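(* Let $\mathcal{E}$ be an extensive, cartesian closed category with finite limits. Then $\mathcal{E}$ has a subobject classifier if and only if the $2$-category $\mathbf{Cat}(\mathcal{E})$ has a full subobject classifier. In this case, the $2$-functor $\mathbf{indisc}:\mathcal{E}\to\mathbf{Cat}(\mathcal{E})$, with $\mathcal{E}$ considered as a locally discrete $2$-category, preserves full subobject classifiers.
   Context: A category with pullbacks is extensive if it has finite coproducts and for all $A,B$ the functor $\mathcal{E}/A\times\mathcal{E}/B\to\mathcal{E}/(A+B)$ taking coproducts is an equivalence. $\mathbf{Cat}(\mathcal{E})$ is the $2$-category of categories, functors and natural transformations internal to $\mathcal{E}$. $\mathbf{indisc}(X)$ is the indiscrete internal category on $X$: object of objects $X$, object of arrows $X\times X$, with source and target the two product projections. In a $2$-category $\mathcal{K}$, a morphism $i:A\to B$ is a full monomorphism if for every $X\in\mathcal{K}$ the functor $\mathcal{K}(X,i)$ is fully faithful and injective on objects. A full subobject classifier in $\mathcal{K}$ (with terminal object $\underline{\mathbf 1}$) is a full monomorphism $\underline\top:\underline{\mathbf 1}\to\underline\Omega$ such that for every full monomorphism $i:A\to B$ there is a unique $\chi_i:B\to\underline\Omega$ such that the square with sides $i$, $!:A\to\underline{\mathbf 1}$, $\underline\top$, $\chi_i$ is a pullback. In a locally discrete $2$-category (only identity $2$-cells) this is the usual notion of subobject classifier. *)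

theory Defs
  imports Main
begin

section \<open>Categories, functors, equivalences\<close>

record ('o, 'm) cat =
  Ob :: "'o set"
  Ar :: "'m set"
  Dm :: "'m \<Rightarrow> 'o"
  Cd :: "'m \<Rightarrow> 'o"
  Ide :: "'o \<Rightarrow> 'm"
  Cmp :: "'m \<Rightarrow> 'm \<Rightarrow> 'm"  (infixr "\<cdot>\<index>" 70)

definition hom :: "('o, 'm, 'z) cat_scheme \<Rightarrow> 'o \<Rightarrow> 'o \<Rightarrow> 'm set" where
  "hom C a b = {f \<in> Ar C. Dm C f = a \<and> Cd C f = b}"

locale category =
  fixes C :: "('o, 'm, 'z) cat_scheme" (structure)
  assumes dom_in: "f \<in> Ar C \<Longrightarrow> Dm C f \<in> Ob C"
    and cod_in: "f \<in> Ar C \<Longrightarrow> Cd C f \<in> Ob C"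
    and id_in: "a \<in> Ob C \<Longrightarrow> Ide C a \<in> hom C a a"
    and comp_in: "f \<in> hom C a b \<Longrightarrow> g \<in> hom C b c \<Longrightarrow> g \<cdot> f \<in> hom C a c"
    and id_left: "f \<in> hom C a b \<Longrightarrow> Ide C b \<cdot> f = f"
    and id_right: "f \<in> hom C a b \<Longrightarrow> f \<cdot> Ide C a = f"
    and assoc: "f \<in> hom C a b \<Longrightarrow> g \<in> hom C b c \<Longrightarrow> h \<in> hom C c d \<Longrightarrow> (h \<cdot> g) \<cdot> f = h \<cdot> (g \<cdot> f)"

record ('o, 'm, 'p, 'n) fctr =
  fobj :: "'o \<Rightarrow> 'p"
  farr :: "'m \<Rightarrow> 'n"

definition is_functor ::
  "('o, 'm, 'y) cat_scheme \<Rightarrow> ('p, 'n, 'z) cat_scheme \<Rightarrow> ('o, 'm, 'p, 'n) fctr \<Rightarrow> bool" where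
  "is_functor C D F \<longleftrightarrow>
     (\<forall>a \<in> Ob C. fobj F a \<in> Ob D) \<and>
     (\<forall>f \<in> Ar C. farr F f \<in> hom D (fobj F (Dm C f)) (fobj F (Cd C f))) \<and>
     (\<forall>a \<in> Ob C. farr F (Ide C a) = Ide D (fobj F a)) \<and>
     (\<forall>f \<in> Ar C. \<forall>g \<in> Ar C. Dm C g = Cd C f \<longrightarrow>
        farr F (g \<cdot>\<^bsub>C\<^esub> f) = farr F g \<cdot>\<^bsub>D\<^esub> farr F f)"

definition id_fctr :: "('o, 'm, 'o, 'm) fctr" where
  "id_fctr = \<lparr>fobj = (\<lambda>a. a), farr = (\<lambda>f. f)\<rparr>"

definition comp_fctr ::
  "('p, 'n, 'q, 'r) fctr \<Rightarrow> ('o, 'm, 'p, 'n) fctr \<Rightarrow> ('o, 'm, 'q, 'r) fctr" where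
  "comp_fctr G F = \<lparr>fobj = (\<lambda>a. fobj G (fobj F a)), farr = (\<lambda>f. farr G (farr F f))\<rparr>"

definition is_iso :: "('o, 'm, 'z) cat_scheme \<Rightarrow> 'm \<Rightarrow> bool" where
  "is_iso C f \<longleftrightarrow> f \<in> Ar C \<and> (\<exists>g \<in> hom C (Cd C f) (Dm C f).
     g \<cdot>\<^bsub>C\<^esub> f = Ide C (Dm C f) \<and> f \<cdot>\<^bsub>C\<^esub> g = Ide C (Cd C f))"

definition is_nat_iso ::
  "('o, 'm, 'y) cat_scheme \<Rightarrow> ('p, 'n, 'z) cat_scheme \<Rightarrow>
   ('o, 'm, 'p, 'n) fctr \<Rightarrow> ('o, 'm, 'p, 'n) fctr \<Rightarrow> ('o \<Rightarrow> 'n) \<Rightarrow> bool" where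
  "is_nat_iso C D F G \<eta> \<longleftrightarrow>
     (\<forall>a \<in> Ob C. \<eta> a \<in> hom D (fobj F a) (fobj G a) \<and> is_iso D (\<eta> a)) \<and>
     (\<forall>f \<in> Ar C. \<eta> (Cd C f) \<cdot>\<^bsub>D\<^esub> farr F f = farr G f \<cdot>\<^bsub>D\<^esub> \<eta> (Dm C f))"

definition is_equivalence ::
  "('o, 'm, 'y) cat_scheme \<Rightarrow> ('p, 'n, 'z) cat_scheme \<Rightarrow> ('o, 'm, 'p, 'n) fctr \<Rightarrow> bool" where
  "is_equivalence C D F \<longleftrightarrow> is_functor C D F \<and>
     (\<exists>G \<eta> \<epsilon>. is_functor D C G \<and>
        is_nat_iso C C id_fctr (comp_fctr G F) \<eta> \<and>
        is_nat_iso D D (comp_fctr F G) id_fctr \<epsilon>)"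

definition fully_faithful ::
  "('o, 'm, 'y) cat_scheme \<Rightarrow> ('p, 'n, 'z) cat_scheme \<Rightarrow> ('o, 'm, 'p, 'n) fctr \<Rightarrow> bool" where
  "fully_faithful C D F \<longleftrightarrow>
     (\<forall>a \<in> Ob C. \<forall>b \<in> Ob C. bij_betw (farr F) (hom C a b) (hom D (fobj F a) (fobj F b)))"

definition prod_cat :: "('o, 'm, 'y) cat_scheme \<Rightarrow> ('p, 'n, 'z) cat_scheme \<Rightarrow> ('o \<times> 'p, 'm \<times> 'n) cat" where
  "prod_cat C D = \<lparr>Ob = Ob C \<times> Ob D, Ar = Ar C \<times> Ar D,
     Dm = (\<lambda>(f, g). (Dm C f, Dm D g)), Cd = (\<lambda>(f, g). (Cd C f, Cd D g)),
     Ide = (\<lambda>(a, b). (Ide C a, Ide D b)),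
     Cmp = (\<lambda>(f', g') (f, g). (f' \<cdot>\<^bsub>C\<^esub> f, g' \<cdot>\<^bsub>D\<^esub> g))\<rparr>"

text \<open>An arrow \<open>(f, h, g)\<close> of the slice over \<open>A\<close> is the commutative triangle \<open>f = g \<cdot> h\<close>,
  regarded as an arrow from \<open>f\<close> to \<open>g\<close>.\<close>

definition slice_cat :: "('o, 'm, 'z) cat_scheme \<Rightarrow> 'o \<Rightarrow> ('m, 'm \<times> 'm \<times> 'm) cat" where
  "slice_cat C A = \<lparr>Ob = {f \<in> Ar C. Cd C f = A},
     Ar = {(f, h, g). f \<in> Ar C \<and> Cd C f = A \<and> g \<in> Ar C \<and> Cd C g = A \<and>
             h \<in> hom C (Dm C f) (Dm C g) \<and> g \<cdot>\<^bsub>C\<^esub> h = f},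
     Dm = (\<lambda>(f, h, g). f), Cd = (\<lambda>(f, h, g). g),
     Ide = (\<lambda>f. (f, Ide C (Dm C f), f)),
     Cmp = (\<lambda>(g', k, l) (f, h, g). (f, k \<cdot>\<^bsub>C\<^esub> h, l))\<rparr>"


section \<open>Limits and colimits\<close>

definition is_cone ::
  "('o, 'm, 'y) cat_scheme \<Rightarrow> ('j, 'a, 'z) cat_scheme \<Rightarrow> ('j, 'a, 'o, 'm) fctr \<Rightarrow> 'o \<Rightarrow> ('j \<Rightarrow> 'm) \<Rightarrow> bool" where
  "is_cone C J D L p \<longleftrightarrow> L \<in> Ob C \<and> (\<forall>j \<in> Ob J. p j \<in> hom C L (fobj D j)) \<and>
     (\<forall>u \<in> Ar J. farr D u \<cdot>\<^bsub>C\<^esub> p (Dm J u) = p (Cd J u))"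

definition is_limit ::
  "('o, 'm, 'y) cat_scheme \<Rightarrow> ('j, 'a, 'z) cat_scheme \<Rightarrow> ('j, 'a, 'o, 'm) fctr \<Rightarrow> 'o \<Rightarrow> ('j \<Rightarrow> 'm) \<Rightarrow> bool" where
  "is_limit C J D L p \<longleftrightarrow> is_cone C J D L p \<and>
     (\<forall>X x. is_cone C J D X x \<longrightarrow> (\<exists>!h. h \<in> hom C X L \<and> (\<forall>j \<in> Ob J. p j \<cdot>\<^bsub>C\<^esub> h = x j)))"

text \<open>Every finite category is isomorphic to one whose objects and arrows are natural numbers,
  so such index categories suffice.\<close>

definition has_finite_limits :: "('o, 'm, 'z) cat_scheme \<Rightarrow> bool" where
  "has_finite_limits C \<longleftrightarrow>
     (\<forall>(J :: (nat, nat) cat) D. category J \<and> finite (Ob J) \<and> finite (Ar J) \<and> is_functor J C D \<longrightarrow>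
        (\<exists>L p. is_limit C J D L p))"

definition is_terminal :: "('o, 'm, 'z) cat_scheme \<Rightarrow> 'o \<Rightarrow> bool" where
  "is_terminal C T \<longleftrightarrow> T \<in> Ob C \<and> (\<forall>X \<in> Ob C. \<exists>!f. f \<in> hom C X T)"

definition bang :: "('o, 'm, 'z) cat_scheme \<Rightarrow> 'o \<Rightarrow> 'o \<Rightarrow> 'm" where
  "bang C X T = (THE f. f \<in> hom C X T)"

text \<open>\<open>is_pullback C f g p q\<close>: the square \<open>f \<cdot> p = g \<cdot> q\<close> is a pullback of the cospan \<open>f, g\<close>.\<close>

definition is_pullback :: "('o, 'm, 'z) cat_scheme \<Rightarrow> 'm \<Rightarrow> 'm \<Rightarrow> 'm \<Rightarrow> 'm \<Rightarrow> bool" where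
  "is_pullback C f g p q \<longleftrightarrow>
     f \<in> Ar C \<and> g \<in> Ar C \<and> p \<in> Ar C \<and> q \<in> Ar C \<and>
     Cd C f = Cd C g \<and> Dm C p = Dm C q \<and> Cd C p = Dm C f \<and> Cd C q = Dm C g \<and>
     f \<cdot>\<^bsub>C\<^esub> p = g \<cdot>\<^bsub>C\<^esub> q \<and>
     (\<forall>X. \<forall>u \<in> hom C X (Dm C f). \<forall>v \<in> hom C X (Dm C g). f \<cdot>\<^bsub>C\<^esub> u = g \<cdot>\<^bsub>C\<^esub> v \<longrightarrow>
        (\<exists>!h. h \<in> hom C X (Dm C p) \<and> p \<cdot>\<^bsub>C\<^esub> h = u \<and> q \<cdot>\<^bsub>C\<^esub> h = v))"

definition has_pullbacks :: "('o, 'm, 'z) cat_scheme \<Rightarrow> bool" where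
  "has_pullbacks C \<longleftrightarrow>
     (\<forall>f \<in> Ar C. \<forall>g \<in> Ar C. Cd C f = Cd C g \<longrightarrow> (\<exists>p q. is_pullback C f g p q))"

text \<open>Chosen pullback projections, and the induced arrow into the chosen pullback.\<close>

definition pb :: "('o, 'm, 'z) cat_scheme \<Rightarrow> 'm \<Rightarrow> 'm \<Rightarrow> 'm \<times> 'm" where
  "pb C f g = (SOME (p, q). is_pullback C f g p q)"

definition pb1 :: "('o, 'm, 'z) cat_scheme \<Rightarrow> 'm \<Rightarrow> 'm \<Rightarrow> 'm" where
  "pb1 C f g = fst (pb C f g)"

definition pb2 :: "('o, 'm, 'z) cat_scheme \<Rightarrow> 'm \<Rightarrow> 'm \<Rightarrow> 'm" where
  "pb2 C f g = snd (pb C f g)"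

definition pb_obj :: "('o, 'm, 'z) cat_scheme \<Rightarrow> 'm \<Rightarrow> 'm \<Rightarrow> 'o" where
  "pb_obj C f g = Dm C (pb1 C f g)"

definition pb_pair :: "('o, 'm, 'z) cat_scheme \<Rightarrow> 'm \<Rightarrow> 'm \<Rightarrow> 'm \<Rightarrow> 'm \<Rightarrow> 'm" where
  "pb_pair C f g u v = (THE h. h \<in> hom C (Dm C u) (pb_obj C f g) \<and>
     pb1 C f g \<cdot>\<^bsub>C\<^esub> h = u \<and> pb2 C f g \<cdot>\<^bsub>C\<^esub> h = v)"

definition has_finite_products :: "('o, 'm, 'z) cat_scheme \<Rightarrow> bool" where
  "has_finite_products C \<longleftrightarrow>
     (\<forall>(I :: nat set) A. finite I \<and> (\<forall>i \<in> I. A i \<in> Ob C) \<longrightarrow>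
        (\<exists>P \<in> Ob C. \<exists>p. (\<forall>i \<in> I. p i \<in> hom C P (A i)) \<and>
           (\<forall>X \<in> Ob C. \<forall>x. (\<forall>i \<in> I. x i \<in> hom C X (A i)) \<longrightarrow>
              (\<exists>!h. h \<in> hom C X P \<and> (\<forall>i \<in> I. p i \<cdot>\<^bsub>C\<^esub> h = x i)))))"

definition has_finite_coproducts :: "('o, 'm, 'z) cat_scheme \<Rightarrow> bool" where
  "has_finite_coproducts C \<longleftrightarrow>
     (\<forall>(I :: nat set) A. finite I \<and> (\<forall>i \<in> I. A i \<in> Ob C) \<longrightarrow>
        (\<exists>P \<in> Ob C. \<exists>p. (\<forall>i \<in> I. p i \<in> hom C (A i) P) \<and>
           (\<forall>X \<in> Ob C. \<forall>x. (\<forall>i \<in> I. x i \<in> hom C (A i) X) \<longrightarrow>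
              (\<exists>!h. h \<in> hom C P X \<and> (\<forall>i \<in> I. h \<cdot>\<^bsub>C\<^esub> p i = x i)))))"

definition is_product :: "('o, 'm, 'z) cat_scheme \<Rightarrow> 'o \<Rightarrow> 'o \<Rightarrow> 'm \<Rightarrow> 'm \<Rightarrow> bool" where
  "is_product C A B p q \<longleftrightarrow>
     p \<in> hom C (Dm C p) A \<and> q \<in> hom C (Dm C p) B \<and>
     (\<forall>X. \<forall>u \<in> hom C X A. \<forall>v \<in> hom C X B.
        \<exists>!h. h \<in> hom C X (Dm C p) \<and> p \<cdot>\<^bsub>C\<^esub> h = u \<and> q \<cdot>\<^bsub>C\<^esub> h = v)"

definition pr :: "('o, 'm, 'z) cat_scheme \<Rightarrow> 'o \<Rightarrow> 'o \<Rightarrow> 'm \<times> 'm" where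
  "pr C A B = (SOME (p, q). is_product C A B p q)"

definition pr1 :: "('o, 'm, 'z) cat_scheme \<Rightarrow> 'o \<Rightarrow> 'o \<Rightarrow> 'm" where
  "pr1 C A B = fst (pr C A B)"

definition pr2 :: "('o, 'm, 'z) cat_scheme \<Rightarrow> 'o \<Rightarrow> 'o \<Rightarrow> 'm" where
  "pr2 C A B = snd (pr C A B)"

definition pr_obj :: "('o, 'm, 'z) cat_scheme \<Rightarrow> 'o \<Rightarrow> 'o \<Rightarrow> 'o" where
  "pr_obj C A B = Dm C (pr1 C A B)"

definition pr_pair :: "('o, 'm, 'z) cat_scheme \<Rightarrow> 'm \<Rightarrow> 'm \<Rightarrow> 'm" where
  "pr_pair C u v = (THE h. h \<in> hom C (Dm C u) (pr_obj C (Cd C u) (Cd C v)) \<and>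
     pr1 C (Cd C u) (Cd C v) \<cdot>\<^bsub>C\<^esub> h = u \<and> pr2 C (Cd C u) (Cd C v) \<cdot>\<^bsub>C\<^esub> h = v)"

definition pr_map :: "('o, 'm, 'z) cat_scheme \<Rightarrow> 'm \<Rightarrow> 'm \<Rightarrow> 'm" where
  "pr_map C f g = pr_pair C (f \<cdot>\<^bsub>C\<^esub> pr1 C (Dm C f) (Dm C g)) (g \<cdot>\<^bsub>C\<^esub> pr2 C (Dm C f) (Dm C g))"

definition is_coproduct :: "('o, 'm, 'z) cat_scheme \<Rightarrow> 'o \<Rightarrow> 'o \<Rightarrow> 'm \<Rightarrow> 'm \<Rightarrow> bool" where
  "is_coproduct C A B i j \<longleftrightarrow>
     i \<in> hom C A (Cd C i) \<and> j \<in> hom C B (Cd C i) \<and>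
     (\<forall>X. \<forall>u \<in> hom C A X. \<forall>v \<in> hom C B X.
        \<exists>!h. h \<in> hom C (Cd C i) X \<and> h \<cdot>\<^bsub>C\<^esub> i = u \<and> h \<cdot>\<^bsub>C\<^esub> j = v)"

definition coproj :: "('o, 'm, 'z) cat_scheme \<Rightarrow> 'o \<Rightarrow> 'o \<Rightarrow> 'm \<times> 'm" where
  "coproj C A B = (SOME (i, j). is_coproduct C A B i j)"

definition coproj1 :: "('o, 'm, 'z) cat_scheme \<Rightarrow> 'o \<Rightarrow> 'o \<Rightarrow> 'm" where
  "coproj1 C A B = fst (coproj C A B)"

definition coproj2 :: "('o, 'm, 'z) cat_scheme \<Rightarrow> 'o \<Rightarrow> 'o \<Rightarrow> 'm" where
  "coproj2 C A B = snd (coproj C A B)"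

definition cop_obj :: "('o, 'm, 'z) cat_scheme \<Rightarrow> 'o \<Rightarrow> 'o \<Rightarrow> 'o" where
  "cop_obj C A B = Cd C (coproj1 C A B)"

definition cop_pair :: "('o, 'm, 'z) cat_scheme \<Rightarrow> 'm \<Rightarrow> 'm \<Rightarrow> 'm" where
  "cop_pair C u v = (THE h. h \<in> hom C (cop_obj C (Dm C u) (Dm C v)) (Cd C u) \<and>
     h \<cdot>\<^bsub>C\<^esub> coproj1 C (Dm C u) (Dm C v) = u \<and> h \<cdot>\<^bsub>C\<^esub> coproj2 C (Dm C u) (Dm C v) = v)"

definition cop_map :: "('o, 'm, 'z) cat_scheme \<Rightarrow> 'm \<Rightarrow> 'm \<Rightarrow> 'm" where
  "cop_map C f g = cop_pair C (coproj1 C (Cd C f) (Cd C g) \<cdot>\<^bsub>C\<^esub> f) (coproj2 C (Cd C f) (Cd C g) \<cdot>\<^bsub>C\<^esub> g)"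


section \<open>Extensive and cartesian closed categories\<close>

definition coproduct_fctr ::
  "('o, 'm, 'z) cat_scheme \<Rightarrow> ('m \<times> 'm, ('m \<times> 'm \<times> 'm) \<times> ('m \<times> 'm \<times> 'm), 'm, 'm \<times> 'm \<times> 'm) fctr" where
  "coproduct_fctr C = \<lparr>fobj = (\<lambda>(f, g). cop_map C f g),
     farr = (\<lambda>((f, h, f'), (g, k, g')). (cop_map C f g, cop_map C h k, cop_map C f' g'))\<rparr>"

definition extensive :: "('o, 'm, 'z) cat_scheme \<Rightarrow> bool" where
  "extensive C \<longleftrightarrow> has_pullbacks C \<and> has_finite_coproducts C \<and>
     (\<forall>A \<in> Ob C. \<forall>B \<in> Ob C.
        is_equivalence (prod_cat (slice_cat C A) (slice_cat C B)) (slice_cat C (cop_obj C A B))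
          (coproduct_fctr C))"

definition is_exponential :: "('o, 'm, 'z) cat_scheme \<Rightarrow> 'o \<Rightarrow> 'o \<Rightarrow> 'o \<Rightarrow> 'm \<Rightarrow> bool" where
  "is_exponential C A B X ev \<longleftrightarrow> X \<in> Ob C \<and> ev \<in> hom C (pr_obj C X A) B \<and>
     (\<forall>Z \<in> Ob C. \<forall>f \<in> hom C (pr_obj C Z A) B.
        \<exists>!g. g \<in> hom C Z X \<and> ev \<cdot>\<^bsub>C\<^esub> pr_map C g (Ide C A) = f)"

definition cartesian_closed :: "('o, 'm, 'z) cat_scheme \<Rightarrow> bool" where
  "cartesian_closed C \<longleftrightarrow> has_finite_products C \<and>
     (\<forall>A \<in> Ob C. \<forall>B \<in> Ob C. \<exists>X ev. is_exponential C A B X ev)"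


section \<open>Strict 2-categories\<close>

text \<open>\<open>VComp K \<beta> \<alpha>\<close> is the vertical composite of \<open>\<alpha> : f \<Rightarrow> g\<close> and \<open>\<beta> : g \<Rightarrow> h\<close>;
  \<open>HComp K \<beta> \<alpha> : g \<cdot> f \<Rightarrow> g' \<cdot> f'\<close> is the horizontal composite of \<open>\<alpha> : f \<Rightarrow> f' : A \<rightarrow> B\<close>
  and \<open>\<beta> : g \<Rightarrow> g' : B \<rightarrow> C\<close>.\<close>

record ('o, 'm, 'c) twocat = "('o, 'm) cat" +
  Cell :: "'c set"
  VSrc :: "'c \<Rightarrow> 'm"
  VTrg :: "'c \<Rightarrow> 'm"
  VId :: "'m \<Rightarrow> 'c"
  VComp :: "'c \<Rightarrow> 'c \<Rightarrow> 'c"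
  HComp :: "'c \<Rightarrow> 'c \<Rightarrow> 'c"

definition hom_cat :: "('o, 'm, 'c) twocat \<Rightarrow> 'o \<Rightarrow> 'o \<Rightarrow> ('m, 'c) cat" where
  "hom_cat K X Y = \<lparr>Ob = hom K X Y,
     Ar = {\<alpha> \<in> Cell K. VSrc K \<alpha> \<in> hom K X Y \<and> VTrg K \<alpha> \<in> hom K X Y},
     Dm = VSrc K, Cd = VTrg K, Ide = VId K, Cmp = VComp K\<rparr>"

locale two_category = category K for K :: "('o, 'm, 'c) twocat" +
  assumes cell_in: "\<alpha> \<in> Cell K \<Longrightarrow> \<exists>X \<in> Ob K. \<exists>Y \<in> Ob K. \<alpha> \<in> Ar (hom_cat K X Y)"
    and hom_category: "X \<in> Ob K \<Longrightarrow> Y \<in> Ob K \<Longrightarrow> category (hom_cat K X Y)"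
    and HComp_in: "f \<in> hom K X Y \<Longrightarrow> f' \<in> hom K X Y \<Longrightarrow> g \<in> hom K Y Z \<Longrightarrow> g' \<in> hom K Y Z \<Longrightarrow>
      \<alpha> \<in> hom (hom_cat K X Y) f f' \<Longrightarrow> \<beta> \<in> hom (hom_cat K Y Z) g g' \<Longrightarrow>
      HComp K \<beta> \<alpha> \<in> hom (hom_cat K X Z) (g \<cdot>\<^bsub>K\<^esub> f) (g' \<cdot>\<^bsub>K\<^esub> f')"
    and HComp_VId: "f \<in> hom K X Y \<Longrightarrow> g \<in> hom K Y Z \<Longrightarrow>
      HComp K (VId K g) (VId K f) = VId K (g \<cdot>\<^bsub>K\<^esub> f)"
    and interchange:
      "\<alpha> \<in> hom (hom_cat K X Y) f f' \<Longrightarrow> \<alpha>' \<in> hom (hom_cat K X Y) f' f'' \<Longrightarrow>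
       \<beta> \<in> hom (hom_cat K Y Z) g g' \<Longrightarrow> \<beta>' \<in> hom (hom_cat K Y Z) g' g'' \<Longrightarrow>
       HComp K (VComp K \<beta>' \<beta>) (VComp K \<alpha>' \<alpha>) = VComp K (HComp K \<beta>' \<alpha>') (HComp K \<beta> \<alpha>)"
    and HComp_assoc:
      "\<alpha> \<in> Ar (hom_cat K W X) \<Longrightarrow> \<beta> \<in> Ar (hom_cat K X Y) \<Longrightarrow> \<gamma> \<in> Ar (hom_cat K Y Z) \<Longrightarrow>
       HComp K (HComp K \<gamma> \<beta>) \<alpha> = HComp K \<gamma> (HComp K \<beta> \<alpha>)"
    and HComp_unit_right: "\<alpha> \<in> Ar (hom_cat K X Y) \<Longrightarrow> HComp K \<alpha> (VId K (Ide K X)) = \<alpha>"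
    and HComp_unit_left: "\<alpha> \<in> Ar (hom_cat K X Y) \<Longrightarrow> HComp K (VId K (Ide K Y)) \<alpha> = \<alpha>"

record ('o, 'm, 'c, 'p, 'n, 'd) two_fctr = "('o, 'm, 'p, 'n) fctr" +
  fcell :: "'c \<Rightarrow> 'd"

definition is_two_functor ::
  "('o, 'm, 'c) twocat \<Rightarrow> ('p, 'n, 'd) twocat \<Rightarrow> ('o, 'm, 'c, 'p, 'n, 'd) two_fctr \<Rightarrow> bool" where
  "is_two_functor K L F \<longleftrightarrow>
     is_functor K L \<lparr>fobj = fobj F, farr = farr F\<rparr> \<and>
     (\<forall>X \<in> Ob K. \<forall>Y \<in> Ob K. is_functor (hom_cat K X Y) (hom_cat L (fobj F X) (fobj F Y))
        \<lparr>fobj = farr F, farr = fcell F\<rparr>) \<and>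
     (\<forall>X Y Z. \<forall>\<alpha> \<in> Ar (hom_cat K X Y). \<forall>\<beta> \<in> Ar (hom_cat K Y Z).
        fcell F (HComp K \<beta> \<alpha>) = HComp L (fcell F \<beta>) (fcell F \<alpha>))"

definition locally_discrete :: "('o, 'm) cat \<Rightarrow> ('o, 'm, 'm) twocat" where
  "locally_discrete C = \<lparr>Ob = Ob C, Ar = Ar C, Dm = Dm C, Cd = Cd C, Ide = Ide C, Cmp = Cmp C,
     Cell = Ar C, VSrc = (\<lambda>f. f), VTrg = (\<lambda>f. f), VId = (\<lambda>f. f),
     VComp = (\<lambda>\<beta> \<alpha>. \<alpha>), HComp = Cmp C\<rparr>"

text \<open>Postcomposition \<open>K(X, i) : K(X, A) \<rightarrow> K(X, B)\<close> for \<open>i : A \<rightarrow> B\<close>.\<close>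

definition post_fctr :: "('o, 'm, 'c) twocat \<Rightarrow> 'm \<Rightarrow> ('m, 'c, 'm, 'c) fctr" where
  "post_fctr K i = \<lparr>fobj = (\<lambda>f. i \<cdot>\<^bsub>K\<^esub> f), farr = (\<lambda>\<alpha>. HComp K (VId K i) \<alpha>)\<rparr>"

definition full_mono :: "('o, 'm, 'c) twocat \<Rightarrow> 'm \<Rightarrow> bool" where
  "full_mono K i \<longleftrightarrow> i \<in> Ar K \<and>
     (\<forall>X \<in> Ob K.
        fully_faithful (hom_cat K X (Dm K i)) (hom_cat K X (Cd K i)) (post_fctr K i) \<and>
        inj_on (fobj (post_fctr K i)) (Ob (hom_cat K X (Dm K i))))"

text \<open>Limits in a 2-category are taken in the strict 2-categorical sense: the universal
  property holds for 1-cells and for 2-cells.\<close>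

definition is_terminal2 :: "('o, 'm, 'c) twocat \<Rightarrow> 'o \<Rightarrow> bool" where
  "is_terminal2 K T \<longleftrightarrow> is_terminal K T \<and>
     (\<forall>X \<in> Ob K. \<exists>!\<alpha>. \<alpha> \<in> Ar (hom_cat K X T))"

definition is_pullback2 :: "('o, 'm, 'c) twocat \<Rightarrow> 'm \<Rightarrow> 'm \<Rightarrow> 'm \<Rightarrow> 'm \<Rightarrow> bool" where
  "is_pullback2 K f g p q \<longleftrightarrow> is_pullback K f g p q \<and>
     (\<forall>X. \<forall>\<alpha> \<in> Ar (hom_cat K X (Dm K f)). \<forall>\<beta> \<in> Ar (hom_cat K X (Dm K g)).
        HComp K (VId K f) \<alpha> = HComp K (VId K g) \<beta> \<longrightarrow>
        (\<exists>!\<gamma>. \<gamma> \<in> Ar (hom_cat K X (Dm K p)) \<and>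
           HComp K (VId K p) \<gamma> = \<alpha> \<and> HComp K (VId K q) \<gamma> = \<beta>))"

definition full_subobject_classifier :: "('o, 'm, 'c) twocat \<Rightarrow> 'm \<Rightarrow> bool" where
  "full_subobject_classifier K t \<longleftrightarrow> full_mono K t \<and> is_terminal2 K (Dm K t) \<and>
     (\<forall>i. full_mono K i \<longrightarrow>
        (\<exists>!\<chi>. \<chi> \<in> hom K (Cd K i) (Cd K t) \<and>
           is_pullback2 K \<chi> t i (bang K (Dm K i) (Dm K t))))"

definition preserves_full_subobject_classifiers ::
  "('o, 'm, 'c) twocat \<Rightarrow> ('p, 'n, 'd) twocat \<Rightarrow> ('o, 'm, 'c, 'p, 'n, 'd) two_fctr \<Rightarrow> bool" where
  "preserves_full_subobject_classifiers K L F \<longleftrightarrow>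
     (\<forall>t. full_subobject_classifier K t \<longrightarrow> full_subobject_classifier L (farr F t))"

definition is_mono :: "('o, 'm, 'z) cat_scheme \<Rightarrow> 'm \<Rightarrow> bool" where
  "is_mono C i \<longleftrightarrow> i \<in> Ar C \<and>
     (\<forall>X. \<forall>f \<in> hom C X (Dm C i). \<forall>g \<in> hom C X (Dm C i). i \<cdot>\<^bsub>C\<^esub> f = i \<cdot>\<^bsub>C\<^esub> g \<longrightarrow> f = g)"

definition subobject_classifier :: "('o, 'm, 'z) cat_scheme \<Rightarrow> 'm \<Rightarrow> bool" where
  "subobject_classifier C t \<longleftrightarrow> is_mono C t \<and> is_terminal C (Dm C t) \<and>
     (\<forall>i. is_mono C i \<longrightarrow>
        (\<exists>!\<chi>. \<chi> \<in> hom C (Cd C i) (Cd C t) \<and>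
           is_pullback C \<chi> t i (bang C (Dm C i) (Dm C t))))"


section \<open>Internal categories\<close>

record ('o, 'm) icat =
  C0 :: 'o
  C1 :: 'o
  isrc :: 'm
  itrg :: 'm
  iid :: 'm
  imul :: 'm

record ('o, 'm) ifun =
  idom :: "('o, 'm) icat"
  icod :: "('o, 'm) icat"
  F0 :: 'm
  F1 :: 'm

record ('o, 'm) inat =
  nsrc :: "('o, 'm) ifun"
  ntrg :: "('o, 'm) ifun"
  ncmp :: 'm

text \<open>The object of composable pairs is the chosen pullback of source and target:
  a generalised element of it is a pair \<open>(g, f)\<close> with source of \<open>g\<close> equal to target of \<open>f\<close>.
  \<open>icmp E A g f\<close> is the internal composite ``\<open>g\<close> after \<open>f\<close>'' of such a pair.\<close>

definition icmp :: "('o, 'm) cat \<Rightarrow> ('o, 'm) icat \<Rightarrow> 'm \<Rightarrow> 'm \<Rightarrow> 'm" where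
  "icmp E A g f = imul A \<cdot>\<^bsub>E\<^esub> pb_pair E (isrc A) (itrg A) g f"

text \<open>In the associativity law the object of composable triples is the pullback of the second
  and the first projection from the object of composable pairs.\<close>

definition internal_category :: "('o, 'm) cat \<Rightarrow> ('o, 'm) icat \<Rightarrow> bool" where
  "internal_category E A \<longleftrightarrow>
     (let s = isrc A; t = itrg A; e = iid A; m = imul A; p = pb1 E s t; q = pb2 E s t;
          pp = pb1 E q p; qq = pb2 E q p in
      C0 A \<in> Ob E \<and> C1 A \<in> Ob E \<and>
      s \<in> hom E (C1 A) (C0 A) \<and> t \<in> hom E (C1 A) (C0 A) \<and> e \<in> hom E (C0 A) (C1 A) \<and>
      m \<in> hom E (pb_obj E s t) (C1 A) \<and>
      s \<cdot>\<^bsub>E\<^esub> e = Ide E (C0 A) \<and> t \<cdot>\<^bsub>E\<^esub> e = Ide E (C0 A) \<and>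
      s \<cdot>\<^bsub>E\<^esub> m = s \<cdot>\<^bsub>E\<^esub> q \<and> t \<cdot>\<^bsub>E\<^esub> m = t \<cdot>\<^bsub>E\<^esub> p \<and>
      icmp E A (e \<cdot>\<^bsub>E\<^esub> t) (Ide E (C1 A)) = Ide E (C1 A) \<and>
      icmp E A (Ide E (C1 A)) (e \<cdot>\<^bsub>E\<^esub> s) = Ide E (C1 A) \<and>
      icmp E A (m \<cdot>\<^bsub>E\<^esub> pp) (q \<cdot>\<^bsub>E\<^esub> qq) = icmp E A (p \<cdot>\<^bsub>E\<^esub> pp) (m \<cdot>\<^bsub>E\<^esub> qq))"

definition internal_functor :: "('o, 'm) cat \<Rightarrow> ('o, 'm) ifun \<Rightarrow> bool" where
  "internal_functor E F \<longleftrightarrow>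
     (let A = idom F; B = icod F; p = pb1 E (isrc A) (itrg A); q = pb2 E (isrc A) (itrg A) in
      internal_category E A \<and> internal_category E B \<and>
      F0 F \<in> hom E (C0 A) (C0 B) \<and> F1 F \<in> hom E (C1 A) (C1 B) \<and>
      isrc B \<cdot>\<^bsub>E\<^esub> F1 F = F0 F \<cdot>\<^bsub>E\<^esub> isrc A \<and> itrg B \<cdot>\<^bsub>E\<^esub> F1 F = F0 F \<cdot>\<^bsub>E\<^esub> itrg A \<and>
      F1 F \<cdot>\<^bsub>E\<^esub> iid A = iid B \<cdot>\<^bsub>E\<^esub> F0 F \<and>
      F1 F \<cdot>\<^bsub>E\<^esub> imul A = icmp E B (F1 F \<cdot>\<^bsub>E\<^esub> p) (F1 F \<cdot>\<^bsub>E\<^esub> q))"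

definition internal_nat :: "('o, 'm) cat \<Rightarrow> ('o, 'm) inat \<Rightarrow> bool" where
  "internal_nat E \<alpha> \<longleftrightarrow>
     (let F = nsrc \<alpha>; G = ntrg \<alpha>; A = idom F; B = icod F in
      internal_functor E F \<and> internal_functor E G \<and> idom G = A \<and> icod G = B \<and>
      ncmp \<alpha> \<in> hom E (C0 A) (C1 B) \<and>
      isrc B \<cdot>\<^bsub>E\<^esub> ncmp \<alpha> = F0 F \<and> itrg B \<cdot>\<^bsub>E\<^esub> ncmp \<alpha> = F0 G \<and>
      icmp E B (ncmp \<alpha> \<cdot>\<^bsub>E\<^esub> itrg A) (F1 F) = icmp E B (F1 G) (ncmp \<alpha> \<cdot>\<^bsub>E\<^esub> isrc A))"

definition ifun_id :: "('o, 'm) cat \<Rightarrow> ('o, 'm) icat \<Rightarrow> ('o, 'm) ifun" where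
  "ifun_id E A = \<lparr>idom = A, icod = A, F0 = Ide E (C0 A), F1 = Ide E (C1 A)\<rparr>"

definition ifun_comp :: "('o, 'm) cat \<Rightarrow> ('o, 'm) ifun \<Rightarrow> ('o, 'm) ifun \<Rightarrow> ('o, 'm) ifun" where
  "ifun_comp E G F = \<lparr>idom = idom F, icod = icod G,
     F0 = F0 G \<cdot>\<^bsub>E\<^esub> F0 F, F1 = F1 G \<cdot>\<^bsub>E\<^esub> F1 F\<rparr>"

definition inat_id :: "('o, 'm) cat \<Rightarrow> ('o, 'm) ifun \<Rightarrow> ('o, 'm) inat" where
  "inat_id E F = \<lparr>nsrc = F, ntrg = F, ncmp = iid (icod F) \<cdot>\<^bsub>E\<^esub> F0 F\<rparr>"

definition inat_vcomp :: "('o, 'm) cat \<Rightarrow> ('o, 'm) inat \<Rightarrow> ('o, 'm) inat \<Rightarrow> ('o, 'm) inat" where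
  "inat_vcomp E \<beta> \<alpha> = \<lparr>nsrc = nsrc \<alpha>, ntrg = ntrg \<beta>,
     ncmp = icmp E (icod (nsrc \<alpha>)) (ncmp \<beta>) (ncmp \<alpha>)\<rparr>"

text \<open>For \<open>\<alpha> : F \<Rightarrow> G\<close> and \<open>\<beta> : H \<Rightarrow> K\<close> the component of the horizontal composite at \<open>x\<close> is
  \<open>\<beta>\<close> at \<open>G x\<close> after \<open>H\<close> applied to \<open>\<alpha>\<close> at \<open>x\<close>.\<close>

definition inat_hcomp :: "('o, 'm) cat \<Rightarrow> ('o, 'm) inat \<Rightarrow> ('o, 'm) inat \<Rightarrow> ('o, 'm) inat" where
  "inat_hcomp E \<beta> \<alpha> = \<lparr>nsrc = ifun_comp E (nsrc \<beta>) (nsrc \<alpha>), ntrg = ifun_comp E (ntrg \<beta>) (ntrg \<alpha>),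
     ncmp = icmp E (icod (nsrc \<beta>)) (ncmp \<beta> \<cdot>\<^bsub>E\<^esub> F0 (ntrg \<alpha>)) (F1 (nsrc \<beta>) \<cdot>\<^bsub>E\<^esub> ncmp \<alpha>)\<rparr>"

definition Cat :: "('o, 'm) cat \<Rightarrow> (('o, 'm) icat, ('o, 'm) ifun, ('o, 'm) inat) twocat" where
  "Cat E = \<lparr>Ob = {A. internal_category E A}, Ar = {F. internal_functor E F},
     Dm = idom, Cd = icod, Ide = ifun_id E, Cmp = ifun_comp E,
     Cell = {\<alpha>. internal_nat E \<alpha>}, VSrc = nsrc, VTrg = ntrg, VId = inat_id E,
     VComp = inat_vcomp E, HComp = inat_hcomp E\<rparr>"

text \<open>The composite of \<open>(y, z)\<close> after \<open>(x, y)\<close> in the indiscrete category is \<open>(x, z)\<close>.\<close>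

definition indisc_obj :: "('o, 'm) cat \<Rightarrow> 'o \<Rightarrow> ('o, 'm) icat" where
  "indisc_obj E X = (let s = pr1 E X X; t = pr2 E X X in
     \<lparr>C0 = X, C1 = pr_obj E X X, isrc = s, itrg = t, iid = pr_pair E (Ide E X) (Ide E X),
      imul = pr_pair E (s \<cdot>\<^bsub>E\<^esub> pb2 E s t) (t \<cdot>\<^bsub>E\<^esub> pb1 E s t)\<rparr>)"

definition indisc_arr :: "('o, 'm) cat \<Rightarrow> 'm \<Rightarrow> ('o, 'm) ifun" where
  "indisc_arr E f = \<lparr>idom = indisc_obj E (Dm E f), icod = indisc_obj E (Cd E f),
     F0 = f, F1 = pr_map E f f\<rparr>"

text \<open>In the locally discrete 2-category on \<open>E\<close> the arrow \<open>f\<close> also serves as the identity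
  2-cell on \<open>f\<close>.\<close>

definition indisc ::
  "('o, 'm) cat \<Rightarrow> ('o, 'm, 'm, ('o, 'm) icat, ('o, 'm) ifun, ('o, 'm) inat) two_fctr" where
  "indisc E = \<lparr>fobj = indisc_obj E, farr = indisc_arr E,
     fcell = (\<lambda>f. inat_id E (indisc_arr E f))\<rparr>"



section \<open>Internal categories form a 2-category\<close>

lemma homI: "f \<in> Ar C \<Longrightarrow> Dm C f = a \<Longrightarrow> Cd C f = b \<Longrightarrow> f \<in> hom C a b"
  and hom_Ar: "f \<in> hom C a b \<Longrightarrow> f \<in> Ar C"
  and hom_Dm: "f \<in> hom C a b \<Longrightarrow> Dm C f = a"
  and hom_Cd: "f \<in> hom C a b \<Longrightarrow> Cd C f = b"
  by (auto simp: hom_def)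

lemma (in category) hom_Ob1: "f \<in> hom C a b \<Longrightarrow> a \<in> Ob C"
  and hom_Ob2: "f \<in> hom C a b \<Longrightarrow> b \<in> Ob C"
  using dom_in cod_in by (auto simp: hom_def)

lemma pb_is_pullback:
  assumes "has_pullbacks C" "f \<in> hom C a c" "g \<in> hom C b c"
  shows "is_pullback C f g (pb1 C f g) (pb2 C f g)"
proof -
  have "\<exists>x. case x of (p, q) \<Rightarrow> is_pullback C f g p q"
    using assms by (auto simp: has_pullbacks_def hom_def)
  from someI_ex[OF this] show ?thesis by (simp add: pb1_def pb2_def pb_def case_prod_unfold)
qed

locale pullback_category = category E for E :: "('o, 'm) cat" (structure) +
  assumes pbs: "has_pullbacks E"
begin

lemma pb1_in: "f \<in> hom E a c \<Longrightarrow> g \<in> hom E b c \<Longrightarrow> pb1 E f g \<in> hom E (pb_obj E f g) a"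
  and pb2_in: "f \<in> hom E a c \<Longrightarrow> g \<in> hom E b c \<Longrightarrow> pb2 E f g \<in> hom E (pb_obj E f g) b"
  and pb_comm: "f \<in> hom E a c \<Longrightarrow> g \<in> hom E b c \<Longrightarrow> f \<cdot> pb1 E f g = g \<cdot> pb2 E f g"
  using pb_is_pullback[OF pbs, of f a c g b]
  by (auto simp: is_pullback_def hom_def pb_obj_def)

lemma pb_ex1:
  assumes "f \<in> hom E a c" "g \<in> hom E b c" "u \<in> hom E X a" "v \<in> hom E X b" "f \<cdot> u = g \<cdot> v"
  shows "\<exists>!h. h \<in> hom E X (pb_obj E f g) \<and> pb1 E f g \<cdot> h = u \<and> pb2 E f g \<cdot> h = v"
proof -
  have "Dm E f = a" "Dm E g = b" using assms by (auto simp: hom_def)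
  then show ?thesis using pb_is_pullback[OF pbs assms(1,2)] assms(3-5)
    unfolding is_pullback_def pb_obj_def by blast
qed

lemma pair_facts:
  assumes "f \<in> hom E a c" "g \<in> hom E b c" "u \<in> hom E X a" "v \<in> hom E X b" "f \<cdot> u = g \<cdot> v"
  shows "pb_pair E f g u v \<in> hom E X (pb_obj E f g)"
    and "pb1 E f g \<cdot> pb_pair E f g u v = u" and "pb2 E f g \<cdot> pb_pair E f g u v = v"
  using theI'[OF pb_ex1[OF assms]] hom_Dm[OF assms(3)] unfolding pb_pair_def by auto

lemma pair_unique:
  assumes "f \<in> hom E a c" "g \<in> hom E b c" "h \<in> hom E X (pb_obj E f g)"
  shows "pb_pair E f g (pb1 E f g \<cdot> h) (pb2 E f g \<cdot> h) = h"
proof -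
  have u: "pb1 E f g \<cdot> h \<in> hom E X a" "pb2 E f g \<cdot> h \<in> hom E X b"
    using assms pb1_in pb2_in comp_in by blast+
  have e: "f \<cdot> (pb1 E f g \<cdot> h) = g \<cdot> (pb2 E f g \<cdot> h)"
    using assoc[OF assms(3) pb1_in[OF assms(1,2)] assms(1)] assoc[OF assms(3) pb2_in[OF assms(1,2)] assms(2)]
      pb_comm[OF assms(1,2)] by simp
  show ?thesis using pb_ex1[OF assms(1,2) u e] pair_facts[OF assms(1,2) u e] assms(3) by blast
qed

lemma pair_comp:
  assumes "f \<in> hom E a c" "g \<in> hom E b c" "u \<in> hom E X a" "v \<in> hom E X b" "f \<cdot> u = g \<cdot> v"
    "k \<in> hom E Y X"
  shows "pb_pair E f g u v \<cdot> k = pb_pair E f g (u \<cdot> k) (v \<cdot> k)"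
proof -
  note p = pair_facts[OF assms(1-5)]
  have h: "pb_pair E f g u v \<cdot> k \<in> hom E Y (pb_obj E f g)" using p assms comp_in by blast
  show ?thesis using pair_unique[OF assms(1,2) h]
      assoc[OF assms(6) p(1) pb1_in[OF assms(1,2)]] assoc[OF assms(6) p(1) pb2_in[OF assms(1,2)]] p
    by simp
qed

end

locale internal_cat = pullback_category +
  fixes A :: "('o, 'm) icat"
  assumes A: "internal_category E A"
begin

lemma ic_types:
  "C0 A \<in> Ob E" "C1 A \<in> Ob E"
  "isrc A \<in> hom E (C1 A) (C0 A)" "itrg A \<in> hom E (C1 A) (C0 A)" "iid A \<in> hom E (C0 A) (C1 A)"
  "imul A \<in> hom E (pb_obj E (isrc A) (itrg A)) (C1 A)"
  using A by (auto simp: internal_category_def Let_def)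

lemma src_id: "x \<in> hom E X (C0 A) \<Longrightarrow> isrc A \<cdot> (iid A \<cdot> x) = x"
  and trg_id: "x \<in> hom E X (C0 A) \<Longrightarrow> itrg A \<cdot> (iid A \<cdot> x) = x"
proof -
  assume x: "x \<in> hom E X (C0 A)"
  have "isrc A \<cdot> iid A = Ide E (C0 A)" "itrg A \<cdot> iid A = Ide E (C0 A)"
    using A by (auto simp: internal_category_def Let_def)
  then show "isrc A \<cdot> (iid A \<cdot> x) = x" "itrg A \<cdot> (iid A \<cdot> x) = x"
    using assoc[OF x ic_types(5) ic_types(3)] assoc[OF x ic_types(5) ic_types(4)] id_left[OF x] by auto
qed

lemma icmp_comp:
  assumes "g \<in> hom E X (C1 A)" "f \<in> hom E X (C1 A)" "isrc A \<cdot> g = itrg A \<cdot> f"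
    and k: "k \<in> hom E Y X"
  shows "icmp E A g f \<cdot> k = icmp E A (g \<cdot> k) (f \<cdot> k)"
  unfolding icmp_def
  using assoc[OF k pair_facts(1)[OF ic_types(3,4) assms(1-3)] ic_types(6)]
    pair_comp[OF ic_types(3,4) assms] by simp

lemma icmp_facts:
  assumes "g \<in> hom E X (C1 A)" "f \<in> hom E X (C1 A)" "isrc A \<cdot> g = itrg A \<cdot> f"
  shows "icmp E A g f \<in> hom E X (C1 A)"
    and "isrc A \<cdot> icmp E A g f = isrc A \<cdot> f"
    and "itrg A \<cdot> icmp E A g f = itrg A \<cdot> g"
proof -
  note p = pair_facts[OF ic_types(3,4) assms]
  show "icmp E A g f \<in> hom E X (C1 A)" unfolding icmp_def using p(1) ic_types(6) comp_in by blast
  have s: "isrc A \<cdot> imul A = isrc A \<cdot> pb2 E (isrc A) (itrg A)"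
    and t: "itrg A \<cdot> imul A = itrg A \<cdot> pb1 E (isrc A) (itrg A)"
    using A by (auto simp: internal_category_def Let_def)
  show "isrc A \<cdot> icmp E A g f = isrc A \<cdot> f" unfolding icmp_def
    using assoc[OF p(1) ic_types(6) ic_types(3)] s
      assoc[OF p(1) pb2_in[OF ic_types(3,4)] ic_types(3)] p by simp
  show "itrg A \<cdot> icmp E A g f = itrg A \<cdot> g" unfolding icmp_def
    using assoc[OF p(1) ic_types(6) ic_types(4)] t
      assoc[OF p(1) pb1_in[OF ic_types(3,4)] ic_types(4)] p by simp
qed

lemma icmp_id_left:
  assumes f: "f \<in> hom E X (C1 A)"
  shows "icmp E A (iid A \<cdot> (itrg A \<cdot> f)) f = f"
proof -
  have I: "Ide E (C1 A) \<in> hom E (C1 A) (C1 A)" using id_in ic_types by blast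
  have et: "iid A \<cdot> itrg A \<in> hom E (C1 A) (C1 A)" using ic_types comp_in by blast
  have "icmp E A (iid A \<cdot> itrg A) (Ide E (C1 A)) = Ide E (C1 A)"
    using A by (auto simp: internal_category_def Let_def)
  moreover have "isrc A \<cdot> (iid A \<cdot> itrg A) = itrg A \<cdot> Ide E (C1 A)"
    using src_id[OF ic_types(4)] id_right[OF ic_types(4)] by simp
  ultimately show ?thesis using icmp_comp[OF et I _ f] id_left[OF f] assoc[OF f ic_types(4,5)] by simp
qed

lemma icmp_id_right:
  assumes f: "f \<in> hom E X (C1 A)"
  shows "icmp E A f (iid A \<cdot> (isrc A \<cdot> f)) = f"
proof -
  have I: "Ide E (C1 A) \<in> hom E (C1 A) (C1 A)" using id_in ic_types by blast
  have es: "iid A \<cdot> isrc A \<in> hom E (C1 A) (C1 A)" using ic_types comp_in by blast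
  have "icmp E A (Ide E (C1 A)) (iid A \<cdot> isrc A) = Ide E (C1 A)"
    using A by (auto simp: internal_category_def Let_def)
  moreover have "isrc A \<cdot> Ide E (C1 A) = itrg A \<cdot> (iid A \<cdot> isrc A)"
    using trg_id[OF ic_types(3)] id_right[OF ic_types(3)] by simp
  ultimately show ?thesis using icmp_comp[OF I es _ f] id_left[OF f] assoc[OF f ic_types(3,5)] by simp
qed

lemma icmp_assoc:
  assumes h: "h \<in> hom E X (C1 A)" and g: "g \<in> hom E X (C1 A)" and f: "f \<in> hom E X (C1 A)"
    and hg: "isrc A \<cdot> h = itrg A \<cdot> g" and gf: "isrc A \<cdot> g = itrg A \<cdot> f"
  shows "icmp E A (icmp E A h g) f = icmp E A h (icmp E A g f)"
proof -
  define p q where "p = pb1 E (isrc A) (itrg A)" and "q = pb2 E (isrc A) (itrg A)"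
  define pp qq where "pp = pb1 E q p" and "qq = pb2 E q p"
  let ?P = "pb_obj E (isrc A) (itrg A)" let ?m = "imul A"
  have p: "p \<in> hom E ?P (C1 A)" and q: "q \<in> hom E ?P (C1 A)"
    unfolding p_def q_def using pb1_in pb2_in ic_types by blast+
  have spq: "isrc A \<cdot> p = itrg A \<cdot> q" unfolding p_def q_def using pb_comm ic_types by blast
  have pp: "pp \<in> hom E (pb_obj E q p) ?P" and qq: "qq \<in> hom E (pb_obj E q p) ?P"
    unfolding pp_def qq_def using pb1_in pb2_in p q by blast+
  have com: "q \<cdot> pp = p \<cdot> qq" unfolding pp_def qq_def using pb_comm p q by blast
  have ax: "icmp E A (?m \<cdot> pp) (q \<cdot> qq) = icmp E A (p \<cdot> pp) (?m \<cdot> qq)"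
    using A unfolding internal_category_def Let_def p_def q_def pp_def qq_def by blast
  define u v where "u = pb_pair E (isrc A) (itrg A) h g" and "v = pb_pair E (isrc A) (itrg A) g f"
  note hg' = pair_facts[OF ic_types(3,4) h g hg, folded p_def q_def u_def]
  note gf' = pair_facts[OF ic_types(3,4) g f gf, folded p_def q_def v_def]
  have uv: "q \<cdot> u = p \<cdot> v" using hg' gf' by simp
  define w where "w = pb_pair E q p u v"
  note w = pair_facts[OF q p hg'(1) gf'(1) uv, folded pp_def qq_def w_def]
  note m = ic_types(6) and s = ic_types(3) and t = ic_types(4)
  have sm: "isrc A \<cdot> ?m = isrc A \<cdot> q" "itrg A \<cdot> ?m = itrg A \<cdot> p"
    using A by (auto simp: internal_category_def Let_def p_def q_def)
  have c1: "isrc A \<cdot> (?m \<cdot> pp) = itrg A \<cdot> (q \<cdot> qq)"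
  proof -
    have "isrc A \<cdot> (?m \<cdot> pp) = isrc A \<cdot> (q \<cdot> pp)"
      using assoc[OF pp m s] assoc[OF pp q s] sm by simp
    also have "\<dots> = itrg A \<cdot> (q \<cdot> qq)" using com assoc[OF qq p s] assoc[OF qq q t] spq by simp
    finally show ?thesis .
  qed
  have c2: "isrc A \<cdot> (p \<cdot> pp) = itrg A \<cdot> (?m \<cdot> qq)"
  proof -
    have "isrc A \<cdot> (p \<cdot> pp) = itrg A \<cdot> (q \<cdot> pp)"
      using assoc[OF pp p s] assoc[OF pp q t] spq by simp
    also have "\<dots> = itrg A \<cdot> (?m \<cdot> qq)" using com assoc[OF qq p t] assoc[OF qq m t] sm by simp
    finally show ?thesis .
  qed
  note mpp = comp_in[OF pp m] and qqq = comp_in[OF qq q] and ppp = comp_in[OF pp p] and mqq = comp_in[OF qq m]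
  have "icmp E A (?m \<cdot> pp) (q \<cdot> qq) \<cdot> w = icmp E A (icmp E A h g) f"
    using icmp_comp[OF mpp qqq c1 w(1)] assoc[OF w(1) pp m] assoc[OF w(1) qq q] w gf' hg'
    by (simp add: icmp_def[of E A h g] u_def)
  moreover have "icmp E A (p \<cdot> pp) (?m \<cdot> qq) \<cdot> w = icmp E A h (icmp E A g f)"
    using icmp_comp[OF ppp mqq c2 w(1)] assoc[OF w(1) qq m] assoc[OF w(1) pp p] w gf' hg'
    by (simp add: icmp_def[of E A g f] v_def)
  ultimately show ?thesis using ax by simp
qed

end

context pullback_category begin

lemma ic: "internal_category E A \<Longrightarrow> internal_cat E A"
  by unfold_locales

lemmas ic_simps = internal_cat.ic_types[OF ic] 

lemma fun_facts:
  assumes "internal_functor E F"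
  shows "internal_category E (idom F)" "internal_category E (icod F)"
    "F0 F \<in> hom E (C0 (idom F)) (C0 (icod F))" "F1 F \<in> hom E (C1 (idom F)) (C1 (icod F))"
    "F1 F \<cdot> iid (idom F) = iid (icod F) \<cdot> F0 F"
    "isrc (icod F) \<cdot> F1 F = F0 F \<cdot> isrc (idom F)" "itrg (icod F) \<cdot> F1 F = F0 F \<cdot> itrg (idom F)"
  using assms by (auto simp: internal_functor_def Let_def)

lemma fun_src:
  assumes F: "internal_functor E F" and f: "f \<in> hom E X (C1 (idom F))"
  shows "isrc (icod F) \<cdot> (F1 F \<cdot> f) = F0 F \<cdot> (isrc (idom F) \<cdot> f)"
    and "itrg (icod F) \<cdot> (F1 F \<cdot> f) = F0 F \<cdot> (itrg (idom F) \<cdot> f)"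
proof -
  note a = fun_facts[OF F]
  show "isrc (icod F) \<cdot> (F1 F \<cdot> f) = F0 F \<cdot> (isrc (idom F) \<cdot> f)"
    using assoc[OF f a(4) ic_simps(3)[OF a(2)]] assoc[OF f ic_simps(3)[OF a(1)] a(3)] a by simp
  show "itrg (icod F) \<cdot> (F1 F \<cdot> f) = F0 F \<cdot> (itrg (idom F) \<cdot> f)"
    using assoc[OF f a(4) ic_simps(4)[OF a(2)]] assoc[OF f ic_simps(4)[OF a(1)] a(3)] a by simp
qed

lemma fun_id:
  assumes F: "internal_functor E F" and x: "x \<in> hom E X (C0 (idom F))"
  shows "F1 F \<cdot> (iid (idom F) \<cdot> x) = iid (icod F) \<cdot> (F0 F \<cdot> x)"
proof -
  note a = fun_facts[OF F]
  show ?thesis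
    using assoc[OF x ic_simps(5)[OF a(1)] a(4)] assoc[OF x a(3) ic_simps(5)[OF a(2)]] a by simp
qed

lemma fun_icmp:
  assumes F: "internal_functor E F" and g: "g \<in> hom E X (C1 (idom F))" and f: "f \<in> hom E X (C1 (idom F))"
    and gf: "isrc (idom F) \<cdot> g = itrg (idom F) \<cdot> f"
  shows "F1 F \<cdot> icmp E (idom F) g f = icmp E (icod F) (F1 F \<cdot> g) (F1 F \<cdot> f)"
proof -
  note a = fun_facts[OF F]
  let ?s = "isrc (idom F)" let ?t = "itrg (idom F)"
  note st = ic_simps(3)[OF a(1)] ic_simps(4)[OF a(1)]
  have ax: "F1 F \<cdot> imul (idom F) = icmp E (icod F) (F1 F \<cdot> pb1 E ?s ?t) (F1 F \<cdot> pb2 E ?s ?t)"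
    using F unfolding internal_functor_def Let_def by blast
  note h = pair_facts[OF st g f gf]
  note p = pb1_in[OF st] and q = pb2_in[OF st]
  have c: "isrc (icod F) \<cdot> (F1 F \<cdot> pb1 E ?s ?t) = itrg (icod F) \<cdot> (F1 F \<cdot> pb2 E ?s ?t)"
    using fun_src[OF F p] fun_src[OF F q] pb_comm[OF st] by simp
  show ?thesis
    using assoc[OF h(1) ic_simps(6)[OF a(1)] a(4)] ax
      internal_cat.icmp_comp[OF ic[OF a(2)] comp_in[OF p a(4)] comp_in[OF q a(4)] c h(1)]
      assoc[OF h(1) p a(4)] assoc[OF h(1) q a(4)] h
    by (simp add: icmp_def[of E "idom F" g f])
qed

lemma fun_id_in:
  assumes "internal_category E A" shows "internal_functor E (ifun_id E A)"
proof -
  note a = ic_simps[OF assms]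
  let ?s = "isrc A" let ?t = "itrg A"
  note p = pb1_in[OF a(3,4)] and q = pb2_in[OF a(3,4)]
  have "pb_pair E ?s ?t (pb1 E ?s ?t) (pb2 E ?s ?t) = Ide E (pb_obj E ?s ?t)"
    using pair_unique[OF a(3,4) id_in[OF hom_Ob1[OF p]]] id_right[OF p] id_right[OF q] by simp
  then show ?thesis
    using assms a id_in id_left id_right id_left[OF p] id_left[OF q] id_right[OF a(6)] id_left[OF a(6)]
      id_left[OF a(3)] id_left[OF a(4)] id_left[OF a(5)] id_right[OF a(3)] id_right[OF a(4)] id_right[OF a(5)]
    by (simp add: internal_functor_def ifun_id_def Let_def icmp_def)
qed

lemma fun_comp_in:
  assumes F: "internal_functor E F" and G: "internal_functor E G" and FG: "idom G = icod F"
  shows "internal_functor E (ifun_comp E G F)"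
proof -
  note f = fun_facts[OF F] and g = fun_facts[OF G, unfolded FG]
  let ?s = "isrc (idom F)" let ?t = "itrg (idom F)"
  note st = ic_simps(3)[OF f(1)] ic_simps(4)[OF f(1)]
  note p = pb1_in[OF st] and q = pb2_in[OF st]
  have ax: "F1 F \<cdot> imul (idom F) = icmp E (icod F) (F1 F \<cdot> pb1 E ?s ?t) (F1 F \<cdot> pb2 E ?s ?t)"
    using F unfolding internal_functor_def Let_def by blast
  have c: "isrc (icod F) \<cdot> (F1 F \<cdot> pb1 E ?s ?t) = itrg (icod F) \<cdot> (F1 F \<cdot> pb2 E ?s ?t)"
    using fun_src[OF F p] fun_src[OF F q] pb_comm[OF st] by simp
  have m: "(F1 G \<cdot> F1 F) \<cdot> imul (idom F)
      = icmp E (icod G) ((F1 G \<cdot> F1 F) \<cdot> pb1 E ?s ?t) ((F1 G \<cdot> F1 F) \<cdot> pb2 E ?s ?t)"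
    using assoc[OF ic_simps(6)[OF f(1)] f(4) g(4)] ax assoc[OF p f(4) g(4)] assoc[OF q f(4) g(4)]
      fun_icmp[OF G, unfolded FG, OF comp_in[OF p f(4)] comp_in[OF q f(4)] c] by simp
  have i: "(F1 G \<cdot> F1 F) \<cdot> iid (idom F) = iid (icod G) \<cdot> (F0 G \<cdot> F0 F)"
    using assoc[OF ic_simps(5)[OF f(1)] f(4) g(4)] f(5) fun_id[OF G, unfolded FG, OF f(3)] by simp
  have s: "isrc (icod G) \<cdot> (F1 G \<cdot> F1 F) = (F0 G \<cdot> F0 F) \<cdot> ?s"
      "itrg (icod G) \<cdot> (F1 G \<cdot> F1 F) = (F0 G \<cdot> F0 F) \<cdot> ?t"
    using fun_src[OF G, unfolded FG, OF f(4)] f assoc[OF st(1) f(3) g(3)] assoc[OF st(2) f(3) g(3)] by simp_all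
  show ?thesis using f g m i s comp_in[OF f(3) g(3)] comp_in[OF f(4) g(4)]
    by (simp add: internal_functor_def ifun_comp_def Let_def)
qed

lemma category_Cat: "category (Cat E)"
proof
  fix F G H A B C D
  show "F \<in> Ar (Cat E) \<Longrightarrow> Dm (Cat E) F \<in> Ob (Cat E)"
    "F \<in> Ar (Cat E) \<Longrightarrow> Cd (Cat E) F \<in> Ob (Cat E)"
    using fun_facts by (auto simp: Cat_def)
  show "A \<in> Ob (Cat E) \<Longrightarrow> Ide (Cat E) A \<in> hom (Cat E) A A"
    using fun_id_in by (auto simp: Cat_def hom_def ifun_id_def)
  assume F: "F \<in> hom (Cat E) A B"
  then have F': "internal_functor E F" "idom F = A" "icod F = B" by (auto simp: Cat_def hom_def)
  note f = fun_facts[OF F'(1), unfolded F'(2,3)]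
  show "Ide (Cat E) B \<cdot>\<^bsub>Cat E\<^esub> F = F" "F \<cdot>\<^bsub>Cat E\<^esub> Ide (Cat E) A = F"
    using F' id_left[OF f(3)] id_left[OF f(4)] id_right[OF f(3)] id_right[OF f(4)]
    by (simp_all add: Cat_def ifun_id_def ifun_comp_def)
  assume G: "G \<in> hom (Cat E) B C"
  then have G': "internal_functor E G" "idom G = B" "icod G = C" by (auto simp: Cat_def hom_def)
  note g = fun_facts[OF G'(1), unfolded G'(2,3)]
  show "G \<cdot>\<^bsub>Cat E\<^esub> F \<in> hom (Cat E) A C"
    using fun_comp_in[OF F'(1) G'(1)] F' G' by (auto simp: Cat_def hom_def ifun_comp_def)
  assume H: "H \<in> hom (Cat E) C D"
  then have H': "internal_functor E H" "idom H = C" "icod H = D" by (auto simp: Cat_def hom_def)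
  note h = fun_facts[OF H'(1), unfolded H'(2,3)]
  show "(H \<cdot>\<^bsub>Cat E\<^esub> G) \<cdot>\<^bsub>Cat E\<^esub> F = H \<cdot>\<^bsub>Cat E\<^esub> (G \<cdot>\<^bsub>Cat E\<^esub> F)"
    using assoc[OF f(3) g(3) h(3)] assoc[OF f(4) g(4) h(4)] by (simp add: Cat_def ifun_comp_def)
qed

text \<open>\<open>nat_from A B \<alpha> F G\<close>: \<open>\<alpha>\<close> is a transformation \<open>F \<Rightarrow> G : A \<rightarrow> B\<close>.\<close>

definition nat_from where
  "nat_from A B \<alpha> F G \<longleftrightarrow> internal_nat E \<alpha> \<and> nsrc \<alpha> = F \<and> ntrg \<alpha> = G \<and> idom F = A \<and> icod F = B"

lemma nat_facts:
  assumes "nat_from A B \<alpha> F G"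
  shows "internal_functor E F" "internal_functor E G" "internal_category E A" "internal_category E B"
    "idom F = A" "icod F = B" "idom G = A" "icod G = B" "nsrc \<alpha> = F" "ntrg \<alpha> = G"
    "ncmp \<alpha> \<in> hom E (C0 A) (C1 B)" "isrc B \<cdot> ncmp \<alpha> = F0 F" "itrg B \<cdot> ncmp \<alpha> = F0 G"
    "icmp E B (ncmp \<alpha> \<cdot> itrg A) (F1 F) = icmp E B (F1 G) (ncmp \<alpha> \<cdot> isrc A)"
  using assms by (auto simp: nat_from_def internal_nat_def Let_def fun_facts)

lemma nat_fromI:
  assumes "internal_functor E F" "internal_functor E G"
    "idom F = A" "icod F = B" "idom G = A" "icod G = B" "nsrc \<alpha> = F" "ntrg \<alpha> = G"
    "ncmp \<alpha> \<in> hom E (C0 A) (C1 B)" "isrc B \<cdot> ncmp \<alpha> = F0 F" "itrg B \<cdot> ncmp \<alpha> = F0 G"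
    "icmp E B (ncmp \<alpha> \<cdot> itrg A) (F1 F) = icmp E B (F1 G) (ncmp \<alpha> \<cdot> isrc A)"
  shows "nat_from A B \<alpha> F G"
  using assms by (auto simp: nat_from_def internal_nat_def Let_def)

lemma nat_st:
  assumes "nat_from A B \<alpha> F G" "x \<in> hom E X (C0 A)"
  shows "isrc B \<cdot> (ncmp \<alpha> \<cdot> x) = F0 F \<cdot> x" "itrg B \<cdot> (ncmp \<alpha> \<cdot> x) = F0 G \<cdot> x"
    "ncmp \<alpha> \<cdot> x \<in> hom E X (C1 B)"
proof -
  note n = nat_facts[OF assms(1)]
  show "isrc B \<cdot> (ncmp \<alpha> \<cdot> x) = F0 F \<cdot> x" "itrg B \<cdot> (ncmp \<alpha> \<cdot> x) = F0 G \<cdot> x"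
    using assoc[OF assms(2) n(11) ic_simps(3)[OF n(4)]] assoc[OF assms(2) n(11) ic_simps(4)[OF n(4)]] n(12,13)
    by simp_all
  show "ncmp \<alpha> \<cdot> x \<in> hom E X (C1 B)" using comp_in assms(2) n(11) by blast
qed

lemma fun_st:
  assumes "internal_functor E F" "idom F = A" "icod F = B" "f \<in> hom E X (C1 A)"
  shows "isrc B \<cdot> (F1 F \<cdot> f) = F0 F \<cdot> (isrc A \<cdot> f)" "itrg B \<cdot> (F1 F \<cdot> f) = F0 F \<cdot> (itrg A \<cdot> f)"
    "F1 F \<cdot> f \<in> hom E X (C1 B)"
  using fun_src[OF assms(1)] fun_facts[OF assms(1)] assms comp_in by auto

lemma nat_natural:
  assumes "nat_from A B \<alpha> F G" "a \<in> hom E X (C1 A)"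
  shows "icmp E B (ncmp \<alpha> \<cdot> (itrg A \<cdot> a)) (F1 F \<cdot> a) = icmp E B (F1 G \<cdot> a) (ncmp \<alpha> \<cdot> (isrc A \<cdot> a))"
proof -
  note n = nat_facts[OF assms(1)]
  note s = ic_simps(3)[OF n(3)] and t = ic_simps(4)[OF n(3)]
  have FG: "F1 F \<in> hom E (C1 A) (C1 B)" "F1 G \<in> hom E (C1 A) (C1 B)"
    using fun_facts(4) n by metis+
  have c1: "isrc B \<cdot> (ncmp \<alpha> \<cdot> itrg A) = itrg B \<cdot> F1 F" 
    using nat_st[OF assms(1) t] fun_facts(7)[OF n(1)] n by simp
  have c2: "isrc B \<cdot> F1 G = itrg B \<cdot> (ncmp \<alpha> \<cdot> isrc A)"
    using nat_st[OF assms(1) s] fun_facts(6)[OF n(2)] n by simp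
  show ?thesis
    using internal_cat.icmp_comp[OF ic[OF n(4)] nat_st(3)[OF assms(1) t] FG(1) c1 assms(2)]
      internal_cat.icmp_comp[OF ic[OF n(4)] FG(2) nat_st(3)[OF assms(1) s] c2 assms(2)]
      n(14) assoc[OF assms(2) t n(11)] assoc[OF assms(2) s n(11)] by simp
qed

lemma Cat_hom: "F \<in> hom (Cat E) A B \<longleftrightarrow> internal_functor E F \<and> idom F = A \<and> icod F = B"
  by (auto simp: Cat_def hom_def)

lemma Cat_Ar2: "\<alpha> \<in> Ar (hom_cat (Cat E) A B) \<longleftrightarrow> nat_from A B \<alpha> (nsrc \<alpha>) (ntrg \<alpha>)"
  by (auto simp: hom_cat_def nat_from_def Cat_hom) (auto simp: Cat_def internal_nat_def Let_def)

lemma Cat_hom2: "\<alpha> \<in> hom (hom_cat (Cat E) A B) F G \<longleftrightarrow> nat_from A B \<alpha> F G"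
proof -
  have "\<alpha> \<in> hom (hom_cat (Cat E) A B) F G \<longleftrightarrow> \<alpha> \<in> Ar (hom_cat (Cat E) A B) \<and> nsrc \<alpha> = F \<and> ntrg \<alpha> = G"
    by (auto simp: hom_def hom_cat_def Cat_def)
  then show ?thesis unfolding Cat_Ar2 by (auto simp: nat_from_def)
qed

lemma nat_id:
  assumes "internal_functor E F" "idom F = A" "icod F = B"
  shows "nat_from A B (inat_id E F) F F"
proof -
  note f = fun_facts[OF assms(1), unfolded assms(2,3)]
  note a = ic_simps[OF f(1)] and b = ic_simps[OF f(2)]
  note bi = ic[OF f(2)]
  have "icmp E B ((iid B \<cdot> F0 F) \<cdot> itrg A) (F1 F) = F1 F"
    using internal_cat.icmp_id_left[OF bi f(4)] f(7) assoc[OF a(4) f(3) b(5)] by simp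
  moreover have "icmp E B (F1 F) ((iid B \<cdot> F0 F) \<cdot> isrc A) = F1 F"
    using internal_cat.icmp_id_right[OF bi f(4)] f(6) assoc[OF a(3) f(3) b(5)] by simp
  ultimately show ?thesis
    using assms comp_in[OF f(3) b(5)] internal_cat.src_id[OF bi f(3)] internal_cat.trg_id[OF bi f(3)]
    by (intro nat_fromI) (auto simp: inat_id_def)
qed

lemma nat_vcomp:
  assumes al: "nat_from A B \<alpha> F G" and be: "nat_from A B \<beta> G H"
  shows "nat_from A B (inat_vcomp E \<beta> \<alpha>) F H"
proof -
  note n = nat_facts[OF al] and m = nat_facts[OF be]
  note bi = ic[OF n(4)] and a = ic_simps[OF n(3)]
  have c: "isrc B \<cdot> ncmp \<beta> = itrg B \<cdot> ncmp \<alpha>" using n m by simp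
  note i = internal_cat.icmp_facts[OF bi m(11) n(11) c]
  let ?s = "isrc A" let ?t = "itrg A"
  have F: "F1 F \<in> hom E (C1 A) (C1 B)" "isrc B \<cdot> F1 F = F0 F \<cdot> ?s" "itrg B \<cdot> F1 F = F0 F \<cdot> ?t"
    using fun_facts[OF n(1)] n by auto
  have G: "F1 G \<in> hom E (C1 A) (C1 B)" "isrc B \<cdot> F1 G = F0 G \<cdot> ?s" "itrg B \<cdot> F1 G = F0 G \<cdot> ?t"
    using fun_facts[OF n(2)] n by auto
  have H: "F1 H \<in> hom E (C1 A) (C1 B)" "isrc B \<cdot> F1 H = F0 H \<cdot> ?s" "itrg B \<cdot> F1 H = F0 H \<cdot> ?t"
    using fun_facts[OF m(2)] m by auto
  note at = nat_st[OF al a(4)] and as = nat_st[OF al a(3)] and bt = nat_st[OF be a(4)] and bs = nat_st[OF be a(3)]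
  note ias = internal_cat.icmp_assoc[OF bi]
  have "icmp E B (icmp E B (ncmp \<beta>) (ncmp \<alpha>) \<cdot> ?t) (F1 F)
      = icmp E B (icmp E B (ncmp \<beta> \<cdot> ?t) (ncmp \<alpha> \<cdot> ?t)) (F1 F)"
    using internal_cat.icmp_comp[OF bi m(11) n(11) c a(4)] by simp
  also have "\<dots> = icmp E B (ncmp \<beta> \<cdot> ?t) (icmp E B (ncmp \<alpha> \<cdot> ?t) (F1 F))"
    by (rule ias[OF bt(3) at(3) F(1)]) (simp_all add: at bt F)
  also have "\<dots> = icmp E B (ncmp \<beta> \<cdot> ?t) (icmp E B (F1 G) (ncmp \<alpha> \<cdot> ?s))" using n(14) by simp
  also have "\<dots> = icmp E B (icmp E B (ncmp \<beta> \<cdot> ?t) (F1 G)) (ncmp \<alpha> \<cdot> ?s)"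
    by (rule ias[OF bt(3) G(1) as(3), symmetric]) (simp_all add: as bt G)
  also have "\<dots> = icmp E B (icmp E B (F1 H) (ncmp \<beta> \<cdot> ?s)) (ncmp \<alpha> \<cdot> ?s)" using m(14) by simp
  also have "\<dots> = icmp E B (F1 H) (icmp E B (ncmp \<beta> \<cdot> ?s) (ncmp \<alpha> \<cdot> ?s))"
    by (rule ias[OF H(1) bs(3) as(3)]) (simp_all add: as bs H)
  also have "\<dots> = icmp E B (F1 H) (icmp E B (ncmp \<beta>) (ncmp \<alpha>) \<cdot> ?s)"
    using internal_cat.icmp_comp[OF bi m(11) n(11) c a(3)] by simp
  finally show ?thesis using n m i
    by (intro nat_fromI) (auto simp: inat_vcomp_def)
qed

lemma hom_category_Cat:
  shows "category (hom_cat (Cat E) A B)"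
proof
  fix \<alpha> \<beta> \<gamma> F G H K
  let ?C = "hom_cat (Cat E) A B"
  show "\<alpha> \<in> Ar ?C \<Longrightarrow> Dm ?C \<alpha> \<in> Ob ?C" "\<alpha> \<in> Ar ?C \<Longrightarrow> Cd ?C \<alpha> \<in> Ob ?C"
    by (auto simp: hom_cat_def)
  show "F \<in> Ob ?C \<Longrightarrow> Ide ?C F \<in> hom ?C F F"
    using nat_id unfolding Cat_hom2 by (simp add: hom_cat_def Cat_hom) (simp add: Cat_def)
  have sel: "Ide ?C = inat_id E" "Cmp ?C = inat_vcomp E" by (simp_all add: hom_cat_def Cat_def)
  assume "\<alpha> \<in> hom ?C F G"
  then have al: "nat_from A B \<alpha> F G" by (simp add: Cat_hom2)
  note n = nat_facts[OF al] note bi = ic[OF n(4)]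
  show "Ide ?C G \<cdot>\<^bsub>?C\<^esub> \<alpha> = \<alpha>" "\<alpha> \<cdot>\<^bsub>?C\<^esub> Ide ?C F = \<alpha>"
    using n internal_cat.icmp_id_left[OF bi n(11)] internal_cat.icmp_id_right[OF bi n(11)]
    by (simp_all add: sel inat_vcomp_def inat_id_def)
  assume "\<beta> \<in> hom ?C G H"
  then have be: "nat_from A B \<beta> G H" by (simp add: Cat_hom2)
  note m = nat_facts[OF be]
  show "\<beta> \<cdot>\<^bsub>?C\<^esub> \<alpha> \<in> hom ?C F H" unfolding Cat_hom2 sel by (rule nat_vcomp[OF al be])
  assume "\<gamma> \<in> hom ?C H K"
  then have ga: "nat_from A B \<gamma> H K" by (simp add: Cat_hom2)
  note k = nat_facts[OF ga]
  show "(\<gamma> \<cdot>\<^bsub>?C\<^esub> \<beta>) \<cdot>\<^bsub>?C\<^esub> \<alpha> = \<gamma> \<cdot>\<^bsub>?C\<^esub> (\<beta> \<cdot>\<^bsub>?C\<^esub> \<alpha>)"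
    using internal_cat.icmp_assoc[OF bi k(11) m(11) n(11)] n m k by (simp add: sel inat_vcomp_def)
qed

lemma nat_hcomp:
  assumes al: "nat_from A B \<alpha> F G" and be: "nat_from B D \<beta> H K"
  shows "nat_from A D (inat_hcomp E \<beta> \<alpha>) (ifun_comp E H F) (ifun_comp E K G)"
proof -
  note n = nat_facts[OF al] and m = nat_facts[OF be]
  note di = ic[OF m(4)] and a = ic_simps[OF n(3)] and b = ic_simps[OF n(4)]
  let ?s = "isrc A" let ?t = "itrg A"
  have F: "F0 F \<in> hom E (C0 A) (C0 B)" "F1 F \<in> hom E (C1 A) (C1 B)"
      "isrc B \<cdot> F1 F = F0 F \<cdot> ?s" "itrg B \<cdot> F1 F = F0 F \<cdot> ?t"
    using fun_facts[OF n(1)] n by auto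
  have G: "F0 G \<in> hom E (C0 A) (C0 B)" "F1 G \<in> hom E (C1 A) (C1 B)"
      "isrc B \<cdot> F1 G = F0 G \<cdot> ?s" "itrg B \<cdot> F1 G = F0 G \<cdot> ?t"
    using fun_facts[OF n(2)] n by auto
  note Hs = fun_st[OF m(1,5,6)] and Ks = fun_st[OF m(2,7,8)]
  have H1: "F1 H \<in> hom E (C1 B) (C1 D)" "F0 H \<in> hom E (C0 B) (C0 D)" using fun_facts[OF m(1)] m by auto
  have K1: "F1 K \<in> hom E (C1 B) (C1 D)" "F0 K \<in> hom E (C0 B) (C0 D)" using fun_facts[OF m(2)] m by auto
  note bG = nat_st[OF be G(1)] and Ha = Hs[OF n(11)]
  have c: "isrc D \<cdot> (ncmp \<beta> \<cdot> F0 G) = itrg D \<cdot> (F1 H \<cdot> ncmp \<alpha>)" using bG Ha n by simp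
  note i = internal_cat.icmp_facts[OF di bG(3) Ha(3) c]
  note ias = internal_cat.icmp_assoc[OF di] and icp = internal_cat.icmp_comp[OF di bG(3) Ha(3) c]
  note as = nat_st[OF al a(3)] and at = nat_st[OF al a(4)]
  note Gs = comp_in[OF a(3) G(1)] and Gt = comp_in[OF a(4) G(1)]
  note bGs = nat_st[OF be Gs] and bGt = nat_st[OF be Gt]
  note Has = Hs[OF as(3)] and Hat = Hs[OF at(3)] and HF = Hs[OF F(2)] and HG = Hs[OF G(2)] and KG = Ks[OF G(2)]
  have "icmp E D (icmp E D (ncmp \<beta> \<cdot> F0 G) (F1 H \<cdot> ncmp \<alpha>) \<cdot> ?t) (F1 H \<cdot> F1 F)
      = icmp E D (icmp E D (ncmp \<beta> \<cdot> (F0 G \<cdot> ?t)) (F1 H \<cdot> (ncmp \<alpha> \<cdot> ?t))) (F1 H \<cdot> F1 F)"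
    using icp[OF a(4)] assoc[OF a(4) G(1) m(11)] assoc[OF a(4) n(11) H1(1)] by simp
  also have "\<dots> = icmp E D (ncmp \<beta> \<cdot> (F0 G \<cdot> ?t)) (icmp E D (F1 H \<cdot> (ncmp \<alpha> \<cdot> ?t)) (F1 H \<cdot> F1 F))"
    by (rule ias[OF bGt(3) Hat(3) HF(3)]) (simp_all add: bGt Hat HF at F)
  also have "icmp E D (F1 H \<cdot> (ncmp \<alpha> \<cdot> ?t)) (F1 H \<cdot> F1 F) = F1 H \<cdot> icmp E B (ncmp \<alpha> \<cdot> ?t) (F1 F)"
    using fun_icmp[OF m(1), unfolded m(5,6), OF at(3) F(2)] at F by simp
  also have "\<dots> = F1 H \<cdot> icmp E B (F1 G) (ncmp \<alpha> \<cdot> ?s)" using n(14) by simp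
  also have "\<dots> = icmp E D (F1 H \<cdot> F1 G) (F1 H \<cdot> (ncmp \<alpha> \<cdot> ?s))"
    using fun_icmp[OF m(1), unfolded m(5,6), OF G(2) as(3)] as G by simp
  also have "icmp E D (ncmp \<beta> \<cdot> (F0 G \<cdot> ?t)) (icmp E D (F1 H \<cdot> F1 G) (F1 H \<cdot> (ncmp \<alpha> \<cdot> ?s)))
      = icmp E D (icmp E D (ncmp \<beta> \<cdot> (F0 G \<cdot> ?t)) (F1 H \<cdot> F1 G)) (F1 H \<cdot> (ncmp \<alpha> \<cdot> ?s))"
    by (rule ias[OF bGt(3) HG(3) Has(3), symmetric]) (simp_all add: bGt Has HG as G)
  also have "icmp E D (ncmp \<beta> \<cdot> (F0 G \<cdot> ?t)) (F1 H \<cdot> F1 G) = icmp E D (F1 K \<cdot> F1 G) (ncmp \<beta> \<cdot> (F0 G \<cdot> ?s))"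
    using nat_natural[OF be G(2)] G by simp
  also have "icmp E D \<dots> (F1 H \<cdot> (ncmp \<alpha> \<cdot> ?s))
      = icmp E D (F1 K \<cdot> F1 G) (icmp E D (ncmp \<beta> \<cdot> (F0 G \<cdot> ?s)) (F1 H \<cdot> (ncmp \<alpha> \<cdot> ?s)))"
    by (rule ias[OF KG(3) bGs(3) Has(3)]) (simp_all add: bGs Has KG as G)
  also have "\<dots> = icmp E D (F1 K \<cdot> F1 G) (icmp E D (ncmp \<beta> \<cdot> F0 G) (F1 H \<cdot> ncmp \<alpha>) \<cdot> ?s)"
    using icp[OF a(3)] assoc[OF a(3) G(1) m(11)] assoc[OF a(3) n(11) H1(1)] by simp
  finally show ?thesis
    using n m i fun_comp_in[OF n(1) m(1)] fun_comp_in[OF n(2) m(2)] bG Ha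
    by (intro nat_fromI) (auto simp: inat_hcomp_def ifun_comp_def)
qed

theorem two_category_Cat: "two_category (Cat E)"
proof (intro two_category.intro category_Cat two_category_axioms.intro)
  fix \<alpha> assume "\<alpha> \<in> Cell (Cat E)"
  then have "internal_nat E \<alpha>" by (simp add: Cat_def)
  then have n: "nat_from (idom (nsrc \<alpha>)) (icod (nsrc \<alpha>)) \<alpha> (nsrc \<alpha>) (ntrg \<alpha>)" by (simp add: nat_from_def)
  then show "\<exists>X\<in>Ob (Cat E). \<exists>Y\<in>Ob (Cat E). \<alpha> \<in> Ar (hom_cat (Cat E) X Y)"
    unfolding Cat_Ar2 using nat_facts(3,4)[OF n] by (auto simp: Cat_def)
next
  fix X Y show "category (hom_cat (Cat E) X Y)" by (rule hom_category_Cat)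
next
  fix F F' G G' X Y Z \<alpha> \<beta>
  assume "\<alpha> \<in> hom (hom_cat (Cat E) X Y) F F'" "\<beta> \<in> hom (hom_cat (Cat E) Y Z) G G'"
  then show "HComp (Cat E) \<beta> \<alpha> \<in> hom (hom_cat (Cat E) X Z) (G \<cdot>\<^bsub>Cat E\<^esub> F) (G' \<cdot>\<^bsub>Cat E\<^esub> F')"
    using nat_hcomp unfolding Cat_hom2 by (simp add: Cat_def)
next
  fix F G X Y Z assume "F \<in> hom (Cat E) X Y" "G \<in> hom (Cat E) Y Z"
  then have F: "internal_functor E F" "idom F = X" "icod F = Y"
    and G: "internal_functor E G" "idom G = Y" "icod G = Z" by (auto simp: Cat_hom)
  note f = fun_facts[OF F(1), unfolded F(2,3)] and g = fun_facts[OF G(1), unfolded G(2,3)]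
  note y = ic_simps[OF f(2)] and z = ic_simps[OF g(2)] and zi = ic[OF g(2)]
  note GF = comp_in[OF f(3) g(3)]
  have "icmp E Z ((iid Z \<cdot> F0 G) \<cdot> F0 F) (F1 G \<cdot> (iid Y \<cdot> F0 F)) = iid Z \<cdot> (F0 G \<cdot> F0 F)"
    using internal_cat.icmp_id_left[OF zi comp_in[OF GF z(5)]] internal_cat.trg_id[OF zi GF]
      fun_id[OF G(1), unfolded G(2,3), OF f(3)] assoc[OF f(3) g(3) z(5)] by simp
  then show "HComp (Cat E) (VId (Cat E) G) (VId (Cat E) F) = VId (Cat E) (G \<cdot>\<^bsub>Cat E\<^esub> F)"
    using F G by (simp add: Cat_def inat_hcomp_def inat_id_def ifun_comp_def)
next
  fix \<alpha> \<alpha>' \<beta> \<beta>' X Y Z F F' F'' G G' G''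
  assume "\<alpha> \<in> hom (hom_cat (Cat E) X Y) F F'" "\<alpha>' \<in> hom (hom_cat (Cat E) X Y) F' F''"
    "\<beta> \<in> hom (hom_cat (Cat E) Y Z) G G'" "\<beta>' \<in> hom (hom_cat (Cat E) Y Z) G' G''"
  then have al: "nat_from X Y \<alpha> F F'" and al': "nat_from X Y \<alpha>' F' F''"
    and be: "nat_from Y Z \<beta> G G'" and be': "nat_from Y Z \<beta>' G' G''" by (simp_all add: Cat_hom2)
  note n = nat_facts[OF al] and n' = nat_facts[OF al'] and m = nat_facts[OF be] and m' = nat_facts[OF be']
  have F: "F0 F' \<in> hom E (C0 X) (C0 Y)" "F0 F'' \<in> hom E (C0 X) (C0 Y)"
    using fun_facts[OF n(2)] fun_facts[OF n'(2)] n n' by auto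
  note zi = ic[OF m(4)] 
  note ias = internal_cat.icmp_assoc[OF zi]
  note b1 = nat_st[OF be F(1)] and b2 = nat_st[OF be F(2)]
    and b'1 = nat_st[OF be' F(1)] and b'2 = nat_st[OF be' F(2)]
  note Ga = fun_st[OF m(1,5,6) n(11)] and Ga' = fun_st[OF m(1,5,6) n'(11)]
    and G'a' = fun_st[OF m(2,7,8) n'(11)]
  note st = b1 b2 b'1 b'2 Ga Ga' G'a' n(12,13) n'(12,13)
  have c0: "isrc Y \<cdot> ncmp \<alpha>' = itrg Y \<cdot> ncmp \<alpha>" using n n' by simp
  have d0: "isrc Z \<cdot> ncmp \<beta>' = itrg Z \<cdot> ncmp \<beta>" using m m' by simp
  let ?b' = "ncmp \<beta>' \<cdot> F0 F''" let ?b = "ncmp \<beta> \<cdot> F0 F''" let ?c = "ncmp \<beta> \<cdot> F0 F'"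
  let ?u = "F1 G \<cdot> ncmp \<alpha>'" let ?v = "F1 G \<cdot> ncmp \<alpha>" let ?w = "F1 G' \<cdot> ncmp \<alpha>'"
  note uv = internal_cat.icmp_facts[OF zi, of ?u _ ?v]
  have i1: "icmp E Z ?u ?v \<in> hom E (C0 X) (C1 Z)" "itrg Z \<cdot> icmp E Z ?u ?v = itrg Z \<cdot> ?u"
    using internal_cat.icmp_facts[OF zi Ga'(3) Ga(3)] by (simp_all add: st)
  have i2: "icmp E Z ?c ?v \<in> hom E (C0 X) (C1 Z)" "itrg Z \<cdot> icmp E Z ?c ?v = itrg Z \<cdot> ?c"
    using internal_cat.icmp_facts[OF zi b1(3) Ga(3)] by (simp_all add: st)
  have "icmp E Z (icmp E Z (ncmp \<beta>') (ncmp \<beta>) \<cdot> F0 F'') (F1 G \<cdot> icmp E Y (ncmp \<alpha>') (ncmp \<alpha>))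
      = icmp E Z (icmp E Z ?b' ?b) (icmp E Z ?u ?v)"
    using internal_cat.icmp_comp[OF zi m'(11) m(11) d0 F(2)]
      fun_icmp[OF m(1), unfolded m(5,6), OF n'(11) n(11) c0] by simp
  also have "\<dots> = icmp E Z ?b' (icmp E Z ?b (icmp E Z ?u ?v))"
    by (rule ias[OF b'2(3) b2(3) i1(1)]) (simp_all add: st i1)
  also have "icmp E Z ?b (icmp E Z ?u ?v) = icmp E Z (icmp E Z ?b ?u) ?v"
    by (rule ias[OF b2(3) Ga'(3) Ga(3), symmetric]) (simp_all add: st)
  also have "icmp E Z ?b ?u = icmp E Z ?w ?c"
    using nat_natural[OF be n'(11)] n'(12,13) by simp
  also have "icmp E Z (icmp E Z ?w ?c) ?v = icmp E Z ?w (icmp E Z ?c ?v)"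
    by (rule ias[OF G'a'(3) b1(3) Ga(3)]) (simp_all add: st)
  also have "icmp E Z ?b' \<dots> = icmp E Z (icmp E Z ?b' ?w) (icmp E Z ?c ?v)"
    by (rule ias[OF b'2(3) G'a'(3) i2(1), symmetric]) (simp_all add: st i2)
  finally show "HComp (Cat E) (VComp (Cat E) \<beta>' \<beta>) (VComp (Cat E) \<alpha>' \<alpha>) =
       VComp (Cat E) (HComp (Cat E) \<beta>' \<alpha>') (HComp (Cat E) \<beta> \<alpha>)"
    using n n' m m' by (simp add: Cat_def inat_hcomp_def inat_vcomp_def ifun_comp_def)
next
  fix \<alpha> \<beta> \<gamma> W X Y Z
  assume "\<alpha> \<in> Ar (hom_cat (Cat E) W X)" "\<beta> \<in> Ar (hom_cat (Cat E) X Y)" "\<gamma> \<in> Ar (hom_cat (Cat E) Y Z)"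
  then obtain F F' G G' H H' where al: "nat_from W X \<alpha> F F'" and be: "nat_from X Y \<beta> G G'"
    and ga: "nat_from Y Z \<gamma> H H'" by (auto simp: Cat_Ar2)
  note n = nat_facts[OF al] and m = nat_facts[OF be] and k = nat_facts[OF ga]
  have f: "F0 F \<in> hom E (C0 W) (C0 X)" "F1 F \<in> hom E (C1 W) (C1 X)"
    "F0 F' \<in> hom E (C0 W) (C0 X)" "F1 F' \<in> hom E (C1 W) (C1 X)"
    using fun_facts[OF n(1)] fun_facts[OF n(2)] n by auto
  have g: "F0 G \<in> hom E (C0 X) (C0 Y)" "F1 G \<in> hom E (C1 X) (C1 Y)"
    "F0 G' \<in> hom E (C0 X) (C0 Y)" "F1 G' \<in> hom E (C1 X) (C1 Y)"
    using fun_facts[OF m(1)] fun_facts[OF m(2)] m by auto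
  have h: "F0 H \<in> hom E (C0 Y) (C0 Z)" "F1 H \<in> hom E (C1 Y) (C1 Z)"
    "F0 H' \<in> hom E (C0 Y) (C0 Z)" "F1 H' \<in> hom E (C1 Y) (C1 Z)"
    using fun_facts[OF k(1)] fun_facts[OF k(2)] k by auto
  note zi = ic[OF k(4)]
  have fe: "(F0 H \<cdot> F0 G) \<cdot> F0 F = F0 H \<cdot> (F0 G \<cdot> F0 F)" "(F1 H \<cdot> F1 G) \<cdot> F1 F = F1 H \<cdot> (F1 G \<cdot> F1 F)"
    "(F0 H' \<cdot> F0 G') \<cdot> F0 F' = F0 H' \<cdot> (F0 G' \<cdot> F0 F')" "(F1 H' \<cdot> F1 G') \<cdot> F1 F' = F1 H' \<cdot> (F1 G' \<cdot> F1 F')"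
    using f g h assoc by blast+
  let ?g = "ncmp \<gamma> \<cdot> (F0 G' \<cdot> F0 F')" let ?b = "F1 H \<cdot> (ncmp \<beta> \<cdot> F0 F')" let ?a = "F1 H \<cdot> (F1 G \<cdot> ncmp \<alpha>)"
  note bF = nat_st[OF be f(3)] and Ga = fun_st[OF m(1,5,6) n(11)]
  note GF = comp_in[OF f(3) g(3)]
  note gG = nat_st[OF ga g(3)] and gGF = nat_st[OF ga GF]
  note Hb = fun_st[OF k(1,5,6) m(11)] and HbF = fun_st[OF k(1,5,6) bF(3)] and HGa = fun_st[OF k(1,5,6) Ga(3)]
  have c1: "isrc Z \<cdot> (ncmp \<gamma> \<cdot> F0 G') = itrg Z \<cdot> (F1 H \<cdot> ncmp \<beta>)" using gG Hb m by simp
  have c2: "isrc Y \<cdot> (ncmp \<beta> \<cdot> F0 F') = itrg Y \<cdot> (F1 G \<cdot> ncmp \<alpha>)" using bF Ga n by simp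
  have "icmp E Z (icmp E Z (ncmp \<gamma> \<cdot> F0 G') (F1 H \<cdot> ncmp \<beta>) \<cdot> F0 F') ((F1 H \<cdot> F1 G) \<cdot> ncmp \<alpha>)
      = icmp E Z (icmp E Z ?g ?b) ?a"
    using internal_cat.icmp_comp[OF zi gG(3) Hb(3) c1 f(3)] assoc[OF f(3) g(3) k(11)] assoc[OF f(3) m(11) h(2)]
      assoc[OF n(11) g(2) h(2)] by simp
  also have "\<dots> = icmp E Z ?g (icmp E Z ?b ?a)"
    by (rule internal_cat.icmp_assoc[OF zi gGF(3) HbF(3) HGa(3)]) (simp_all add: gGF HbF HGa bF Ga n)
  also have "icmp E Z ?b ?a = F1 H \<cdot> icmp E Y (ncmp \<beta> \<cdot> F0 F') (F1 G \<cdot> ncmp \<alpha>)"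
    using fun_icmp[OF k(1), unfolded k(5,6), OF bF(3) Ga(3) c2] by simp
  finally show "HComp (Cat E) (HComp (Cat E) \<gamma> \<beta>) \<alpha> = HComp (Cat E) \<gamma> (HComp (Cat E) \<beta> \<alpha>)"
    using n m k fe by (simp add: Cat_def inat_hcomp_def ifun_comp_def)
next
  fix \<alpha> X Y assume "\<alpha> \<in> Ar (hom_cat (Cat E) X Y)"
  then obtain F G where al: "nat_from X Y \<alpha> F G" by (auto simp: Cat_Ar2)
  note n = nat_facts[OF al]
  have f: "F0 F \<in> hom E (C0 X) (C0 Y)" "F1 F \<in> hom E (C1 X) (C1 Y)"
    "F0 G \<in> hom E (C0 X) (C0 Y)" "F1 G \<in> hom E (C1 X) (C1 Y)"
    using fun_facts[OF n(1)] fun_facts[OF n(2)] n by auto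
  note x = ic_simps[OF n(3)] and y = ic_simps[OF n(4)] and yi = ic[OF n(4)]
  note I = id_right[OF f(1)] id_right[OF f(2)] id_right[OF f(3)] id_right[OF f(4)]
     id_left[OF f(1)] id_left[OF f(2)] id_left[OF f(3)] id_left[OF f(4)]
     id_right[OF n(11)] id_left[OF n(11)] id_right[OF x(5)] id_right[OF y(5)]
  have "F1 F \<cdot> iid X = iid Y \<cdot> (isrc Y \<cdot> ncmp \<alpha>)" using fun_facts(5)[OF n(1)] n by simp
  then have r: "icmp E Y (ncmp \<alpha>) (F1 F \<cdot> iid X) = ncmp \<alpha>"
    using internal_cat.icmp_id_right[OF yi n(11)] by simp
  have l: "icmp E Y (iid Y \<cdot> F0 G) (ncmp \<alpha>) = ncmp \<alpha>"
    using internal_cat.icmp_id_left[OF yi n(11)] n by simp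
  show "HComp (Cat E) \<alpha> (VId (Cat E) (Ide (Cat E) X)) = \<alpha>"
    using n r I by (simp add: Cat_def inat_hcomp_def inat_id_def ifun_comp_def ifun_id_def)
  show "HComp (Cat E) (VId (Cat E) (Ide (Cat E) Y)) \<alpha> = \<alpha>"
    using n l I by (simp add: Cat_def inat_hcomp_def inat_id_def ifun_comp_def ifun_id_def)
qed

end

section \<open>Consequences of the existence of finite limits, products and coproducts\<close>

lemma finite_limits_pullbacks:
  assumes C: "category C" and L: "has_finite_limits C"
  shows "has_pullbacks C"
  unfolding has_pullbacks_def
proof (intro ballI impI)
  fix f g assume f: "f \<in> Ar C" and g: "g \<in> Ar C" and fg: "Cd C f = Cd C g"
  interpret category C by (rule C)
  define J :: "(nat, nat) cat" where "J = \<lparr>Ob = {0,1,2}, Ar = {0,1,2,3,4},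
    Dm = (\<lambda>u. if u = 3 then 0 else if u = 4 then 1 else u), Cd = (\<lambda>u. if u \<ge> 2 then 2 else u),
    Ide = (\<lambda>j. j), Cmp = (\<lambda>v u. if u \<ge> 3 then u else v)\<rparr>"
  define D where "D = \<lparr>fobj = (\<lambda>j::nat. if j = 0 then Dm C f else if j = 1 then Dm C g else Cd C f),
    farr = (\<lambda>u::nat. if u = 3 then f else if u = 4 then g else if u = 0 then Ide C (Dm C f)
       else if u = 1 then Ide C (Dm C g) else Ide C (Cd C f))\<rparr>"
  have Ju: "u = 0 \<or> u = 1 \<or> u = 2 \<or> u = 3 \<or> u = 4" if "u \<in> Ar J" for u using that by (auto simp: J_def)
  have Jcomp: "(u = 0 \<and> v = 0) \<or> (u = 0 \<and> v = 3) \<or> (u = 1 \<and> v = 1) \<or> (u = 1 \<and> v = 4) \<or>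
      (v = 2 \<and> (u = 2 \<or> u = 3 \<or> u = 4))"
    if "u \<in> Ar J" "v \<in> Ar J" "Dm J v = Cd J u" for u v
    using Ju[OF that(1)] Ju[OF that(2)] that(3) by (elim disjE) (simp_all add: J_def)
  have J: "category J"
  proof
    fix u v w a b c d
    show "u \<in> Ar J \<Longrightarrow> Dm J u \<in> Ob J" "u \<in> Ar J \<Longrightarrow> Cd J u \<in> Ob J"
      using Ju[of u] by (auto simp: J_def)
    show "a \<in> Ob J \<Longrightarrow> Ide J a \<in> hom J a a" by (auto simp: J_def hom_def)
    assume u: "u \<in> hom J a b"
    then have u': "u \<in> Ar J" "Dm J u = a" "Cd J u = b" by (auto simp: hom_def)
    show "Ide J b \<cdot>\<^bsub>J\<^esub> u = u" "u \<cdot>\<^bsub>J\<^esub> Ide J a = u"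
      using Ju[OF u'(1)] u'(2,3) by (elim disjE; force simp: J_def)+
    assume v: "v \<in> hom J b c"
    then have v': "v \<in> Ar J" "Dm J v = b" "Cd J v = c" by (auto simp: hom_def)
    have "Dm J v = Cd J u" using u' v' by simp
    from Jcomp[OF u'(1) v'(1) this] show "v \<cdot>\<^bsub>J\<^esub> u \<in> hom J a c"
      using u' v' by (elim disjE conjE) (simp_all add: J_def hom_def)
    show "(w \<cdot>\<^bsub>J\<^esub> v) \<cdot>\<^bsub>J\<^esub> u = w \<cdot>\<^bsub>J\<^esub> (v \<cdot>\<^bsub>J\<^esub> u)" by (simp add: J_def)
  qed
  have ids: "Dm C (Ide C a) = a" "Cd C (Ide C a) = a" "Ide C a \<in> Ar C" if "a \<in> Ob C" for a
    using id_in[OF that] by (auto simp: hom_def)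
  have f': "f \<in> hom C (Dm C f) (Cd C f)" and g': "g \<in> hom C (Dm C g) (Cd C f)" using f g fg by (auto simp: hom_def)
  have obs: "Dm C f \<in> Ob C" "Dm C g \<in> Ob C" "Cd C f \<in> Ob C" using f g dom_in cod_in by auto
  note I = id_in[OF obs(1)] id_in[OF obs(2)] id_in[OF obs(3)]
  have D: "is_functor J C D" unfolding is_functor_def
  proof (intro conjI ballI impI)
    fix u assume "u \<in> Ar J"
    then show "farr D u \<in> hom C (fobj D (Dm J u)) (fobj D (Cd J u))"
      using Ju f' g' I by (auto simp: J_def D_def)
  next
    fix u v assume u: "u \<in> Ar J" and v: "v \<in> Ar J" and uv: "Dm J v = Cd J u"
    from Jcomp[OF u v uv] show "farr D (v \<cdot>\<^bsub>J\<^esub> u) = farr D v \<cdot>\<^bsub>C\<^esub> farr D u"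
      using id_left[OF f'] id_right[OF f'] id_left[OF g'] id_right[OF g'] id_left[OF I(1)] id_left[OF I(2)] id_left[OF I(3)]
      by (elim disjE conjE) (simp_all add: J_def D_def)
  qed (use obs in \<open>auto simp: J_def D_def\<close>)
  obtain P p where lim: "is_limit C J D P p"
    using L[unfolded has_finite_limits_def, rule_format, of J D] J D by (auto simp: J_def)
  then have cone: "is_cone C J D P p" by (simp add: is_limit_def)
  then have p: "p 0 \<in> hom C P (Dm C f)" "p 1 \<in> hom C P (Dm C g)" "p 2 \<in> hom C P (Cd C f)"
    "f \<cdot>\<^bsub>C\<^esub> p 0 = p 2" "g \<cdot>\<^bsub>C\<^esub> p 1 = p 2"
    by (auto simp: is_cone_def J_def D_def)
  have "is_pullback C f g (p 0) (p 1)" unfolding is_pullback_def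
  proof (intro conjI allI ballI impI)
    fix X u v assume "u \<in> hom C X (Dm C f)" "v \<in> hom C X (Dm C g)" and uv: "f \<cdot>\<^bsub>C\<^esub> u = g \<cdot>\<^bsub>C\<^esub> v"
    then have u: "u \<in> hom C X (Dm C f)" and v: "v \<in> hom C X (Dm C g)" by auto
    define x where "x = (\<lambda>j::nat. if j = 0 then u else if j = 1 then v else f \<cdot>\<^bsub>C\<^esub> u)"
    have fu: "f \<cdot>\<^bsub>C\<^esub> u \<in> hom C X (Cd C f)" by (rule comp_in[OF u f'])
    have "X \<in> Ob C" using u dom_in by (auto simp: hom_def)
    then have "is_cone C J D X x" using u v fu uv id_left[OF u] id_left[OF v] id_left[OF fu]
      by (auto simp: is_cone_def J_def D_def x_def)
    then have "\<exists>!h. h \<in> hom C X P \<and> (\<forall>j \<in> Ob J. p j \<cdot>\<^bsub>C\<^esub> h = x j)"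
      using lim unfolding is_limit_def by blast
    moreover have "(\<forall>j \<in> Ob J. p j \<cdot>\<^bsub>C\<^esub> h = x j) \<longleftrightarrow> p 0 \<cdot>\<^bsub>C\<^esub> h = u \<and> p 1 \<cdot>\<^bsub>C\<^esub> h = v"
      if "h \<in> hom C X P" for h
      using assoc[OF that p(1) f'] p(4) by (auto simp: J_def x_def)
    ultimately show "\<exists>!h. h \<in> hom C X (Dm C (p 0)) \<and> p 0 \<cdot>\<^bsub>C\<^esub> h = u \<and> p 1 \<cdot>\<^bsub>C\<^esub> h = v"
      using hom_Dm[OF p(1)] by (metis (no_types, lifting))
  qed (use p f g fg in \<open>auto simp: hom_def\<close>)
  then show "\<exists>p q. is_pullback C f g p q" by blast
qed

lemma finite_products_pr:
  assumes "has_finite_products C" "A \<in> Ob C" "B \<in> Ob C" "category C"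
  shows "is_product C A B (pr1 C A B) (pr2 C A B)"
proof -
  interpret category C by (rule assms)
  let ?A = "\<lambda>i::nat. if i = 0 then A else B"
  have "\<exists>P \<in> Ob C. \<exists>p. (\<forall>i \<in> {0::nat,1}. p i \<in> hom C P (?A i)) \<and>
     (\<forall>X \<in> Ob C. \<forall>x. (\<forall>i \<in> {0::nat,1}. x i \<in> hom C X (?A i)) \<longrightarrow>
        (\<exists>!h. h \<in> hom C X P \<and> (\<forall>i \<in> {0,1}. p i \<cdot>\<^bsub>C\<^esub> h = x i)))"
    using assms(1)[unfolded has_finite_products_def, rule_format, of "{0,1}" ?A] assms(2,3) by simp
  then obtain P p where p: "p 0 \<in> hom C P A" "p (1::nat) \<in> hom C P B"
    and u: "\<And>X x. X \<in> Ob C \<Longrightarrow> x 0 \<in> hom C X A \<Longrightarrow> x (1::nat) \<in> hom C X B \<Longrightarrow>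
       \<exists>!h. h \<in> hom C X P \<and> p 0 \<cdot>\<^bsub>C\<^esub> h = x 0 \<and> p 1 \<cdot>\<^bsub>C\<^esub> h = x 1" by auto
  have "is_product C A B (p 0) (p 1)" unfolding is_product_def
  proof (intro conjI allI ballI)
    fix X a b assume "a \<in> hom C X A" "b \<in> hom C X B"
    then show "\<exists>!h. h \<in> hom C X (Dm C (p 0)) \<and> p 0 \<cdot>\<^bsub>C\<^esub> h = a \<and> p 1 \<cdot>\<^bsub>C\<^esub> h = b"
      using u[of X "\<lambda>i. if i = 0 then a else b"] hom_Ob1 hom_Dm[OF p(1)] by auto
  qed (use p in \<open>auto simp: hom_def\<close>)
  then have "\<exists>x. case x of (p, q) \<Rightarrow> is_product C A B p q" by auto
  from someI_ex[OF this] show ?thesis by (simp add: pr1_def pr2_def pr_def case_prod_unfold)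
qed

lemma finite_coproducts_coproj:
  assumes "has_finite_coproducts C" "A \<in> Ob C" "B \<in> Ob C" "category C"
  shows "is_coproduct C A B (coproj1 C A B) (coproj2 C A B)"
proof -
  interpret category C by (rule assms)
  let ?A = "\<lambda>i::nat. if i = 0 then A else B"
  have "\<exists>P \<in> Ob C. \<exists>p. (\<forall>i \<in> {0::nat,1}. p i \<in> hom C (?A i) P) \<and>
     (\<forall>X \<in> Ob C. \<forall>x. (\<forall>i \<in> {0::nat,1}. x i \<in> hom C (?A i) X) \<longrightarrow>
        (\<exists>!h. h \<in> hom C P X \<and> (\<forall>i \<in> {0,1}. h \<cdot>\<^bsub>C\<^esub> p i = x i)))"
    using assms(1)[unfolded has_finite_coproducts_def, rule_format, of "{0,1}" ?A] assms(2,3) by simp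
  then obtain P p where p: "p 0 \<in> hom C A P" "p (1::nat) \<in> hom C B P"
    and u: "\<And>X x. X \<in> Ob C \<Longrightarrow> x 0 \<in> hom C A X \<Longrightarrow> x (1::nat) \<in> hom C B X \<Longrightarrow>
       \<exists>!h. h \<in> hom C P X \<and> h \<cdot>\<^bsub>C\<^esub> p 0 = x 0 \<and> h \<cdot>\<^bsub>C\<^esub> p 1 = x 1" by auto
  have "is_coproduct C A B (p 0) (p 1)" unfolding is_coproduct_def
  proof (intro conjI allI ballI)
    fix X a b assume "a \<in> hom C A X" "b \<in> hom C B X"
    then show "\<exists>!h. h \<in> hom C (Cd C (p 0)) X \<and> h \<cdot>\<^bsub>C\<^esub> p 0 = a \<and> h \<cdot>\<^bsub>C\<^esub> p 1 = b"
      using u[of X "\<lambda>i. if i = 0 then a else b"] hom_Ob2 hom_Cd[OF p(1)] by auto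
  qed (use p in \<open>auto simp: hom_def\<close>)
  then have "\<exists>x. case x of (p, q) \<Rightarrow> is_coproduct C A B p q" by auto
  from someI_ex[OF this] show ?thesis by (simp add: coproj1_def coproj2_def coproj_def case_prod_unfold)
qed

locale coproduct_category = category C for C :: "('o, 'm) cat" (structure) +
  assumes fcop: "has_finite_coproducts C"
begin

lemma coproj_in:
  assumes "A \<in> Ob C" "B \<in> Ob C"
  shows "coproj1 C A B \<in> hom C A (cop_obj C A B)" "coproj2 C A B \<in> hom C B (cop_obj C A B)"
  using finite_coproducts_coproj[OF fcop assms] category_axioms by (auto simp: is_coproduct_def cop_obj_def)

lemma cop_ex1:
  assumes "u \<in> hom C A X" "v \<in> hom C B X"
  shows "\<exists>!h. h \<in> hom C (cop_obj C A B) X \<and> h \<cdot> coproj1 C A B = u \<and> h \<cdot> coproj2 C A B = v"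
  using finite_coproducts_coproj[OF fcop hom_Ob1[OF assms(1)] hom_Ob1[OF assms(2)]] category_axioms assms
  by (auto simp: is_coproduct_def cop_obj_def)

lemma cop_map_facts:
  assumes f: "f \<in> hom C A A'" and g: "g \<in> hom C B B'"
  shows "cop_map C f g \<in> hom C (cop_obj C A B) (cop_obj C A' B')"
    "cop_map C f g \<cdot> coproj1 C A B = coproj1 C A' B' \<cdot> f"
    "cop_map C f g \<cdot> coproj2 C A B = coproj2 C A' B' \<cdot> g"
proof -
  note i = coproj_in[OF hom_Ob2[OF f] hom_Ob2[OF g]]
  note u = comp_in[OF f i(1)] and v = comp_in[OF g i(2)]
  note th = theI'[OF cop_ex1[OF u v]]
  show "cop_map C f g \<in> hom C (cop_obj C A B) (cop_obj C A' B')"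
    "cop_map C f g \<cdot> coproj1 C A B = coproj1 C A' B' \<cdot> f"
    "cop_map C f g \<cdot> coproj2 C A B = coproj2 C A' B' \<cdot> g"
    using th hom_Dm[OF f] hom_Cd[OF f] hom_Dm[OF g] hom_Cd[OF g] hom_Dm[OF u] hom_Cd[OF u] hom_Dm[OF v]
    by (simp_all add: cop_map_def cop_pair_def)
qed

lemma cop_map_unique:
  assumes f: "f \<in> hom C A A'" and g: "g \<in> hom C B B'"
    and "h \<in> hom C (cop_obj C A B) (cop_obj C A' B')"
    "h \<cdot> coproj1 C A B = coproj1 C A' B' \<cdot> f" "h \<cdot> coproj2 C A B = coproj2 C A' B' \<cdot> g"
  shows "cop_map C f g = h"
proof -
  note i = coproj_in[OF hom_Ob2[OF f] hom_Ob2[OF g]]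
  show ?thesis using cop_ex1[OF comp_in[OF f i(1)] comp_in[OF g i(2)]] cop_map_facts[OF f g] assms by blast
qed

lemma cop_map_id:
  assumes "A \<in> Ob C" "B \<in> Ob C"
  shows "cop_map C (Ide C A) (Ide C B) = Ide C (cop_obj C A B)"
proof (rule cop_map_unique[OF id_in id_in])
  note i = coproj_in[OF assms]
  show "Ide C (cop_obj C A B) \<in> hom C (cop_obj C A B) (cop_obj C A B)" by (rule id_in[OF hom_Ob2[OF i(1)]])
  show "Ide C (cop_obj C A B) \<cdot> coproj1 C A B = coproj1 C A B \<cdot> Ide C A"
    "Ide C (cop_obj C A B) \<cdot> coproj2 C A B = coproj2 C A B \<cdot> Ide C B"
    using id_left[OF i(1)] id_left[OF i(2)] id_right[OF i(1)] id_right[OF i(2)] by simp_all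
qed (use assms in simp_all)

lemma cop_map_comp:
  assumes f: "f \<in> hom C A A'" and g: "g \<in> hom C B B'" and f': "f' \<in> hom C A' A''" and g': "g' \<in> hom C B' B''"
  shows "cop_map C (f' \<cdot> f) (g' \<cdot> g) = cop_map C f' g' \<cdot> cop_map C f g"
proof (rule cop_map_unique[OF comp_in[OF f f'] comp_in[OF g g']])
  note i = coproj_in[OF hom_Ob1[OF f] hom_Ob1[OF g]] and i' = coproj_in[OF hom_Ob1[OF f'] hom_Ob1[OF g']]
    and i'' = coproj_in[OF hom_Ob2[OF f'] hom_Ob2[OF g']]
  note m = cop_map_facts[OF f g] and m' = cop_map_facts[OF f' g']
  show "cop_map C f' g' \<cdot> cop_map C f g \<in> hom C (cop_obj C A B) (cop_obj C A'' B'')"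
    by (rule comp_in[OF m(1) m'(1)])
  show "(cop_map C f' g' \<cdot> cop_map C f g) \<cdot> coproj1 C A B = coproj1 C A'' B'' \<cdot> (f' \<cdot> f)"
    using assoc[OF i(1) m(1) m'(1)] m m' assoc[OF f i'(1) m'(1)] assoc[OF f f' i''(1)] by simp
  show "(cop_map C f' g' \<cdot> cop_map C f g) \<cdot> coproj2 C A B = coproj2 C A'' B'' \<cdot> (g' \<cdot> g)"
    using assoc[OF i(2) m(1) m'(1)] m m' assoc[OF g i'(2) m'(1)] assoc[OF g g' i''(2)] by simp
qed

lemma coproduct_fctr_is_functor:
  assumes "A \<in> Ob C" "B \<in> Ob C"
  shows "is_functor (prod_cat (slice_cat C A) (slice_cat C B)) (slice_cat C (cop_obj C A B)) (coproduct_fctr C)"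
proof -
  have o: "cop_map C f g \<in> Ar C" "Cd C (cop_map C f g) = cop_obj C (Cd C f) (Cd C g)"
    "Dm C (cop_map C f g) = cop_obj C (Dm C f) (Dm C g)"
    if "f \<in> Ar C" "g \<in> Ar C" for f g
    using cop_map_facts(1)[of f "Dm C f" "Cd C f" g "Dm C g" "Cd C g"] that by (auto simp: hom_def)
  have c: "cop_map C f' g' \<cdot> cop_map C f g = cop_map C (f' \<cdot> f) (g' \<cdot> g)"
    if "f \<in> Ar C" "g \<in> Ar C" "f' \<in> Ar C" "g' \<in> Ar C" "Dm C f' = Cd C f" "Dm C g' = Cd C g" for f g f' g'
    using cop_map_comp[of f "Dm C f" "Cd C f" g "Dm C g" "Cd C g" f' _ g'] that by (auto simp: hom_def)
  show ?thesis
    by (auto simp: is_functor_def prod_cat_def slice_cat_def coproduct_fctr_def hom_def o c cop_map_id dom_in)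
qed

end

section \<open>Locally discrete 2-categories\<close>

lemma ld_sel:
  "Ob (locally_discrete C) = Ob C" "Ar (locally_discrete C) = Ar C" "Dm (locally_discrete C) = Dm C"
  "Cd (locally_discrete C) = Cd C" "Cmp (locally_discrete C) = Cmp C" "Ide (locally_discrete C) = Ide C"
  "hom (locally_discrete C) = hom C" "VId (locally_discrete C) = (\<lambda>f. f)" "HComp (locally_discrete C) = Cmp C"
  "VComp (locally_discrete C) = (\<lambda>\<beta> \<alpha>. \<alpha>)" "Cell (locally_discrete C) = Ar C"
  "Ob (hom_cat (locally_discrete C) X Y) = hom C X Y" "Ar (hom_cat (locally_discrete C) X Y) = hom C X Y"
  by (auto simp: locally_discrete_def hom_def fun_eq_iff hom_cat_def)

lemma ld_hom2: "hom (hom_cat (locally_discrete C) X Y) f g = (if f = g \<and> f \<in> hom C X Y then {f} else {})"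
  by (auto simp: locally_discrete_def hom_def hom_cat_def)

lemma ld_hom_cat_sel:
  "Dm (hom_cat (locally_discrete C) X Y) = (\<lambda>f. f)" "Cd (hom_cat (locally_discrete C) X Y) = (\<lambda>f. f)"
  "Ide (hom_cat (locally_discrete C) X Y) = (\<lambda>f. f)" "Cmp (hom_cat (locally_discrete C) X Y) = (\<lambda>g f. f)"
  by (simp_all add: hom_cat_def locally_discrete_def)

lemma two_category_locally_discrete: assumes "category C" shows "two_category (locally_discrete C)"
proof -
  interpret category C by (rule assms)
  show ?thesis
  proof (intro two_category.intro two_category_axioms.intro)
    show "category (locally_discrete C)"
      by unfold_locales (auto simp: ld_sel intro: dom_in cod_in id_in comp_in id_left id_right assoc)
    show "category (hom_cat (locally_discrete C) X Y)" for X Y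
      by unfold_locales (auto simp: ld_sel ld_hom2 ld_hom_cat_sel split: if_splits)
    show "\<exists>X\<in>Ob (locally_discrete C). \<exists>Y\<in>Ob (locally_discrete C). \<alpha> \<in> Ar (hom_cat (locally_discrete C) X Y)"
      if "\<alpha> \<in> Cell (locally_discrete C)" for \<alpha>
      using that dom_in cod_in by (auto simp: ld_sel hom_def)
  qed (auto simp: ld_sel ld_hom2 id_left id_right intro: comp_in assoc split: if_splits)
qed

lemma ld_terminal: "is_terminal2 (locally_discrete C) T \<longleftrightarrow> is_terminal C T"
  unfolding is_terminal2_def is_terminal_def ld_sel by simp

lemma ld_pullback: "is_pullback2 (locally_discrete C) f g p q \<longleftrightarrow> is_pullback C f g p q"
  unfolding is_pullback2_def is_pullback_def ld_sel by (rule iffI; (elim conjE)?; intro conjI; assumption)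

lemma ld_full_mono: assumes "category C" shows "full_mono (locally_discrete C) i \<longleftrightarrow> is_mono C i"
proof -
  interpret category C by (rule assms)
  show ?thesis
  proof
    assume a: "full_mono (locally_discrete C) i"
    then have i: "i \<in> Ar C" and
      inj: "\<And>X. X \<in> Ob C \<Longrightarrow> inj_on (\<lambda>f. i \<cdot>\<^bsub>C\<^esub> f) (hom C X (Dm C i))"
      by (auto simp: full_mono_def ld_sel post_fctr_def)
    show "is_mono C i" unfolding is_mono_def using i inj hom_Ob1 by (meson inj_onD)
  next
    assume "is_mono C i"
    then have i: "i \<in> hom C (Dm C i) (Cd C i)" and
      m: "\<And>X f g. f \<in> hom C X (Dm C i) \<Longrightarrow> g \<in> hom C X (Dm C i) \<Longrightarrow> i \<cdot>\<^bsub>C\<^esub> f = i \<cdot>\<^bsub>C\<^esub> g \<Longrightarrow> f = g"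
      by (auto simp: is_mono_def hom_def)
    show "full_mono (locally_discrete C) i" unfolding full_mono_def fully_faithful_def
      using i comp_in[OF _ i] m
      by (auto simp: ld_sel ld_hom2 post_fctr_def bij_betw_def inj_on_def hom_Ar)
  qed
qed

lemma ld_full_subobject_classifier:
  "category C \<Longrightarrow> full_subobject_classifier (locally_discrete C) t \<longleftrightarrow> subobject_classifier C t"
  by (simp add: full_subobject_classifier_def subobject_classifier_def ld_terminal ld_pullback ld_full_mono
      ld_sel bang_def)

section \<open>The indiscrete 2-functor\<close>

locale indisc_category = pullback_category +
  assumes prods: "has_finite_products E"
begin

lemma pr_in:
  assumes "A \<in> Ob E" "B \<in> Ob E"
  shows "pr1 E A B \<in> hom E (pr_obj E A B) A" "pr2 E A B \<in> hom E (pr_obj E A B) B"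
  using finite_products_pr[OF prods assms] category_axioms by (auto simp: is_product_def pr_obj_def)

lemma pr_ex1:
  assumes "u \<in> hom E X A" "v \<in> hom E X B"
  shows "\<exists>!h. h \<in> hom E X (pr_obj E A B) \<and> pr1 E A B \<cdot> h = u \<and> pr2 E A B \<cdot> h = v"
  using finite_products_pr[OF prods hom_Ob2[OF assms(1)] hom_Ob2[OF assms(2)]] category_axioms assms
  by (auto simp: is_product_def pr_obj_def)

lemma pr_pair_facts:
  assumes "u \<in> hom E X A" "v \<in> hom E X B"
  shows "pr_pair E u v \<in> hom E X (pr_obj E A B)" "pr1 E A B \<cdot> pr_pair E u v = u" "pr2 E A B \<cdot> pr_pair E u v = v"
  using theI'[OF pr_ex1[OF assms]] hom_Dm[OF assms(1)] hom_Cd[OF assms(1)] hom_Cd[OF assms(2)]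
  by (auto simp: pr_pair_def)

lemma pr_eqI:
  assumes "h \<in> hom E X (pr_obj E A B)" "k \<in> hom E X (pr_obj E A B)" "A \<in> Ob E" "B \<in> Ob E"
    "pr1 E A B \<cdot> h = pr1 E A B \<cdot> k" "pr2 E A B \<cdot> h = pr2 E A B \<cdot> k"
  shows "h = k"
  using pr_ex1[OF comp_in[OF assms(1) pr_in(1)[OF assms(3,4)]] comp_in[OF assms(1) pr_in(2)[OF assms(3,4)]]] assms
  by metis

lemma pr_map_facts:
  assumes f: "f \<in> hom E A A'" and g: "g \<in> hom E B B'"
  shows "pr_map E f g \<in> hom E (pr_obj E A B) (pr_obj E A' B')"
    "pr1 E A' B' \<cdot> pr_map E f g = f \<cdot> pr1 E A B" "pr2 E A' B' \<cdot> pr_map E f g = g \<cdot> pr2 E A B"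
  using pr_pair_facts[OF comp_in[OF pr_in(1) f] comp_in[OF pr_in(2) g]] hom_Ob1[OF f] hom_Ob1[OF g]
    hom_Dm[OF f] hom_Dm[OF g] by (auto simp: pr_map_def)

lemma indisc_sel:
  "C0 (indisc_obj E X) = X" "C1 (indisc_obj E X) = pr_obj E X X"
  "isrc (indisc_obj E X) = pr1 E X X" "itrg (indisc_obj E X) = pr2 E X X"
  by (auto simp: indisc_obj_def Let_def)

lemma indisc_mul_facts:
  assumes X: "X \<in> Ob E"
  shows "imul (indisc_obj E X) \<in> hom E (pb_obj E (pr1 E X X) (pr2 E X X)) (pr_obj E X X)"
   "pr1 E X X \<cdot> imul (indisc_obj E X) = pr1 E X X \<cdot> pb2 E (pr1 E X X) (pr2 E X X)"
   "pr2 E X X \<cdot> imul (indisc_obj E X) = pr2 E X X \<cdot> pb1 E (pr1 E X X) (pr2 E X X)"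
  using pr_pair_facts[OF comp_in[OF pb2_in[OF pr_in[OF X X]] pr_in(1)[OF X X]] comp_in[OF pb1_in[OF pr_in[OF X X]] pr_in(2)[OF X X]]]
  by (auto simp: indisc_obj_def Let_def)

lemma indisc_icmp:
  assumes X: "X \<in> Ob E" and g: "g \<in> hom E Y (pr_obj E X X)" and f: "f \<in> hom E Y (pr_obj E X X)"
    and c: "pr1 E X X \<cdot> g = pr2 E X X \<cdot> f"
  shows "icmp E (indisc_obj E X) g f \<in> hom E Y (pr_obj E X X)"
    "pr1 E X X \<cdot> icmp E (indisc_obj E X) g f = pr1 E X X \<cdot> f"
    "pr2 E X X \<cdot> icmp E (indisc_obj E X) g f = pr2 E X X \<cdot> g"
proof -
  note p = pr_in[OF X X] note h = pair_facts[OF p g f c] note m = indisc_mul_facts[OF X]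
  note b = pb1_in[OF p] pb2_in[OF p]
  show "icmp E (indisc_obj E X) g f \<in> hom E Y (pr_obj E X X)"
    unfolding icmp_def indisc_sel by (rule comp_in[OF h(1) m(1)])
  show "pr1 E X X \<cdot> icmp E (indisc_obj E X) g f = pr1 E X X \<cdot> f"
    "pr2 E X X \<cdot> icmp E (indisc_obj E X) g f = pr2 E X X \<cdot> g"
    unfolding icmp_def indisc_sel
    using assoc[OF h(1) m(1) p(1)] assoc[OF h(1) m(1) p(2)] assoc[OF h(1) b(1) p(2)] assoc[OF h(1) b(2) p(1)] m h
    by simp_all
qed

lemma indisc_internal: assumes X: "X \<in> Ob E" shows "internal_category E (indisc_obj E X)"
proof -
  let ?s = "pr1 E X X" let ?t = "pr2 E X X" let ?e = "iid (indisc_obj E X)" let ?P = "pr_obj E X X"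
  let ?m = "imul (indisc_obj E X)"
  note p = pr_in[OF X X] note b = pb1_in[OF p] pb2_in[OF p] note m = indisc_mul_facts[OF X]
  have e: "?e \<in> hom E X ?P" "?s \<cdot> ?e = Ide E X" "?t \<cdot> ?e = Ide E X"
    using pr_pair_facts[OF id_in[OF X] id_in[OF X]] by (auto simp: indisc_obj_def Let_def)
  have P: "?P \<in> Ob E" using p hom_Ob1 by blast
  note I = id_in[OF P]
  note et = comp_in[OF p(2) e(1)] and es = comp_in[OF p(1) e(1)]
  have c1: "?s \<cdot> (?e \<cdot> ?t) = ?t \<cdot> Ide E ?P" "?t \<cdot> (?e \<cdot> ?t) = ?t"
    using assoc[OF p(2) e(1) p(1)] assoc[OF p(2) e(1) p(2)] e id_left[OF p(2)] id_right[OF p(2)] by simp_all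
  have c2: "?s \<cdot> Ide E ?P = ?t \<cdot> (?e \<cdot> ?s)" "?s \<cdot> (?e \<cdot> ?s) = ?s"
    using assoc[OF p(1) e(1) p(2)] assoc[OF p(1) e(1) p(1)] e id_left[OF p(1)] id_right[OF p(1)] by simp_all
  have l: "icmp E (indisc_obj E X) (?e \<cdot> ?t) (Ide E ?P) = Ide E ?P"
    by (rule pr_eqI[OF indisc_icmp(1)[OF X et I c1(1)] I X X])
      (simp_all add: indisc_icmp[OF X et I c1(1)] c1 id_right[OF p(2)])
  have r: "icmp E (indisc_obj E X) (Ide E ?P) (?e \<cdot> ?s) = Ide E ?P"
    by (rule pr_eqI[OF indisc_icmp(1)[OF X I es c2(1)] I X X])
      (use indisc_icmp[OF X I es c2(1)] c2 id_right[OF p(1)] in simp_all)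
  let ?p = "pb1 E ?s ?t" let ?q = "pb2 E ?s ?t"
  let ?pp = "pb1 E ?q ?p" let ?qq = "pb2 E ?q ?p"
  note pp = pb1_in[OF b(2,1)] and qq = pb2_in[OF b(2,1)]
  note com = pb_comm[OF b(2,1)] pb_comm[OF p]
  note ty = comp_in[OF pp m(1)] comp_in[OF qq b(2)] comp_in[OF pp b(1)] comp_in[OF qq m(1)]
  note as = assoc[OF pp m(1) p(1)] assoc[OF pp m(1) p(2)] assoc[OF qq m(1) p(1)] assoc[OF qq m(1) p(2)]
     assoc[OF pp b(1) p(1)] assoc[OF pp b(1) p(2)] assoc[OF pp b(2) p(1)] assoc[OF pp b(2) p(2)]
     assoc[OF qq b(1) p(1)] assoc[OF qq b(1) p(2)] assoc[OF qq b(2) p(1)] assoc[OF qq b(2) p(2)]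
  have d1: "?s \<cdot> (?m \<cdot> ?pp) = ?t \<cdot> (?q \<cdot> ?qq)" using as m com by metis
  have d2: "?s \<cdot> (?p \<cdot> ?pp) = ?t \<cdot> (?m \<cdot> ?qq)" using as m com by metis
  note i1 = indisc_icmp[OF X ty(1,2) d1] and i2 = indisc_icmp[OF X ty(3,4) d2]
  have a: "icmp E (indisc_obj E X) (?m \<cdot> ?pp) (?q \<cdot> ?qq) = icmp E (indisc_obj E X) (?p \<cdot> ?pp) (?m \<cdot> ?qq)"
    by (rule pr_eqI[OF i1(1) i2(1) X X]) (use i1 i2 as m in metis)+
  show ?thesis unfolding internal_category_def Let_def indisc_sel
    using X P p e m l r a by auto
qed

lemma indisc_functor: assumes f: "f \<in> hom E X Y" shows "internal_functor E (indisc_arr E f)"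
    "idom (indisc_arr E f) = indisc_obj E X" "icod (indisc_arr E f) = indisc_obj E Y"
    "F0 (indisc_arr E f) = f" "F1 (indisc_arr E f) = pr_map E f f"
proof -
  show sel: "idom (indisc_arr E f) = indisc_obj E X" "icod (indisc_arr E f) = indisc_obj E Y"
    "F0 (indisc_arr E f) = f" "F1 (indisc_arr E f) = pr_map E f f"
    using hom_Dm[OF f] hom_Cd[OF f] by (simp_all add: indisc_arr_def)
  note X = hom_Ob1[OF f] and Y = hom_Ob2[OF f]
  note p = pr_in[OF X X] and py = pr_in[OF Y Y] note b = pb1_in[OF p] pb2_in[OF p] note m = indisc_mul_facts[OF X]
  note ff = pr_map_facts[OF f f]
  note xe = ic_simps(5)[OF indisc_internal[OF X], unfolded indisc_sel]
    and ye = ic_simps(5)[OF indisc_internal[OF Y], unfolded indisc_sel]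
  have e: "pr1 E X X \<cdot> iid (indisc_obj E X) = Ide E X" "pr2 E X X \<cdot> iid (indisc_obj E X) = Ide E X"
    "pr1 E Y Y \<cdot> iid (indisc_obj E Y) = Ide E Y" "pr2 E Y Y \<cdot> iid (indisc_obj E Y) = Ide E Y"
    using pr_pair_facts[OF id_in[OF X] id_in[OF X]] pr_pair_facts[OF id_in[OF Y] id_in[OF Y]]
    by (auto simp: indisc_obj_def Let_def)
  have i: "pr_map E f f \<cdot> iid (indisc_obj E X) = iid (indisc_obj E Y) \<cdot> f"
    by (rule pr_eqI[OF comp_in[OF xe ff(1)] comp_in[OF f ye] Y Y])
      (use assoc[OF xe ff(1) py(1)] assoc[OF xe ff(1) py(2)] assoc[OF f ye py(1)] assoc[OF f ye py(2)]
        assoc[OF xe p(1) f] assoc[OF xe p(2) f] ff e id_left[OF f] id_right[OF f] in simp_all)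
  let ?p = "pb1 E (pr1 E X X) (pr2 E X X)" let ?q = "pb2 E (pr1 E X X) (pr2 E X X)"
  note as = assoc[OF b(1) ff(1) py(1)] assoc[OF b(1) ff(1) py(2)] assoc[OF b(2) ff(1) py(1)] assoc[OF b(2) ff(1) py(2)]
    assoc[OF b(1) p(1) f] assoc[OF b(1) p(2) f] assoc[OF b(2) p(1) f] assoc[OF b(2) p(2) f]
    assoc[OF m(1) ff(1) py(1)] assoc[OF m(1) ff(1) py(2)] assoc[OF m(1) p(1) f] assoc[OF m(1) p(2) f]
  have c: "pr1 E Y Y \<cdot> (pr_map E f f \<cdot> ?p) = pr2 E Y Y \<cdot> (pr_map E f f \<cdot> ?q)"
    using as ff pb_comm[OF p] by metis
  note ii = indisc_icmp[OF Y comp_in[OF b(1) ff(1)] comp_in[OF b(2) ff(1)] c]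
  have mm: "pr_map E f f \<cdot> imul (indisc_obj E X) = icmp E (indisc_obj E Y) (pr_map E f f \<cdot> ?p) (pr_map E f f \<cdot> ?q)"
    by (rule pr_eqI[OF comp_in[OF m(1) ff(1)] ii(1) Y Y]) (use as ff ii m in metis)+
  show "internal_functor E (indisc_arr E f)"
    unfolding internal_functor_def Let_def sel indisc_sel
    using indisc_internal[OF X] indisc_internal[OF Y] f ff i mm by auto
qed

lemma pr_map_id:
  assumes X: "X \<in> Ob E"
  shows "pr_map E (Ide E X) (Ide E X) = Ide E (pr_obj E X X)"
proof -
  note p = pr_in[OF X X] and f = pr_map_facts[OF id_in[OF X] id_in[OF X]]
  show ?thesis by (rule pr_eqI[OF f(1) id_in[OF hom_Ob1[OF p(1)]] X X])
    (use f id_left[OF p(1)] id_left[OF p(2)] id_right[OF p(1)] id_right[OF p(2)] in simp_all)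
qed

lemma pr_map_comp:
  assumes f: "f \<in> hom E X Y" and g: "g \<in> hom E Y Z"
  shows "pr_map E (g \<cdot> f) (g \<cdot> f) = pr_map E g g \<cdot> pr_map E f f"
proof -
  note gf = comp_in[OF f g] and X = hom_Ob1[OF f] and Y = hom_Ob2[OF f] and Z = hom_Ob2[OF g]
  note a = pr_map_facts[OF f f] and b = pr_map_facts[OF g g] and c = pr_map_facts[OF gf gf]
  note p = pr_in[OF X X] pr_in[OF Y Y] pr_in[OF Z Z]
  show ?thesis by (rule pr_eqI[OF c(1) comp_in[OF a(1) b(1)] Z Z])
    (use a b c assoc[OF a(1) b(1) p(5)] assoc[OF a(1) b(1) p(6)] assoc[OF a(1) p(3) g] assoc[OF a(1) p(4) g]
      assoc[OF p(1) f g] assoc[OF p(2) f g] in simp_all)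
qed

theorem indisc_is_two_functor: "is_two_functor (locally_discrete E) (Cat E) (indisc E)"
proof -
  interpret T: two_category "Cat E" by (rule two_category_Cat)
  have comp: "indisc_arr E (g \<cdot> f) = ifun_comp E (indisc_arr E g) (indisc_arr E f)"
    if "f \<in> hom E X Y" "g \<in> hom E Y Z" for f g X Y Z
    using that pr_map_comp[OF that] hom_Dm[OF comp_in[OF that]] hom_Cd[OF comp_in[OF that]]
    by (simp add: indisc_arr_def ifun_comp_def hom_Dm hom_Cd)
  have 1: "is_functor (locally_discrete E) (Cat E) \<lparr>fobj = indisc_obj E, farr = indisc_arr E\<rparr>"
    unfolding is_functor_def ld_sel
  proof (simp, intro conjI ballI impI)
    show "a \<in> Ob E \<Longrightarrow> indisc_obj E a \<in> Ob (Cat E)" for a using indisc_internal by (simp add: Cat_def)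
    show "f \<in> Ar E \<Longrightarrow> indisc_arr E f \<in> hom (Cat E) (indisc_obj E (Dm E f)) (indisc_obj E (Cd E f))" for f
      using indisc_functor[of f "Dm E f" "Cd E f"] unfolding Cat_hom by (simp add: hom_def)
    show "a \<in> Ob E \<Longrightarrow> indisc_arr E (Ide E a) = Ide (Cat E) (indisc_obj E a)" for a
      using id_in pr_map_id by (simp add: Cat_def ifun_id_def indisc_arr_def indisc_sel hom_def)
    show "f \<in> Ar E \<Longrightarrow> g \<in> Ar E \<Longrightarrow> Dm E g = Cd E f \<Longrightarrow>
        indisc_arr E (g \<cdot> f) = indisc_arr E g \<cdot>\<^bsub>Cat E\<^esub> indisc_arr E f" for f g
      using comp[of f "Dm E f" "Cd E f" g "Cd E g"] by (simp add: Cat_def hom_def)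
  qed
  have h: "indisc_arr E f \<in> hom (Cat E) (indisc_obj E X) (indisc_obj E Y)" if "f \<in> hom E X Y" for f X Y
    using indisc_functor[OF that] by (simp add: Cat_hom)
  have n: "nat_from (indisc_obj E X) (indisc_obj E Y) (inat_id E (indisc_arr E f)) (indisc_arr E f) (indisc_arr E f)"
    if "f \<in> hom E X Y" for f X Y using indisc_functor[OF that] by (intro nat_id)
  have 2: "is_functor (hom_cat (locally_discrete E) X Y) (hom_cat (Cat E) (indisc_obj E X) (indisc_obj E Y))
     \<lparr>fobj = indisc_arr E, farr = (\<lambda>f. inat_id E (indisc_arr E f))\<rparr>" for X Y
  proof -
    interpret H: category "hom_cat (Cat E) (indisc_obj E X) (indisc_obj E Y)" by (rule hom_category_Cat)
    have ids: "Ide (hom_cat (Cat E) (indisc_obj E X) (indisc_obj E Y)) = inat_id E"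
      by (simp add: hom_cat_def Cat_def)
    have o: "f \<in> hom E X Y \<Longrightarrow> indisc_arr E f \<in> Ob (hom_cat (Cat E) (indisc_obj E X) (indisc_obj E Y))" for f
      using h by (simp add: hom_cat_def)
    have s: "Dm (hom_cat (locally_discrete E) X Y) = (\<lambda>f. f)" "Cd (hom_cat (locally_discrete E) X Y) = (\<lambda>f. f)"
      "Ide (hom_cat (locally_discrete E) X Y) = (\<lambda>f. f)" "Cmp (hom_cat (locally_discrete E) X Y) = (\<lambda>g f. f)"
      by (simp_all add: hom_cat_def locally_discrete_def)
    show ?thesis unfolding is_functor_def ld_sel s
      using o n Cat_hom2 H.id_left[OF H.id_in[OF o]] by (auto simp: ids)
  qed
  have 3: "inat_id E (indisc_arr E (g \<cdot> f)) = HComp (Cat E) (inat_id E (indisc_arr E g)) (inat_id E (indisc_arr E f))"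
    if "f \<in> hom E X Y" "g \<in> hom E Y Z" for f g X Y Z
    using T.HComp_VId[OF h[OF that(1)] h[OF that(2)]] comp[OF that] by (simp add: Cat_def)
  show ?thesis unfolding is_two_functor_def ld_sel
  proof (intro conjI allI ballI)
    show "is_functor (locally_discrete E) (Cat E) \<lparr>fobj = fobj (indisc E), farr = farr (indisc E)\<rparr>"
      using 1 by (simp add: indisc_def)
    show "is_functor (hom_cat (locally_discrete E) X Y) (hom_cat (Cat E) (fobj (indisc E) X) (fobj (indisc E) Y))
        \<lparr>fobj = farr (indisc E), farr = fcell (indisc E)\<rparr>" for X Y
      using 2 by (simp add: indisc_def)
    show "fcell (indisc E) (g \<cdot> f) = HComp (Cat E) (fcell (indisc E) g) (fcell (indisc E) f)"
      if "f \<in> hom E X Y" "g \<in> hom E Y Z" for X Y Z f g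
      using 3[OF that] by (simp add: indisc_def)
  qed
qed

end
end

theory Submission
  imports Defs
begin

text \<open>A functor into an indiscrete category, or out of a discrete one, is determined by its
  object part. Testing against discrete categories shows that \<open>i\<close> is a full monomorphism in
  \<open>Cat E\<close> iff \<open>F0 i\<close> is monic and \<open>F1 i\<close> is the pullback of \<open>F0 i \<times> F0 i\<close> along source and
  target, and that pullbacks in \<open>Cat E\<close> are pullbacks on objects; a commuting square of functors
  with two parallel sides full monomorphisms is a pullback as soon as it is one on objects.
  If \<open>t\<close> classifies subobjects, then full monomorphisms into \<open>B\<close> are classified by the functors
  \<open>B \<rightarrow> indisc \<Omega>\<close> corresponding to classifying maps \<open>C0 B \<rightarrow> \<Omega>\<close>. Conversely, if \<open>T\<close> classifies
  full monomorphisms, then a monomorphism \<open>m : S \<rightarrow> X\<close> is a full monomorphism of the discrete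
  categories on \<open>S\<close> and \<open>X\<close>, and maps \<open>X \<rightarrow> C0 \<Omega>\<close> are functors from the discrete category on
  \<open>X\<close>, so \<open>F0 T\<close> classifies \<open>m\<close>.\<close>

section \<open>Terminal arrows and the 2-dimensional part of pullbacks\<close>

lemma bang_in: "is_terminal C T \<Longrightarrow> X \<in> Ob C \<Longrightarrow> bang C X T \<in> hom C X T"
  unfolding is_terminal_def bang_def by (metis theI')

text \<open>The 2-dimensional part of the universal property is automatic: \<open>p\<close> lifts 2-cells, and
  \<open>g\<close> being faithful on 2-cells gives compatibility with \<open>q\<close>.\<close>

lemma (in two_category) is_pullback2I:
  assumes pb: "is_pullback K f g p q" and g: "full_mono K g" and p: "full_mono K p"
  shows "is_pullback2 K f g p q"
  unfolding is_pullback2_def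
proof (intro conjI pb allI ballI impI)
  have f: "f \<in> hom K (Dm K f) (Cd K g)" and g': "g \<in> hom K (Dm K g) (Cd K g)"
    and p': "p \<in> hom K (Dm K p) (Dm K f)" and q: "q \<in> hom K (Dm K p) (Dm K g)" and com: "f \<cdot>\<^bsub>K\<^esub> p = g \<cdot>\<^bsub>K\<^esub> q"
    using pb by (auto simp: is_pullback_def hom_def)
  have ff: "bij_betw (HComp K (VId K i)) (hom (hom_cat K X (Dm K i)) a b)
      (hom (hom_cat K X (Cd K i)) (i \<cdot>\<^bsub>K\<^esub> a) (i \<cdot>\<^bsub>K\<^esub> b))"
    if "full_mono K i" "a \<in> hom K X (Dm K i)" "b \<in> hom K X (Dm K i)" for i X a b
    using that hom_Ob1[OF that(2)]
    by (auto simp: full_mono_def fully_faithful_def post_fctr_def hom_cat_def)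
  \<comment> \<open>Whiskering by \<open>i\<close> composes source and target with \<open>i\<close>,
    so equations between whiskered 2-cells can be read on their boundaries.\<close>
  have w: "HComp K (VId K i) \<theta> \<in> hom (hom_cat K X (Cd K i)) (i \<cdot>\<^bsub>K\<^esub> VSrc K \<theta>) (i \<cdot>\<^bsub>K\<^esub> VTrg K \<theta>)"
    if i: "i \<in> Ar K" and th: "\<theta> \<in> Ar (hom_cat K X (Dm K i))" for i X \<theta>
  proof -
    note ih = homI[OF i refl refl]
    have st: "VSrc K \<theta> \<in> hom K X (Dm K i)" "VTrg K \<theta> \<in> hom K X (Dm K i)"
      using th by (auto simp: hom_cat_def)
    interpret H: category "hom_cat K (Dm K i) (Cd K i)"
      by (rule hom_category[OF hom_Ob1[OF ih] hom_Ob2[OF ih]])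
    have "VId K i \<in> hom (hom_cat K (Dm K i) (Cd K i)) i i" using H.id_in[of i] ih by (simp add: hom_cat_def)
    moreover have "\<theta> \<in> hom (hom_cat K X (Dm K i)) (VSrc K \<theta>) (VTrg K \<theta>)"
      using th by (simp add: hom_def hom_cat_def)
    ultimately show ?thesis using HComp_in[OF st ih ih] by blast
  qed
  have as: "HComp K (VId K (j \<cdot>\<^bsub>K\<^esub> i)) \<theta> = HComp K (VId K j) (HComp K (VId K i) \<theta>)"
    if i: "i \<in> hom K Y Z" and j: "j \<in> hom K Z W" and th: "\<theta> \<in> Ar (hom_cat K X Y)" for i j \<theta> X Y Z W
  proof -
    have "VId K k \<in> Ar (hom_cat K Y' Z')" if "k \<in> hom K Y' Z'" for k Y' Z'
      using category.id_in[OF hom_category[OF hom_Ob1[OF that] hom_Ob2[OF that]], of k] that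
      by (simp add: hom_cat_def hom_def)
    then show ?thesis using HComp_assoc[OF th] HComp_VId[OF i j] i j by metis
  qed
  fix X \<alpha> \<beta> assume al: "\<alpha> \<in> Ar (hom_cat K X (Dm K f))" and be: "\<beta> \<in> Ar (hom_cat K X (Dm K g))"
    and eq: "HComp K (VId K f) \<alpha> = HComp K (VId K g) \<beta>"
  have al': "VSrc K \<alpha> \<in> hom K X (Dm K f)" "VTrg K \<alpha> \<in> hom K X (Dm K f)"
    and be': "VSrc K \<beta> \<in> hom K X (Dm K g)" "VTrg K \<beta> \<in> hom K X (Dm K g)"
    using al be by (auto simp: hom_cat_def)
  have e: "f \<cdot>\<^bsub>K\<^esub> VSrc K \<alpha> = g \<cdot>\<^bsub>K\<^esub> VSrc K \<beta>" "f \<cdot>\<^bsub>K\<^esub> VTrg K \<alpha> = g \<cdot>\<^bsub>K\<^esub> VTrg K \<beta>"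
    using w[OF hom_Ar[OF f] al] w[OF hom_Ar[OF g'] be] eq by (auto simp: hom_def hom_cat_def)
  have ex: "\<exists>!h. h \<in> hom K X (Dm K p) \<and> p \<cdot>\<^bsub>K\<^esub> h = u \<and> q \<cdot>\<^bsub>K\<^esub> h = v"
    if "u \<in> hom K X (Dm K f)" "v \<in> hom K X (Dm K g)" "f \<cdot>\<^bsub>K\<^esub> u = g \<cdot>\<^bsub>K\<^esub> v" for u v
    using pb that unfolding is_pullback_def by blast
  obtain a where a: "a \<in> hom K X (Dm K p)" "p \<cdot>\<^bsub>K\<^esub> a = VSrc K \<alpha>" "q \<cdot>\<^bsub>K\<^esub> a = VSrc K \<beta>"
    using ex[OF al'(1) be'(1) e(1)] by blast
  obtain b where b: "b \<in> hom K X (Dm K p)" "p \<cdot>\<^bsub>K\<^esub> b = VTrg K \<alpha>" "q \<cdot>\<^bsub>K\<^esub> b = VTrg K \<beta>"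
    using ex[OF al'(2) be'(2) e(2)] by blast
  have "\<alpha> \<in> hom (hom_cat K X (Cd K p)) (p \<cdot>\<^bsub>K\<^esub> a) (p \<cdot>\<^bsub>K\<^esub> b)"
    using al a b hom_Cd[OF p'] by (simp add: hom_def hom_cat_def)
  then obtain \<gamma> where ga: "\<gamma> \<in> hom (hom_cat K X (Dm K p)) a b" "HComp K (VId K p) \<gamma> = \<alpha>"
    using ff[OF p a(1) b(1)] by (metis bij_betw_imp_surj_on imageE)
  have gA: "\<gamma> \<in> Ar (hom_cat K X (Dm K p))" and gs: "VSrc K \<gamma> = a" "VTrg K \<gamma> = b"
    using ga by (auto simp: hom_def hom_cat_def)
  have qg: "HComp K (VId K q) \<gamma> \<in> hom (hom_cat K X (Dm K g)) (VSrc K \<beta>) (VTrg K \<beta>)"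
    using w[OF hom_Ar[OF q], of \<gamma> X] gA gs a b hom_Dm[OF q] hom_Cd[OF q] by simp
  have "HComp K (VId K g) (HComp K (VId K q) \<gamma>) = HComp K (VId K g) \<beta>"
    using as[OF p' f gA] as[OF q g' gA] com ga eq by simp
  moreover have "\<beta> \<in> hom (hom_cat K X (Dm K g)) (VSrc K \<beta>) (VTrg K \<beta>)"
    using be by (simp add: hom_def hom_cat_def)
  ultimately have qb: "HComp K (VId K q) \<gamma> = \<beta>"
    using ff[OF g be'] qg by (meson bij_betw_imp_inj_on inj_onD)
  show "\<exists>!\<gamma>. \<gamma> \<in> Ar (hom_cat K X (Dm K p)) \<and> HComp K (VId K p) \<gamma> = \<alpha> \<and> HComp K (VId K q) \<gamma> = \<beta>"
  proof (rule ex1I[of _ \<gamma>])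
    fix \<delta> assume d: "\<delta> \<in> Ar (hom_cat K X (Dm K p)) \<and> HComp K (VId K p) \<delta> = \<alpha> \<and> HComp K (VId K q) \<delta> = \<beta>"
    then have dp: "\<delta> \<in> Ar (hom_cat K X (Dm K p))" "\<delta> \<in> Ar (hom_cat K X (Dm K q))"
      and de: "HComp K (VId K p) \<delta> = \<alpha>" "HComp K (VId K q) \<delta> = \<beta>"
      using hom_Dm[OF q] by auto
    \<comment> \<open>The 1-dimensional uniqueness forces \<open>\<delta>\<close> to run from
      \<open>a\<close> to \<open>b\<close>; it is then parallel to \<open>\<gamma>\<close>, and
      faithfulness of \<open>p\<close> applies.\<close>
    have dst: "VSrc K \<delta> \<in> hom K X (Dm K p)" "VTrg K \<delta> \<in> hom K X (Dm K p)" using dp by (auto simp: hom_cat_def)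
    have "p \<cdot>\<^bsub>K\<^esub> VSrc K \<delta> = VSrc K \<alpha>" "p \<cdot>\<^bsub>K\<^esub> VTrg K \<delta> = VTrg K \<alpha>"
      "q \<cdot>\<^bsub>K\<^esub> VSrc K \<delta> = VSrc K \<beta>" "q \<cdot>\<^bsub>K\<^esub> VTrg K \<delta> = VTrg K \<beta>"
      using w[OF hom_Ar[OF p'] dp(1)] w[OF hom_Ar[OF q] dp(2)] de by (auto simp: hom_def hom_cat_def)
    then have "VSrc K \<delta> = a" "VTrg K \<delta> = b"
      using ex[OF al'(1) be'(1) e(1)] ex[OF al'(2) be'(2) e(2)] a b dst by blast+
    then have "\<delta> \<in> hom (hom_cat K X (Dm K p)) a b" using dp by (simp add: hom_def hom_cat_def)
    then show "\<delta> = \<gamma>" using ff[OF p a(1) b(1)] ga de by (metis bij_betw_imp_inj_on inj_onD)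
  qed (use gA ga qb in blast)
qed

section \<open>Discrete internal categories and functors out of them\<close>

text \<open>All arrows are identities, so \<open>X\<close> is also the object of arrows. A
  composable pair consists of two equal elements, and either pullback projection can serve as
  composition.\<close>

definition disc_obj :: "('o, 'm) cat \<Rightarrow> 'o \<Rightarrow> ('o, 'm) icat" where
  "disc_obj E X = \<lparr>C0 = X, C1 = X, isrc = Ide E X, itrg = Ide E X, iid = Ide E X,
     imul = pb1 E (Ide E X) (Ide E X)\<rparr>"

text \<open>The functor naming a generalised object \<open>x\<close> of \<open>A\<close>. Since
  every arrow of the domain is an identity, the arrow part has to be \<open>iid A\<close> after
  \<open>x\<close>.\<close>

definition disc_fun :: "('o, 'm) cat \<Rightarrow> ('o, 'm) icat \<Rightarrow> 'm \<Rightarrow> ('o, 'm) ifun" where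
  "disc_fun E A x = \<lparr>idom = disc_obj E (Dm E x), icod = A, F0 = x, F1 = iid A \<cdot>\<^bsub>E\<^esub> x\<rparr>"

text \<open>The second clause is the pullback condition on \<open>F1 i\<close>, spelled out on
  generalised elements at stage \<open>Z\<close>: an arrow between images of objects comes from
  exactly one arrow between these objects. In this form it makes sense in
  \<open>pullback_category\<close>, where no products are chosen.\<close>

definition internally_full_mono :: "('o, 'm) cat \<Rightarrow> ('o, 'm) ifun \<Rightarrow> bool" where
  "internally_full_mono E i \<longleftrightarrow> internal_functor E i \<and> is_mono E (F0 i) \<and>
     (\<forall>Z. \<forall>x \<in> hom E Z (C0 (idom i)). \<forall>y \<in> hom E Z (C0 (idom i)). \<forall>b \<in> hom E Z (C1 (icod i)).
        isrc (icod i) \<cdot>\<^bsub>E\<^esub> b = F0 i \<cdot>\<^bsub>E\<^esub> x \<and> itrg (icod i) \<cdot>\<^bsub>E\<^esub> b = F0 i \<cdot>\<^bsub>E\<^esub> y \<longrightarrow>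
        (\<exists>!a. a \<in> hom E Z (C1 (idom i)) \<and> isrc (idom i) \<cdot>\<^bsub>E\<^esub> a = x \<and> itrg (idom i) \<cdot>\<^bsub>E\<^esub> a = y \<and>
           F1 i \<cdot>\<^bsub>E\<^esub> a = b))"

lemma disc_sel:
  "C0 (disc_obj E X) = X" "C1 (disc_obj E X) = X" "isrc (disc_obj E X) = Ide E X"
  "itrg (disc_obj E X) = Ide E X" "iid (disc_obj E X) = Ide E X"
  "imul (disc_obj E X) = pb1 E (Ide E X) (Ide E X)"
  by (simp_all add: disc_obj_def)

lemma Cat_sel:
  "Ob (Cat E) = {A. internal_category E A}" "Ar (Cat E) = {F. internal_functor E F}"
  "Dm (Cat E) = idom" "Cd (Cat E) = icod" "Cmp (Cat E) = ifun_comp E" "Ide (Cat E) = ifun_id E"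
  "VId (Cat E) = inat_id E" "HComp (Cat E) = inat_hcomp E"
  by (simp_all add: Cat_def)

lemma ifun_comp_sel:
  "idom (ifun_comp E G F) = idom F" "icod (ifun_comp E G F) = icod G"
  "F0 (ifun_comp E G F) = F0 G \<cdot>\<^bsub>E\<^esub> F0 F" "F1 (ifun_comp E G F) = F1 G \<cdot>\<^bsub>E\<^esub> F1 F"
  by (simp_all add: ifun_comp_def)

lemma ifun_eqI:
  "idom F = idom G \<Longrightarrow> icod F = icod G \<Longrightarrow> F0 F = F0 G \<Longrightarrow> F1 F = F1 G \<Longrightarrow> F = (G :: ('o, 'm) ifun)"
  by simp

context pullback_category begin

lemma disc_icmp:
  assumes "g \<in> hom E X Y" "g' \<in> hom E X Y" "g = g'"
  shows "icmp E (disc_obj E Y) g g' = g"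
proof -
  note I = id_in[OF hom_Ob2[OF assms(1)]]
  show ?thesis using pair_facts[OF I I assms(1,2)] assms(3) by (simp add: icmp_def disc_sel)
qed

lemma disc_internal:
  assumes X: "X \<in> Ob E" shows "internal_category E (disc_obj E X)"
proof -
  note I = id_in[OF X]
  let ?p = "pb1 E (Ide E X) (Ide E X)" let ?q = "pb2 E (Ide E X) (Ide E X)"
  note p = pb1_in[OF I I] and q = pb2_in[OF I I]
  \<comment> \<open>Both legs of the cospan are identities, so the two projections coincide and
    triples are pairs over \<open>?q\<close> on both sides.\<close>
  have pq: "?p = ?q" using pb_comm[OF I I] id_left[OF p] id_left[OF q] by simp
  let ?pp = "pb1 E ?q ?q" let ?qq = "pb2 E ?q ?q"
  note pp = pb1_in[OF q q] and qq = pb2_in[OF q q]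
  have com: "?q \<cdot> ?pp = ?q \<cdot> ?qq" by (rule pb_comm[OF q q])
  note qpp = comp_in[OF pp q] and qqq = comp_in[OF qq q]
  show ?thesis unfolding internal_category_def Let_def disc_sel
    using X I p q pq com id_left[OF I] id_left[OF q] disc_icmp[OF I I] disc_icmp[OF qpp qqq] by simp
qed

lemma disc_fun_in:
  assumes A: "internal_category E A" and x: "x \<in> hom E X (C0 A)"
  shows "internal_functor E (disc_fun E A x)" "idom (disc_fun E A x) = disc_obj E X"
    "icod (disc_fun E A x) = A" "F0 (disc_fun E A x) = x" "F1 (disc_fun E A x) = iid A \<cdot> x"
proof -
  show s: "idom (disc_fun E A x) = disc_obj E X"
    "icod (disc_fun E A x) = A" "F0 (disc_fun E A x) = x" "F1 (disc_fun E A x) = iid A \<cdot> x"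
    using hom_Dm[OF x] by (simp_all add: disc_fun_def)
  note X = hom_Ob1[OF x] note I = id_in[OF X] and a = ic_simps[OF A]
  interpret A: internal_cat E A by (rule ic[OF A])
  note ix = comp_in[OF x a(5)]
  let ?p = "pb1 E (Ide E X) (Ide E X)" let ?q = "pb2 E (Ide E X) (Ide E X)"
  note p = pb1_in[OF I I] and q = pb2_in[OF I I]
  have pq: "?p = ?q" using pb_comm[OF I I] id_left[OF p] id_left[OF q] by simp
  have m: "icmp E A ((iid A \<cdot> x) \<cdot> ?q) ((iid A \<cdot> x) \<cdot> ?q) = (iid A \<cdot> x) \<cdot> ?q"
    using A.icmp_id_left[OF comp_in[OF q ix]] A.trg_id[OF comp_in[OF q x]] assoc[OF q x a(5)] by simp
  show "internal_functor E (disc_fun E A x)"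
    unfolding internal_functor_def Let_def s disc_sel
    using A disc_internal[OF X] x ix A.src_id[OF x] A.trg_id[OF x] id_right[OF x] id_right[OF ix] m pq
    by simp
qed

text \<open>Preservation of identities determines \<open>F1 F\<close>, because \<open>iid\<close> of
  a discrete category is an identity arrow of \<open>E\<close>.\<close>

lemma disc_fun_unique:
  assumes F: "internal_functor E F" "idom F = disc_obj E X" "icod F = A"
  shows "F = disc_fun E A (F0 F)"
proof -
  note f = fun_facts[OF F(1), unfolded F(2,3) disc_sel]
  show ?thesis using f(5) id_right[OF f(4)] hom_Dm[OF f(3)] F by (intro ifun_eqI) (simp_all add: disc_fun_def)
qed

section \<open>Full monomorphisms in \<open>Cat E\<close>\<close>

text \<open>The horizontal composite carries an extra factor from the identity transformation on
  \<open>i\<close>; the left unit law removes it, leaving \<open>F1 i\<close> applied to the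
  component.\<close>

lemma whisker:
  assumes al: "nat_from X A \<alpha> F G" and i: "internal_functor E i" "idom i = A" "icod i = B"
  shows "nat_from X B (inat_hcomp E (inat_id E i) \<alpha>) (ifun_comp E i F) (ifun_comp E i G)"
    "ncmp (inat_hcomp E (inat_id E i) \<alpha>) = F1 i \<cdot> ncmp \<alpha>"
proof -
  show "nat_from X B (inat_hcomp E (inat_id E i) \<alpha>) (ifun_comp E i F) (ifun_comp E i G)"
    by (rule nat_hcomp[OF al nat_id[OF i]])
  note n = nat_facts[OF al] and f = fun_facts[OF i(1), unfolded i(2,3)]
  have G: "F0 G \<in> hom E (C0 X) (C0 A)" using fun_facts[OF n(2)] n by simp
  show "ncmp (inat_hcomp E (inat_id E i) \<alpha>) = F1 i \<cdot> ncmp \<alpha>"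
    using internal_cat.icmp_id_left[OF ic[OF f(2)] comp_in[OF n(11) f(4)]] fun_st[OF i n(11)] n(10,13)
      assoc[OF G f(3) ic_simps(5)[OF f(2)]] i by (simp add: inat_hcomp_def inat_id_def)
qed

text \<open>Monicity of \<open>F0 i\<close> makes the sources and the targets agree, and then the
  uniqueness in the second clause applies. Equations between arrows can thus be checked after
  \<open>F1 i\<close>.\<close>

lemma internally_full_mono_F1:
  assumes i: "internally_full_mono E i" and a: "a \<in> hom E Z (C1 (idom i))" "a' \<in> hom E Z (C1 (idom i))"
    and e: "F1 i \<cdot> a = F1 i \<cdot> a'"
  shows "a = a'"
proof -
  have F: "internal_functor E i" and m: "is_mono E (F0 i)" using i by (auto simp: internally_full_mono_def)
  note f = fun_facts[OF F] note s = ic_simps(3,4)[OF f(1)]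
  note sa = comp_in[OF a(1) s(1)] comp_in[OF a(1) s(2)] comp_in[OF a(2) s(1)] comp_in[OF a(2) s(2)]
  have mm: "x = y" if "x \<in> hom E Z (C0 (idom i))" "y \<in> hom E Z (C0 (idom i))" "F0 i \<cdot> x = F0 i \<cdot> y" for x y
    using m that hom_Dm[OF f(3)] unfolding is_mono_def by auto
  have "isrc (idom i) \<cdot> a = isrc (idom i) \<cdot> a'" "itrg (idom i) \<cdot> a = itrg (idom i) \<cdot> a'"
    using mm[OF sa(1,3)] mm[OF sa(2,4)] fun_src[OF F a(1)] fun_src[OF F a(2)] e by simp_all
  moreover have "\<exists>!c. c \<in> hom E Z (C1 (idom i)) \<and> isrc (idom i) \<cdot> c = isrc (idom i) \<cdot> a \<and>
      itrg (idom i) \<cdot> c = itrg (idom i) \<cdot> a \<and> F1 i \<cdot> c = F1 i \<cdot> a"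
    using i sa(1,2) comp_in[OF a(1) f(4)] fun_src[OF F a(1)] unfolding internally_full_mono_def by blast
  ultimately show ?thesis using a e by metis
qed

text \<open>Fullness supplies the arrow part of the lift, and its functor laws hold because they
  hold after the left cancellable \<open>F1 p\<close>. Hence only the object part has to be
  factored.\<close>

lemma internally_full_mono_lift:
  assumes p: "internally_full_mono E p" and U: "internal_functor E U" "icod U = icod p"
    and h: "h \<in> hom E (C0 (idom U)) (C0 (idom p))" "F0 p \<cdot> h = F0 U"
  obtains H where "internal_functor E H" "idom H = idom U" "icod H = idom p" "F0 H = h" "ifun_comp E p H = U"
proof -
  have F: "internal_functor E p" using p by (auto simp: internally_full_mono_def)
  note f = fun_facts[OF F] and u = fun_facts[OF U(1), unfolded U(2)]
  note x = ic_simps[OF u(1)] and P = ic_simps[OF f(1)]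
  note hs = comp_in[OF x(3) h(1)] and ht = comp_in[OF x(4) h(1)]
  have "isrc (icod p) \<cdot> F1 U = F0 p \<cdot> (h \<cdot> isrc (idom U))" "itrg (icod p) \<cdot> F1 U = F0 p \<cdot> (h \<cdot> itrg (idom U))"
    using u(6,7) h(2) assoc[OF x(3) h(1) f(3)] assoc[OF x(4) h(1) f(3)] by simp_all
  \<comment> \<open>Fullness is applied to the generic arrow: the stage is
    \<open>C1 (idom U)\<close> and the element is \<open>F1 U\<close>.\<close>
  then obtain a where a: "a \<in> hom E (C1 (idom U)) (C1 (idom p))" "isrc (idom p) \<cdot> a = h \<cdot> isrc (idom U)"
      "itrg (idom p) \<cdot> a = h \<cdot> itrg (idom U)" "F1 p \<cdot> a = F1 U"
    using p hs ht u(4) unfolding internally_full_mono_def by blast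
  let ?H = "\<lparr>idom = idom U, icod = idom p, F0 = h, F1 = a\<rparr>"
  have i: "a \<cdot> iid (idom U) = iid (idom p) \<cdot> h"
    by (rule internally_full_mono_F1[OF p comp_in[OF x(5) a(1)] comp_in[OF h(1) P(5)]])
      (use assoc[OF x(5) a(1) f(4)] a(4) u(5) fun_id[OF F h(1)] h(2) in simp)
  let ?p = "pb1 E (isrc (idom U)) (itrg (idom U))" let ?q = "pb2 E (isrc (idom U)) (itrg (idom U))"
  note pi = pb1_in[OF x(3,4)] and qi = pb2_in[OF x(3,4)]
  note ap = comp_in[OF pi a(1)] and aq = comp_in[OF qi a(1)]
  have c: "isrc (idom p) \<cdot> (a \<cdot> ?p) = itrg (idom p) \<cdot> (a \<cdot> ?q)"
    using assoc[OF pi a(1) P(3)] assoc[OF qi a(1) P(4)] a assoc[OF pi x(3) h(1)] assoc[OF qi x(4) h(1)]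
      pb_comm[OF x(3,4)] by simp
  have ax: "F1 U \<cdot> imul (idom U) = icmp E (icod p) (F1 U \<cdot> ?p) (F1 U \<cdot> ?q)"
    using U unfolding internal_functor_def Let_def by metis
  have m: "a \<cdot> imul (idom U) = icmp E (idom p) (a \<cdot> ?p) (a \<cdot> ?q)"
    by (rule internally_full_mono_F1[OF p comp_in[OF x(6) a(1)] internal_cat.icmp_facts(1)[OF ic[OF f(1)] ap aq c]])
      (use assoc[OF x(6) a(1) f(4)] a(4) ax fun_icmp[OF F ap aq c] assoc[OF pi a(1) f(4)] assoc[OF qi a(1) f(4)] in simp)
  have "internal_functor E ?H" using f(1) u(1) h(1) a i m by (simp add: internal_functor_def Let_def)
  then show ?thesis using that[of ?H] a(4) h(2) U(2) by (simp add: ifun_comp_def)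
qed

lemma internally_full_mono_cancel:
  assumes i: "internally_full_mono E i" and F: "internal_functor E F" "icod F = idom i"
    and G: "internal_functor E G" "icod G = idom i" and e: "ifun_comp E i F = ifun_comp E i G"
  shows "F = G"
proof -
  have d: "idom F = idom G" "F0 i \<cdot> F0 F = F0 i \<cdot> F0 G" "F1 i \<cdot> F1 F = F1 i \<cdot> F1 G"
    using arg_cong[OF e, of idom] arg_cong[OF e, of F0] arg_cong[OF e, of F1] by (simp_all add: ifun_comp_sel)
  note f = fun_facts[OF F(1), unfolded F(2)] and g = fun_facts[OF G(1), unfolded G(2), folded d(1)]
  have "is_mono E (F0 i)" "Dm E (F0 i) = C0 (idom i)"
    using i hom_Dm[OF fun_facts(3)] by (auto simp: internally_full_mono_def)
  then have "F0 F = F0 G" using f(3) g(3) d(2) unfolding is_mono_def by auto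
  then show ?thesis using internally_full_mono_F1[OF i f(4) g(4) d(3)] d(1) F(2) G(2) by simp
qed

text \<open>A 2-cell between composites with \<open>i\<close> has a component with endpoints in the
  image of \<open>F0 i\<close>, so fullness lifts it. Naturality of the lift, like uniqueness, is
  inherited through cancellation of \<open>F1 i\<close>.\<close>

lemma full_mono_CatI:
  assumes i: "internally_full_mono E i" shows "full_mono (Cat E) i"
proof -
  have F: "internal_functor E i" and m: "is_mono E (F0 i)" using i by (auto simp: internally_full_mono_def)
  note f = fun_facts[OF F]
  have "bij_betw (inat_hcomp E (inat_id E i)) (hom (hom_cat (Cat E) X (idom i)) G H)
      (hom (hom_cat (Cat E) X (icod i)) (ifun_comp E i G) (ifun_comp E i H))"
    if G: "G \<in> hom (Cat E) X (idom i)" and H: "H \<in> hom (Cat E) X (idom i)" for X G H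
  proof -
    note w = whisker[OF _ F refl refl]
    have G': "internal_functor E G" "idom G = X" "icod G = idom i"
      and H': "internal_functor E H" "idom H = X" "icod H = idom i" using G H by (auto simp: Cat_hom)
    note g = fun_facts[OF G'(1), unfolded G'(2,3)] and h = fun_facts[OF H'(1), unfolded H'(2,3)]
    note x = ic_simps[OF g(1)] and A = ic_simps[OF f(1)] and B = ic_simps[OF f(2)]
    have 1: "\<alpha> = \<beta>" if a: "nat_from X (idom i) \<alpha> G H" and b: "nat_from X (idom i) \<beta> G H"
      and e: "inat_hcomp E (inat_id E i) \<alpha> = inat_hcomp E (inat_id E i) \<beta>" for \<alpha> \<beta>
    proof -
      note na = nat_facts[OF a] and nb = nat_facts[OF b]
      have "ncmp \<alpha> = ncmp \<beta>"
        by (rule internally_full_mono_F1[OF i na(11) nb(11)]) (use w(2)[OF a] w(2)[OF b] e in simp)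
      then show ?thesis using na nb by simp
    qed
    have 2: "\<exists>\<alpha>. nat_from X (idom i) \<alpha> G H \<and> inat_hcomp E (inat_id E i) \<alpha> = \<beta>"
      if b: "nat_from X (icod i) \<beta> (ifun_comp E i G) (ifun_comp E i H)" for \<beta>
    proof -
      note nb = nat_facts[OF b]
      have "isrc (icod i) \<cdot> ncmp \<beta> = F0 i \<cdot> F0 G" "itrg (icod i) \<cdot> ncmp \<beta> = F0 i \<cdot> F0 H"
        using nb by (simp_all add: ifun_comp_sel)
      then obtain a where a: "a \<in> hom E (C0 X) (C1 (idom i))" "isrc (idom i) \<cdot> a = F0 G"
          "itrg (idom i) \<cdot> a = F0 H" "F1 i \<cdot> a = ncmp \<beta>"
        using i g(3) h(3) nb(11) unfolding internally_full_mono_def by blast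
      note at = comp_in[OF x(4) a(1)] and as = comp_in[OF x(3) a(1)]
      have c1: "isrc (idom i) \<cdot> (a \<cdot> itrg X) = itrg (idom i) \<cdot> F1 G"
        using assoc[OF x(4) a(1) A(3)] a(2) g(7) by simp
      have c2: "isrc (idom i) \<cdot> F1 H = itrg (idom i) \<cdot> (a \<cdot> isrc X)"
        using assoc[OF x(3) a(1) A(4)] a(3) h(6) by simp
      have "icmp E (idom i) (a \<cdot> itrg X) (F1 G) = icmp E (idom i) (F1 H) (a \<cdot> isrc X)"
        by (rule internally_full_mono_F1[OF i internal_cat.icmp_facts(1)[OF ic[OF f(1)] at g(4) c1]
              internal_cat.icmp_facts(1)[OF ic[OF f(1)] h(4) as c2]])
          (use fun_icmp[OF F at g(4) c1] fun_icmp[OF F h(4) as c2] assoc[OF x(4) a(1) f(4)]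
            assoc[OF x(3) a(1) f(4)] a(4) nb(14) in \<open>simp add: ifun_comp_sel\<close>)
      then have n: "nat_from X (idom i) \<lparr>nsrc = G, ntrg = H, ncmp = a\<rparr> G H"
        using G' H' a by (intro nat_fromI) simp_all
      then have "inat_hcomp E (inat_id E i) \<lparr>nsrc = G, ntrg = H, ncmp = a\<rparr> = \<beta>"
        using w(2)[OF n] nat_facts(9,10)[OF w(1)[OF n]] nb(9,10) a(4) by simp
      with n show ?thesis by blast
    qed
    show ?thesis unfolding bij_betw_def inj_on_def set_eq_iff image_iff Ball_def Bex_def Cat_hom2
      using 1 2 w(1) by metis
  qed
  moreover have "G = H" if "G \<in> hom (Cat E) X (idom i)" "H \<in> hom (Cat E) X (idom i)"
      "ifun_comp E i G = ifun_comp E i H" for X G H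
    using internally_full_mono_cancel[OF i] that by (auto simp: Cat_hom)
  moreover have "Ob (hom_cat (Cat E) X Y) = hom (Cat E) X Y" for X Y by (simp add: hom_cat_def)
  ultimately show ?thesis unfolding full_mono_def fully_faithful_def Cat_sel post_fctr_def inj_on_def
    using F by simp
qed

text \<open>The converse reading of components: a generalised arrow is a 2-cell between the functors
  naming its endpoints. Over a discrete domain naturality only compares composites with identities,
  so the unit laws suffice.\<close>

lemma nat_disc:
  assumes A: "internal_category E A" and a: "a \<in> hom E Z (C1 A)"
  shows "nat_from (disc_obj E Z) A
    \<lparr>nsrc = disc_fun E A (isrc A \<cdot> a), ntrg = disc_fun E A (itrg A \<cdot> a), ncmp = a\<rparr>
    (disc_fun E A (isrc A \<cdot> a)) (disc_fun E A (itrg A \<cdot> a))"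
proof -
  note A' = ic_simps[OF A] and i = ic[OF A]
  note x = disc_fun_in[OF A comp_in[OF a A'(3)]] and y = disc_fun_in[OF A comp_in[OF a A'(4)]]
  show ?thesis
    using x y a id_right[OF a] internal_cat.icmp_id_left[OF i a] internal_cat.icmp_id_right[OF i a]
    by (intro nat_fromI) (simp_all add: disc_sel)
qed

lemma disc_fun_comp:
  assumes F: "internal_functor E F" and x: "x \<in> hom E Z (C0 (idom F))"
  shows "ifun_comp E F (disc_fun E (idom F) x) = disc_fun E (icod F) (F0 F \<cdot> x)"
proof -
  note f = fun_facts[OF F]
  show ?thesis using disc_fun_in[OF f(1) x] disc_fun_in[OF f(2) comp_in[OF x f(3)]] fun_id[OF F x]
    by (intro ifun_eqI) (simp_all add: ifun_comp_sel)
qed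

text \<open>On the discrete category on \<open>Z\<close>, postcomposition with \<open>i\<close> acts
  on generalised objects by \<open>F0 i\<close> and on generalised arrows by \<open>F1 i\<close>.
  Injectivity on objects and full faithfulness then become the two clauses at stage
  \<open>Z\<close>.\<close>

lemma full_mono_CatD:
  assumes i: "full_mono (Cat E) i" shows "internally_full_mono E i"
proof -
  have F: "internal_functor E i" using i by (simp add: full_mono_def Cat_sel)
  note f = fun_facts[OF F] note A = ic_simps[OF f(1)]
  have inj: "G = H" if "G \<in> hom (Cat E) X (idom i)" "H \<in> hom (Cat E) X (idom i)"
      "ifun_comp E i G = ifun_comp E i H" for X G H
    using i that category.hom_Ob1[OF category_Cat that(1)]
    by (auto simp: full_mono_def Cat_sel post_fctr_def inj_on_def hom_cat_def)
  have ff: "bij_betw (inat_hcomp E (inat_id E i)) (hom (hom_cat (Cat E) X (idom i)) G H)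
      (hom (hom_cat (Cat E) X (icod i)) (ifun_comp E i G) (ifun_comp E i H))"
    if "G \<in> hom (Cat E) X (idom i)" "H \<in> hom (Cat E) X (idom i)" for X G H
    using i that category.hom_Ob1[OF category_Cat that(1)]
    by (auto simp: full_mono_def fully_faithful_def Cat_sel post_fctr_def hom_cat_def)
  have dh: "disc_fun E (idom i) x \<in> hom (Cat E) (disc_obj E Z) (idom i)"
    if "x \<in> hom E Z (C0 (idom i))" for x Z
    using disc_fun_in[OF f(1) that] by (simp add: Cat_hom)
  have mono: "x = y" if x: "x \<in> hom E Z (C0 (idom i))" and y: "y \<in> hom E Z (C0 (idom i))"
    and e: "F0 i \<cdot> x = F0 i \<cdot> y" for x y Z
    using inj[OF dh[OF x] dh[OF y]] disc_fun_comp[OF F x] disc_fun_comp[OF F y] e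
      disc_fun_in(4)[OF f(1) x] disc_fun_in(4)[OF f(1) y] by metis
  have "\<exists>!a. a \<in> hom E Z (C1 (idom i)) \<and> isrc (idom i) \<cdot> a = x \<and> itrg (idom i) \<cdot> a = y \<and> F1 i \<cdot> a = b"
    if x: "x \<in> hom E Z (C0 (idom i))" and y: "y \<in> hom E Z (C0 (idom i))"
      and b: "b \<in> hom E Z (C1 (icod i))" "isrc (icod i) \<cdot> b = F0 i \<cdot> x" "itrg (icod i) \<cdot> b = F0 i \<cdot> y" for Z x y b
  proof -
    let ?x = "disc_fun E (idom i) x" and ?y = "disc_fun E (idom i) y"
    note c = disc_fun_comp[OF F x] disc_fun_comp[OF F y]
    note bij = ff[OF dh[OF x] dh[OF y], unfolded c]
    note w = whisker(2)[OF _ F refl refl]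
    \<comment> \<open>The arrow \<open>b\<close> viewed as a 2-cell; surjectivity of whiskering on
      2-cells provides its preimage.\<close>
    let ?b = "\<lparr>nsrc = disc_fun E (icod i) (F0 i \<cdot> x), ntrg = disc_fun E (icod i) (F0 i \<cdot> y), ncmp = b\<rparr>"
    have "?b \<in> hom (hom_cat (Cat E) (disc_obj E Z) (icod i)) (disc_fun E (icod i) (F0 i \<cdot> x)) (disc_fun E (icod i) (F0 i \<cdot> y))"
      using nat_disc[OF f(2) b(1)] b by (simp add: Cat_hom2)
    then have "?b \<in> inat_hcomp E (inat_id E i) ` hom (hom_cat (Cat E) (disc_obj E Z) (idom i)) ?x ?y"
      unfolding bij_betw_imp_surj_on[OF bij] .
    then obtain \<alpha> where ab: "inat_hcomp E (inat_id E i) \<alpha> = ?b"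
        and al: "nat_from (disc_obj E Z) (idom i) \<alpha> ?x ?y" unfolding Cat_hom2[symmetric] by (elim imageE) simp
    note n = nat_facts[OF al]
    have 1: "ncmp \<alpha> \<in> hom E Z (C1 (idom i))" "isrc (idom i) \<cdot> ncmp \<alpha> = x" "itrg (idom i) \<cdot> ncmp \<alpha> = y"
        "F1 i \<cdot> ncmp \<alpha> = b"
      using n disc_fun_in[OF f(1) x] disc_fun_in[OF f(1) y] w[OF al] ab by (simp_all add: disc_sel)
    have 2: "a = ncmp \<alpha>" if a: "a \<in> hom E Z (C1 (idom i))" "isrc (idom i) \<cdot> a = x" "itrg (idom i) \<cdot> a = y"
        "F1 i \<cdot> a = b" for a
    proof -
      \<comment> \<open>A competing \<open>a\<close> is a 2-cell with the same boundary and the same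
        image, so injectivity of whiskering identifies it with \<open>\<alpha>\<close>.\<close>
      let ?a = "\<lparr>nsrc = ?x, ntrg = ?y, ncmp = a\<rparr>"
      have an: "nat_from (disc_obj E Z) (idom i) ?a ?x ?y" using nat_disc[OF f(1) a(1)] a by simp
      note wa = whisker[OF an F refl refl]
      have "inat_hcomp E (inat_id E i) ?a = ?b"
        using nat_facts(9,10)[OF wa(1)] wa(2) a(4) c by simp
      then have "?a = \<alpha>"
        using inj_onD[OF bij_betw_imp_inj_on[OF bij]] an al ab unfolding Cat_hom2[symmetric] by simp
      then show ?thesis by auto
    qed
    show ?thesis using 1 2 by blast
  qed
  moreover have "is_mono E (F0 i)" unfolding is_mono_def hom_Dm[OF f(3)]
    using mono hom_Ar[OF f(3)] by blast
  ultimately show ?thesis unfolding internally_full_mono_def using F by simp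
qed

section \<open>Pullbacks in \<open>Cat E\<close> compared with pullbacks on objects\<close>

text \<open>Taking objects is right adjoint to the discrete category construction: cones over the
  object parts are cones of functors out of a discrete category, where the given universal property
  can be used.\<close>

lemma Cat_pullback_F0:
  assumes pb: "is_pullback (Cat E) f g p q"
  shows "is_pullback E (F0 f) (F0 g) (F0 p) (F0 q)"
proof -
  have F: "internal_functor E f" "internal_functor E g" "internal_functor E p" "internal_functor E q"
    and d: "icod f = icod g" "idom p = idom q" "icod p = idom f" "icod q = idom g"
    and com: "ifun_comp E f p = ifun_comp E g q"
    using pb by (auto simp: is_pullback_def Cat_sel)
  have un: "\<exists>!h. h \<in> hom (Cat E) X (idom p) \<and> ifun_comp E p h = u \<and> ifun_comp E q h = v"
    if "u \<in> hom (Cat E) X (idom f)" "v \<in> hom (Cat E) X (idom g)" "ifun_comp E f u = ifun_comp E g v" for X u v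
    using pb that unfolding is_pullback_def Cat_sel by blast
  note ff = fun_facts[OF F(1)] and gg = fun_facts[OF F(2)] and pp = fun_facts[OF F(3)] and qq = fun_facts[OF F(4)]
  note t = ff(3) gg(3) pp(3) qq(3)
  show ?thesis unfolding is_pullback_def
  proof (intro conjI allI ballI impI)
    show "F0 f \<cdot> F0 p = F0 g \<cdot> F0 q" using arg_cong[OF com, of F0] by (simp add: ifun_comp_sel)
    fix X u v assume "u \<in> hom E X (Dm E (F0 f))" "v \<in> hom E X (Dm E (F0 g))" and e: "F0 f \<cdot> u = F0 g \<cdot> v"
    then have u: "u \<in> hom E X (C0 (idom f))" and v: "v \<in> hom E X (C0 (idom g))" using t by (auto simp: hom_def)
    note du = disc_fun_in[OF ff(1) u] and dv = disc_fun_in[OF gg(1) v]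
    have "\<exists>!H. H \<in> hom (Cat E) (disc_obj E X) (idom p) \<and> ifun_comp E p H = disc_fun E (idom f) u \<and>
        ifun_comp E q H = disc_fun E (idom g) v" (is "\<exists>!H. ?P H")
      using du dv disc_fun_comp[OF F(1) u] disc_fun_comp[OF F(2) v] e d(1)
      by (intro un) (simp_all add: Cat_hom)
    then obtain H where H: "?P H" and Hu: "\<And>H'. ?P H' \<Longrightarrow> H' = H" by blast
    have H': "internal_functor E H" "idom H = disc_obj E X" "icod H = idom p" using H by (auto simp: Cat_hom)
    show "\<exists>!h. h \<in> hom E X (Dm E (F0 p)) \<and> F0 p \<cdot> h = u \<and> F0 q \<cdot> h = v"
    proof (rule ex1I[of _ "F0 H"], intro conjI)
      show "F0 H \<in> hom E X (Dm E (F0 p))" using fun_facts(3)[OF H'(1)] H' hom_Dm[OF pp(3)] by (simp add: disc_sel)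
      show "F0 p \<cdot> F0 H = u" "F0 q \<cdot> F0 H = v"
        using H du(4) dv(4) ifun_comp_sel(3)[of E p H] ifun_comp_sel(3)[of E q H] by simp_all
      fix h assume h: "h \<in> hom E X (Dm E (F0 p)) \<and> F0 p \<cdot> h = u \<and> F0 q \<cdot> h = v"
      then have hp: "h \<in> hom E X (C0 (idom p))" "h \<in> hom E X (C0 (idom q))" using hom_Dm[OF pp(3)] d(2) by auto
      have "?P (disc_fun E (idom p) h)"
        using disc_fun_in[OF pp(1) hp(1)] disc_fun_comp[OF F(3) hp(1)] disc_fun_comp[OF F(4) hp(2)] h d
        by (simp add: Cat_hom)
      then show "h = F0 H" using Hu disc_fun_in(4)[OF pp(1) hp(1)] by metis
    qed
  qed (use t d in \<open>auto simp: hom_def\<close>)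
qed

text \<open>The pullback on objects gives only the object part of a mediating functor. Fullness of
  \<open>p\<close> extends it to a functor, and cancelling \<open>g\<close> gives the remaining
  triangle.\<close>

lemma Cat_pullback2I:
  assumes f: "internal_functor E f" and q: "internal_functor E q"
    and g: "full_mono (Cat E) g" and p: "full_mono (Cat E) p"
    and d: "icod f = icod g" "idom p = idom q" "icod p = idom f" "icod q = idom g"
    and com: "ifun_comp E f p = ifun_comp E g q"
    and pb: "is_pullback E (F0 f) (F0 g) (F0 p) (F0 q)"
  shows "is_pullback2 (Cat E) f g p q"
proof (rule two_category.is_pullback2I[OF two_category_Cat _ g p])
  interpret T: category "Cat E" by (rule category_Cat)
  note gi = full_mono_CatD[OF g] and pi = full_mono_CatD[OF p]
  have g': "internal_functor E g" and p': "internal_functor E p" using gi pi by (auto simp: internally_full_mono_def)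
  show "is_pullback (Cat E) f g p q" unfolding is_pullback_def Cat_sel
  proof (intro conjI allI ballI impI)
    fix X U V assume U: "U \<in> hom (Cat E) X (idom f)" and V: "V \<in> hom (Cat E) X (idom g)"
      and e: "ifun_comp E f U = ifun_comp E g V"
    then have U': "internal_functor E U" "idom U = X" "icod U = idom f"
      and V': "internal_functor E V" "idom V = X" "icod V = idom g" by (auto simp: Cat_hom)
    have "F0 f \<cdot> F0 U = F0 g \<cdot> F0 V" using arg_cong[OF e, of F0] by (simp add: ifun_comp_sel)
    moreover have "F0 U \<in> hom E (C0 X) (Dm E (F0 f))" "F0 V \<in> hom E (C0 X) (Dm E (F0 g))"
      using fun_facts(3)[OF U'(1)] fun_facts(3)[OF V'(1)] U' V' hom_Dm[OF fun_facts(3)[OF f]] hom_Dm[OF fun_facts(3)[OF g']]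
      by simp_all
    ultimately obtain h where h: "h \<in> hom E (C0 X) (Dm E (F0 p))" "F0 p \<cdot> h = F0 U"
      using pb unfolding is_pullback_def by blast
    have h': "h \<in> hom E (C0 (idom U)) (C0 (idom p))" using h U' hom_Dm[OF fun_facts(3)[OF p']] by simp
    obtain H where H: "internal_functor E H" "idom H = X" "icod H = idom p" "ifun_comp E p H = U"
      using internally_full_mono_lift[OF pi U'(1) _ h' h(2)] U' d by metis
    have Hh: "H \<in> hom (Cat E) X (idom p)" using H by (simp add: Cat_hom)
    have th: "f \<in> hom (Cat E) (idom f) (icod g)" "g \<in> hom (Cat E) (idom g) (icod g)"
      "p \<in> hom (Cat E) (idom p) (idom f)" "q \<in> hom (Cat E) (idom p) (idom g)"
      using f g' p' q d by (auto simp: Cat_hom)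
    \<comment> \<open>The triangle with \<open>q\<close> is checked after \<open>g\<close>, where
      the commuting square turns it into \<open>e\<close>.\<close>
    have "ifun_comp E g (ifun_comp E q H) = ifun_comp E g V"
      using T.assoc[OF Hh th(3) th(1)] T.assoc[OF Hh th(4) th(2)] com e H(4) by (simp add: Cat_sel)
    moreover have "ifun_comp E q H \<in> hom (Cat E) X (idom g)" using T.comp_in[OF Hh th(4)] by (simp add: Cat_sel)
    ultimately have "ifun_comp E q H = V"
      using internally_full_mono_cancel[OF gi, of "ifun_comp E q H" V] V' by (simp add: Cat_hom)
    then have "H \<in> hom (Cat E) X (idom p) \<and> ifun_comp E p H = U \<and> ifun_comp E q H = V" using Hh H(4) by simp
    moreover have "H' = H" if "H' \<in> hom (Cat E) X (idom p) \<and> ifun_comp E p H' = U \<and> ifun_comp E q H' = V" for H'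
      using internally_full_mono_cancel[OF pi, of H' H] H that by (simp add: Cat_hom)
    ultimately show "\<exists>!H. H \<in> hom (Cat E) X (idom p) \<and> ifun_comp E p H = U \<and> ifun_comp E q H = V"
      by (rule ex1I)
  qed (use f g' p' q com in \<open>simp_all add: d\<close>)
qed

section \<open>From a full subobject classifier to a subobject classifier\<close>

text \<open>An arrow of a discrete category has equal endpoints, so monicity of \<open>m\<close>
  gives \<open>x = y\<close>, and this common element is the required lift.\<close>

lemma full_mono_disc:
  assumes m: "is_mono E m" "m \<in> hom E S X"
  shows "full_mono (Cat E) (disc_fun E (disc_obj E X) m)"
proof (rule full_mono_CatI)
  note S = hom_Ob1[OF m(2)] and X = hom_Ob2[OF m(2)]
  have "m \<in> hom E S (C0 (disc_obj E X))" using m(2) by (simp add: disc_sel)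
  note d = disc_fun_in[OF disc_internal[OF X] this, unfolded disc_sel id_left[OF m(2)]]
  have mm: "x = y" if "x \<in> hom E Z S" "y \<in> hom E Z S" "m \<cdot> x = m \<cdot> y" for Z x y
    using m that hom_Dm[OF m(2)] unfolding is_mono_def by auto
  show "internally_full_mono E (disc_fun E (disc_obj E X) m)"
    unfolding internally_full_mono_def d disc_sel
  proof (intro conjI d m allI ballI impI)
    fix Z x y b assume x: "x \<in> hom E Z S" and y: "y \<in> hom E Z S" and b: "b \<in> hom E Z X"
      and e: "Ide E X \<cdot> b = m \<cdot> x \<and> Ide E X \<cdot> b = m \<cdot> y"
    then have "x = y" "m \<cdot> x = b" using mm[OF x y] id_left[OF b] by auto
    then show "\<exists>!a. a \<in> hom E Z S \<and> Ide E S \<cdot> a = x \<and> Ide E S \<cdot> a = y \<and> m \<cdot> a = b"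
      using x id_left by metis
  qed
qed

theorem subobject_classifier_F0:
  assumes T: "full_subobject_classifier (Cat E) T"
  shows "subobject_classifier E (F0 T)"
proof -
  let ?I = "idom T"
  have Tm: "full_mono (Cat E) T" and ter: "is_terminal (Cat E) ?I"
    and cl: "\<And>i. full_mono (Cat E) i \<Longrightarrow> \<exists>!\<chi>. \<chi> \<in> hom (Cat E) (icod i) (icod T) \<and>
      is_pullback2 (Cat E) \<chi> T i (bang (Cat E) (idom i) ?I)"
    using T by (auto simp: full_subobject_classifier_def Cat_sel is_terminal2_def)
  have TF: "internal_functor E T" using full_mono_CatD[OF Tm] by (simp add: internally_full_mono_def)
  note t = fun_facts[OF TF] note I0 = ic_simps(1)[OF t(1)]
  have T0: "F0 T \<in> hom E (C0 ?I) (C0 (icod T))" by (rule t(3))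
  \<comment> \<open>Maps from \<open>X\<close> to \<open>C0 ?I\<close> are functors from the
    discrete category on \<open>X\<close> to the terminal object.\<close>
  have ter0: "is_terminal E (C0 ?I)" unfolding is_terminal_def
  proof (intro conjI ballI I0)
    fix X assume X: "X \<in> Ob E"
    then obtain F where F: "F \<in> hom (Cat E) (disc_obj E X) ?I" and Fu: "\<And>G. G \<in> hom (Cat E) (disc_obj E X) ?I \<Longrightarrow> G = F"
      using ter disc_internal[OF X] unfolding is_terminal_def Cat_sel by blast
    show "\<exists>!f. f \<in> hom E X (C0 ?I)"
    proof (rule ex1I[of _ "F0 F"])
      show "F0 F \<in> hom E X (C0 ?I)" using F fun_facts(3)[of F] by (auto simp: Cat_hom disc_sel)
      show "x = F0 F" if "x \<in> hom E X (C0 ?I)" for x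
        using Fu[of "disc_fun E ?I x"] disc_fun_in[OF t(1) that] by (auto simp: Cat_hom)
    qed
  qed
  have teq: "x = y" if "x \<in> hom E X (C0 ?I)" "y \<in> hom E X (C0 ?I)" for X x y
    using ter0 that hom_Ob1[OF that(1)] unfolding is_terminal_def by blast
  show ?thesis unfolding subobject_classifier_def hom_Dm[OF T0] hom_Cd[OF T0]
  proof (intro conjI ter0 allI impI)
    show "is_mono E (F0 T)" unfolding is_mono_def hom_Dm[OF T0] using hom_Ar[OF T0] teq by blast
    fix m assume m: "is_mono E m"
    let ?S = "Dm E m" let ?X = "Cd E m" let ?d = "disc_fun E (disc_obj E ?X) m"
    let ?b = "bang (Cat E) (disc_obj E ?S) ?I"
    have mh: "m \<in> hom E ?S ?X" using m by (simp add: is_mono_def hom_def)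
    note S = hom_Ob1[OF mh] and X = hom_Ob2[OF mh]
    have mh': "m \<in> hom E ?S (C0 (disc_obj E ?X))" using mh by (simp add: disc_sel)
    note d = disc_fun_in[OF disc_internal[OF X] mh', unfolded disc_sel id_left[OF mh]]
    note dm = full_mono_disc[OF m mh]
    have "?b \<in> hom (Cat E) (disc_obj E ?S) ?I" using bang_in[OF ter] disc_internal[OF S] by (simp add: Cat_sel)
    then have b: "internal_functor E ?b" "idom ?b = disc_obj E ?S" "icod ?b = ?I" by (auto simp: Cat_hom)
    have b0: "F0 ?b = bang E ?S (C0 ?I)"
      using teq[OF _ bang_in[OF ter0 S]] fun_facts(3)[OF b(1)] b by (simp add: disc_sel)
    obtain \<chi> where ch: "\<chi> \<in> hom (Cat E) (disc_obj E ?X) (icod T)" "is_pullback2 (Cat E) \<chi> T ?d ?b"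
      and chu: "\<And>\<chi>'. \<chi>' \<in> hom (Cat E) (disc_obj E ?X) (icod T) \<Longrightarrow> is_pullback2 (Cat E) \<chi>' T ?d ?b \<Longrightarrow> \<chi>' = \<chi>"
      using cl[OF dm] unfolding d by blast
    show "\<exists>!\<chi>. \<chi> \<in> hom E ?X (C0 (icod T)) \<and> is_pullback E \<chi> (F0 T) m (bang E ?S (C0 ?I))"
    proof (rule ex1I[of _ "F0 \<chi>"], intro conjI)
      show "F0 \<chi> \<in> hom E ?X (C0 (icod T))" using ch(1) fun_facts(3)[of \<chi>] by (auto simp: Cat_hom disc_sel)
      show "is_pullback E (F0 \<chi>) (F0 T) m (bang E ?S (C0 ?I))"
        using Cat_pullback_F0[of \<chi> T ?d ?b] ch(2) b0 d(4) by (simp add: is_pullback2_def)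
      fix x assume x: "x \<in> hom E ?X (C0 (icod T)) \<and> is_pullback E x (F0 T) m (bang E ?S (C0 ?I))"
      then have xh: "x \<in> hom E ?X (C0 (icod T))" and xp: "is_pullback E x (F0 T) m (bang E ?S (C0 ?I))" by auto
      let ?x = "disc_fun E (icod T) x"
      note xd = disc_fun_in[OF t(2) xh]
      \<comment> \<open>Both composites start at a discrete category, so equality of their object
        parts is enough.\<close>
      have "ifun_comp E ?x ?d = ifun_comp E T ?b"
      proof -
        have "ifun_comp E ?x ?d = disc_fun E (icod T) (F0 (ifun_comp E ?x ?d))"
          using fun_comp_in[OF d(1) xd(1)] d xd
          by (intro disc_fun_unique[of _ ?S]) (simp_all add: ifun_comp_sel)
        moreover have "ifun_comp E T ?b = disc_fun E (icod T) (F0 (ifun_comp E T ?b))"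
          using fun_comp_in[OF b(1) TF] b
          by (intro disc_fun_unique[of _ ?S]) (simp_all add: ifun_comp_sel)
        moreover have "x \<cdot> m = F0 T \<cdot> F0 ?b" using xp b0 by (simp add: is_pullback_def)
        ultimately show ?thesis using xd(4) d(4) by (simp add: ifun_comp_sel)
      qed
      then have "is_pullback2 (Cat E) ?x T ?d ?b"
        using xd d b xp b0 by (intro Cat_pullback2I[OF xd(1) b(1) Tm dm]) simp_all
      then have "?x = \<chi>" using xd by (intro chu) (simp_all add: Cat_hom)
      then show "x = F0 \<chi>" using xd(4) by metis
    qed
  qed
qed

end

context indisc_category begin

section \<open>Functors into indiscrete categories\<close>

text \<open>Compatibility with source and target prescribes both projections of the arrow
  part.\<close>

lemma indisc_fun_unique:
  assumes F: "internal_functor E F" "icod F = indisc_obj E X" and G: "internal_functor E G" "icod G = indisc_obj E X"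
    and e: "idom F = idom G" "F0 F = F0 G" and X: "X \<in> Ob E"
  shows "F = G"
proof -
  note f = fun_facts[OF F(1), unfolded F(2) indisc_sel] and g = fun_facts[OF G(1), unfolded G(2) indisc_sel]
  have "F1 F = F1 G" by (rule pr_eqI[OF f(4) g(4)[folded e(1)] X X]) (use f g e in simp_all)
  then show ?thesis using e F G by simp
qed

text \<open>An arrow is sent to the pair of images of its endpoints; the functor laws are compared
  under the two projections.\<close>

lemma indisc_fun_ex:
  assumes A: "internal_category E A" and x: "x \<in> hom E (C0 A) X"
  obtains F where "internal_functor E F" "idom F = A" "icod F = indisc_obj E X" "F0 F = x"
proof -
  note a = ic_simps[OF A] and X = hom_Ob2[OF x]
  let ?f = "pr_pair E (x \<cdot> isrc A) (x \<cdot> itrg A)"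
  let ?F = "\<lparr>idom = A, icod = indisc_obj E X, F0 = x, F1 = ?f\<rparr>"
  note f = pr_pair_facts[OF comp_in[OF a(3) x] comp_in[OF a(4) x]]
  note p = pr_in[OF X X]
  note e = ic_simps(5)[OF indisc_internal[OF X], unfolded indisc_sel]
  interpret A: internal_cat E A by (rule ic[OF A])
  interpret X: internal_cat E "indisc_obj E X" by (rule ic[OF indisc_internal[OF X]])
  have se: "isrc A \<cdot> iid A = Ide E (C0 A)" "itrg A \<cdot> iid A = Ide E (C0 A)"
    "isrc A \<cdot> imul A = isrc A \<cdot> pb2 E (isrc A) (itrg A)" "itrg A \<cdot> imul A = itrg A \<cdot> pb1 E (isrc A) (itrg A)"
    using A by (auto simp: internal_category_def Let_def)
  have i: "?f \<cdot> iid A = iid (indisc_obj E X) \<cdot> x"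
    by (rule pr_eqI[OF comp_in[OF a(5) f(1)] comp_in[OF x e] X X])
      (use assoc[OF a(5) f(1) p(1)] assoc[OF a(5) f(1) p(2)] f assoc[OF a(5) a(3) x] assoc[OF a(5) a(4) x]
        se id_right[OF x] X.src_id[unfolded indisc_sel, OF x] X.trg_id[unfolded indisc_sel, OF x] in simp_all)
  let ?p = "pb1 E (isrc A) (itrg A)" let ?q = "pb2 E (isrc A) (itrg A)"
  note b = pb1_in[OF a(3,4)] pb2_in[OF a(3,4)]
  note fp = comp_in[OF b(1) f(1)] and fq = comp_in[OF b(2) f(1)]
  have as: "pr1 E X X \<cdot> (?f \<cdot> k) = x \<cdot> (isrc A \<cdot> k)" "pr2 E X X \<cdot> (?f \<cdot> k) = x \<cdot> (itrg A \<cdot> k)"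
    if k: "k \<in> hom E Z (C1 A)" for k Z
    using assoc[OF k f(1) p(1)] assoc[OF k f(1) p(2)] assoc[OF k a(3) x] assoc[OF k a(4) x] f by simp_all
  have c: "pr1 E X X \<cdot> (?f \<cdot> ?p) = pr2 E X X \<cdot> (?f \<cdot> ?q)"
    using as[OF b(1)] as[OF b(2)] pb_comm[OF a(3,4)] by simp
  note ii = indisc_icmp[OF X fp fq c]
  have m: "?f \<cdot> imul A = icmp E (indisc_obj E X) (?f \<cdot> ?p) (?f \<cdot> ?q)"
    by (rule pr_eqI[OF comp_in[OF a(6) f(1)] ii(1) X X])
      (use ii as[OF a(6)] as[OF b(1)] as[OF b(2)] se in simp_all)
  have "internal_functor E ?F" unfolding internal_functor_def Let_def
    using A indisc_internal[OF X] x f i m by (simp add: indisc_sel)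
  then show ?thesis using that[of ?F] by simp
qed

text \<open>Parallel maps into \<open>T\<close> agree, hence so do parallel maps into its square.
  The first gives uniqueness of functors, the second that of components of 2-cells.\<close>

lemma indisc_terminal:
  assumes T: "is_terminal E T" shows "is_terminal2 (Cat E) (indisc_obj E T)"
proof -
  have T0: "T \<in> Ob E" using T by (simp add: is_terminal_def)
  have teq: "x = y" if "x \<in> hom E X T" "y \<in> hom E X T" for X x y
    using T that hom_Ob1[OF that(1)] unfolding is_terminal_def by blast
  have peq: "x = y" if "x \<in> hom E X (pr_obj E T T)" "y \<in> hom E X (pr_obj E T T)" for X x y
    using pr_eqI[OF that T0 T0] teq comp_in that pr_in[OF T0 T0] by meson
  have ex: "\<exists>!F. internal_functor E F \<and> idom F = A \<and> icod F = indisc_obj E T" if A: "internal_category E A" for A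
  proof -
    obtain F where F: "internal_functor E F" "idom F = A" "icod F = indisc_obj E T"
      using indisc_fun_ex[OF A bang_in[OF T ic_simps(1)[OF A]]] by blast
    have "G = F" if "internal_functor E G" "idom G = A" "icod G = indisc_obj E T" for G
      using indisc_fun_unique[OF that(1,3) F(1,3) _ _ T0] that F teq fun_facts(3)[OF that(1)] fun_facts(3)[OF F(1)]
      by (simp add: indisc_sel)
    then show ?thesis using F by blast
  qed
  have "\<exists>!\<alpha>. nat_from A (indisc_obj E T) \<alpha> (nsrc \<alpha>) (ntrg \<alpha>)" if A: "internal_category E A" for A
  proof -
    obtain F where F: "internal_functor E F" "idom F = A" "icod F = indisc_obj E T" using ex[OF A] by blast
    note n = nat_id[OF F] note nf = nat_facts[OF n]
    show ?thesis
    proof (rule ex1I[of _ "inat_id E F"])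
      show "nat_from A (indisc_obj E T) (inat_id E F) (nsrc (inat_id E F)) (ntrg (inat_id E F))"
        using n by (simp add: inat_id_def)
      fix \<alpha> assume "nat_from A (indisc_obj E T) \<alpha> (nsrc \<alpha>) (ntrg \<alpha>)"
      note na = nat_facts[OF this]
      have "nsrc \<alpha> = F" "ntrg \<alpha> = F" using ex[OF A] F na by blast+
      moreover have "ncmp \<alpha> = ncmp (inat_id E F)" using peq na(11) nf(11) by (simp add: indisc_sel)
      ultimately show "\<alpha> = inat_id E F" using nf(9,10) by simp
    qed
  qed
  then show ?thesis unfolding is_terminal2_def is_terminal_def Cat_Ar2 Cat_hom
    using ex indisc_internal[OF T0] by (simp add: Cat_sel)
qed

text \<open>The lift of \<open>b\<close> must be the pair of \<open>x\<close> and \<open>y\<close>;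
  its image is \<open>b\<close> because both have the same projections.\<close>

lemma full_mono_indisc:
  assumes m: "is_mono E m" shows "full_mono (Cat E) (indisc_arr E m)"
proof (rule full_mono_CatI)
  let ?S = "Dm E m" let ?X = "Cd E m"
  have mh: "m \<in> hom E ?S ?X" using m by (simp add: is_mono_def hom_def)
  note S = hom_Ob1[OF mh] and X = hom_Ob2[OF mh]
  note i = indisc_functor[OF mh] note f = pr_map_facts[OF mh mh] and p = pr_in[OF S S] and px = pr_in[OF X X]
  show "internally_full_mono E (indisc_arr E m)" unfolding internally_full_mono_def i(2-5) indisc_sel
  proof (intro conjI i(1) m allI ballI impI)
    fix Z x y b assume x: "x \<in> hom E Z ?S" and y: "y \<in> hom E Z ?S" and b: "b \<in> hom E Z (pr_obj E ?X ?X)"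
      and e: "pr1 E ?X ?X \<cdot> b = m \<cdot> x \<and> pr2 E ?X ?X \<cdot> b = m \<cdot> y"
    have "pr_map E m m \<cdot> a = b" if a: "a \<in> hom E Z (pr_obj E ?S ?S)" "pr1 E ?S ?S \<cdot> a = x" "pr2 E ?S ?S \<cdot> a = y" for a
      by (rule pr_eqI[OF comp_in[OF a(1) f(1)] b X X])
        (use assoc[OF a(1) f(1) px(1)] assoc[OF a(1) f(1) px(2)] assoc[OF a(1) p(1) mh] assoc[OF a(1) p(2) mh] f a e in simp_all)
    then show "\<exists>!a. a \<in> hom E Z (pr_obj E ?S ?S) \<and> pr1 E ?S ?S \<cdot> a = x \<and> pr2 E ?S ?S \<cdot> a = y \<and> pr_map E m m \<cdot> a = b"
      using pr_ex1[OF x y] by metis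
  qed
qed

section \<open>From a subobject classifier to a full subobject classifier\<close>

theorem full_subobject_classifier_indisc:
  assumes t: "subobject_classifier E t"
  shows "full_subobject_classifier (Cat E) (indisc_arr E t)"
proof -
  let ?I = "Dm E t" let ?O = "Cd E t" let ?T = "indisc_arr E t"
  have tm: "is_mono E t" and ter: "is_terminal E ?I"
    and cl: "\<And>i. is_mono E i \<Longrightarrow> \<exists>!\<chi>. \<chi> \<in> hom E (Cd E i) ?O \<and> is_pullback E \<chi> t i (bang E (Dm E i) ?I)"
    using t by (auto simp: subobject_classifier_def)
  have th: "t \<in> hom E ?I ?O" using tm by (simp add: is_mono_def hom_def)
  note T = indisc_functor[OF th] and Tm = full_mono_indisc[OF tm] and ter2 = indisc_terminal[OF ter]
  note O = hom_Ob2[OF th]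
  have ter1: "is_terminal (Cat E) (indisc_obj E ?I)" using ter2 by (simp add: is_terminal2_def)
  show ?thesis unfolding full_subobject_classifier_def Cat_sel T(2,3)
  proof (intro conjI Tm ter2 allI impI)
    fix i assume im: "full_mono (Cat E) i"
    let ?b = "bang (Cat E) (idom i) (indisc_obj E ?I)"
    have i: "internal_functor E i" and m0: "is_mono E (F0 i)"
      using full_mono_CatD[OF im] by (auto simp: internally_full_mono_def)
    note f = fun_facts[OF i]
    have "?b \<in> hom (Cat E) (idom i) (indisc_obj E ?I)" using bang_in[OF ter1] f(1) by (simp add: Cat_sel)
    then have b: "internal_functor E ?b" "idom ?b = idom i" "icod ?b = indisc_obj E ?I" by (auto simp: Cat_hom)
    have bb: "bang E (C0 (idom i)) ?I \<in> hom E (C0 (idom i)) ?I" using bang_in[OF ter] ic_simps(1)[OF f(1)] by simp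
    then have b0: "F0 ?b = bang E (C0 (idom i)) ?I"
      using fun_facts(3)[OF b(1)] b ter ic_simps(1)[OF f(1)] unfolding is_terminal_def by (auto simp: indisc_sel)
    \<comment> \<open>The monic object part \<open>F0 i\<close> is classified in \<open>E\<close>;
      its classifying map becomes the object part of \<open>\<chi>\<close>.\<close>
    obtain x where x: "x \<in> hom E (C0 (icod i)) ?O" "is_pullback E x t (F0 i) (F0 ?b)"
      and xu: "\<And>y. y \<in> hom E (C0 (icod i)) ?O \<Longrightarrow> is_pullback E y t (F0 i) (F0 ?b) \<Longrightarrow> y = x"
      using cl[OF m0] unfolding hom_Dm[OF f(3)] hom_Cd[OF f(3)] b0 by blast
    obtain \<chi> where c: "internal_functor E \<chi>" "idom \<chi> = icod i" "icod \<chi> = indisc_obj E ?O" "F0 \<chi> = x"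
      using indisc_fun_ex[OF f(2) x(1)] by blast
    have "ifun_comp E \<chi> i = ifun_comp E ?T ?b"
      using fun_comp_in[OF i c(1)] fun_comp_in[OF b(1) T(1)] c T b x(2)
      by (intro indisc_fun_unique[OF _ _ _ _ _ _ O]) (simp_all add: ifun_comp_sel is_pullback_def)
    then have "is_pullback2 (Cat E) \<chi> ?T i ?b"
      using c T b x by (intro Cat_pullback2I[OF c(1) b(1) Tm im]) simp_all
    then have "\<chi> \<in> hom (Cat E) (icod i) (indisc_obj E ?O) \<and> is_pullback2 (Cat E) \<chi> ?T i ?b"
      using c by (simp add: Cat_hom)
    moreover have "\<chi>' = \<chi>" if c': "\<chi>' \<in> hom (Cat E) (icod i) (indisc_obj E ?O) \<and> is_pullback2 (Cat E) \<chi>' ?T i ?b" for \<chi>'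
    proof -
      have ch: "internal_functor E \<chi>'" "idom \<chi>' = icod i" "icod \<chi>' = indisc_obj E ?O" using c' by (auto simp: Cat_hom)
      \<comment> \<open>Pullbacks in \<open>Cat E\<close> restrict to objects, so
        \<open>F0 \<chi>'\<close> also classifies \<open>F0 i\<close>; the indiscrete codomain then
        determines the whole functor.\<close>
      have "F0 \<chi>' = x"
        using fun_facts(3)[OF ch(1)] ch Cat_pullback_F0[of \<chi>' ?T i ?b] c' T(4)
        by (intro xu) (simp_all add: indisc_sel is_pullback2_def)
      then show ?thesis using ch c by (intro indisc_fun_unique[OF ch(1,3) c(1,3) _ _ O]) simp_all
    qed
    ultimately show "\<exists>!\<chi>. \<chi> \<in> hom (Cat E) (icod i) (indisc_obj E ?O) \<and> is_pullback2 (Cat E) \<chi> ?T i ?b"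
      by (rule ex1I)
  qed
qed

end

theorem theorem7p7:
  fixes E :: "('o, 'm) cat"
  assumes "category E"
    and "has_finite_limits E"
    and "extensive E"
    and "cartesian_closed E"
  shows "((\<exists>t. subobject_classifier E t) \<longleftrightarrow> (\<exists>t. full_subobject_classifier (Cat E) t)) \<and>
    ((\<exists>t. subobject_classifier E t) \<longrightarrow>
       preserves_full_subobject_classifiers (locally_discrete E) (Cat E) (indisc E))"
proof -
  interpret category E by (rule assms(1))
  interpret indisc_category E
    using assms(4) finite_limits_pullbacks[OF assms(1,2)] by unfold_locales (simp_all add: cartesian_closed_def)
  \<comment> \<open>In the locally discrete 2-category a full subobject classifier is just a
    subobject classifier, so preservation is the same statement as the forward direction.\<close>
  show ?thesis
    using full_subobject_classifier_indisc subobject_classifier_F0 ld_full_subobject_classifier[OF assms(1)]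
    by (auto simp: preserves_full_subobject_classifiers_def indisc_def)
qed

end
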